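(* Let $t$ be a transcendental real number and let $G_t$ be the subgroup of $\mathrm{GL}_2(\mathbb Q(t))$ consisting of all matrices $\begin{pmatrix} a & b\\ 0 & 1\end{pmatrix}$ with $a,b\in\mathbb Q(t)$ and $a>0$. Then $G_t$ belongs to $\mathbf H_3\mathfrak F$.
   Context: Here $\mathbb Q(t)$ is the subfield of $\mathbb R$ generated by $t$, so that $a>0$ makes sense. $\mathfrak F$ is the class of all finite groups. A $G$-complex is a $G$-CW-complex (in the sense of tom Dieck), so an element of $G$ that maps a cell to itself fixes that cell pointwise. Set $\mathbf H_0\mathfrak F=\mathfrak F$ and, for each integer $n\ge1$, let $\mathbf H_n\mathfrak F$ be the class of all (discrete) groups $G$ that admit a finite dimensional contractible $G$-complex with all stabilizers in $\mathbf H_{n-1}\mathfrak F$. *)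

theory Defs
  imports
    "HOL-Analysis.Analysis"
    "HOL-Algebra.Algebra"
    "HOL-Algebra.Left_Coset"
    "HOL-Algebra.Algebraic_Closure_Type"
begin

definition closed_disc :: "nat \<Rightarrow> (nat \<Rightarrow> real) topology" where
  "closed_disc n = subtopology (Euclidean_space n) {x. (\<Sum>i<n. x i ^ 2) \<le> 1}"

text \<open>For \<open>n = 0\<close> the disc is a point and its boundary is empty.\<close>

definition disc_boundary :: "nat \<Rightarrow> (nat \<Rightarrow> real) set" where
  "disc_boundary n = {x \<in> topspace (closed_disc n). (\<Sum>i<n. x i ^ 2) = 1}"

text \<open>
  \<open>B\<close> arises from \<open>A\<close> by attaching equivariant \<open>n\<close>-cells \<open>G/H \<times> D\<^sup>n\<close>, where \<open>A\<close> and \<open>B\<close> carry the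
  subspace topologies from \<open>Y\<close>: the square formed by the attaching maps
  \<open>\<Coprod> G/H \<times> S\<^bsup>n-1\<^esup> \<rightarrow> A\<close> and the characteristic maps \<open>\<Coprod> G/H \<times> D\<^sup>n \<rightarrow> B\<close> is a pushout of
  \<open>G\<close>-spaces. The last two conjuncts spell out the pushout as a set and as a space. The family of
  equivariant cells is given by the set \<open>\<C>\<close> of pairs \<open>(H, \<Phi>)\<close> of a cell stabilizer and a
  characteristic map.
\<close>

definition attach_equivariant_cells ::
  "('g, 'r) monoid_scheme \<Rightarrow> 'x topology \<Rightarrow> ('g \<Rightarrow> 'x \<Rightarrow> 'x) \<Rightarrow> nat \<Rightarrow> 'x set \<Rightarrow> 'x set \<Rightarrow> bool" where
  "attach_equivariant_cells G Y \<phi> n A B \<longleftrightarrow>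
     A \<subseteq> B \<and>
     (\<exists>\<C> :: ('g set \<times> ('g set \<times> (nat \<Rightarrow> real) \<Rightarrow> 'x)) set.
        (\<forall>(H, \<Phi>) \<in> \<C>.
           subgroup H G \<and>
           continuous_map
             (prod_topology (discrete_topology (lcosets\<^bsub>G\<^esub> H)) (closed_disc n))
             (subtopology Y B) \<Phi> \<and>
           (\<forall>g \<in> carrier G. \<forall>C \<in> lcosets\<^bsub>G\<^esub> H. \<forall>x \<in> topspace (closed_disc n).
              \<Phi> (g <#\<^bsub>G\<^esub> C, x) = \<phi> g (\<Phi> (C, x))) \<and>
           \<Phi> ` ((lcosets\<^bsub>G\<^esub> H) \<times> disc_boundary n) \<subseteq> A) \<and>
        bij_betw (\<lambda>((H, \<Phi>), p). \<Phi> p)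
          (SIGMA (H, \<Phi>) : \<C>. (lcosets\<^bsub>G\<^esub> H) \<times> (topspace (closed_disc n) - disc_boundary n))
          (B - A) \<and>
        (\<forall>U. U \<subseteq> B \<longrightarrow>
           (openin (subtopology Y B) U \<longleftrightarrow>
              openin (subtopology Y A) (U \<inter> A) \<and>
              (\<forall>(H, \<Phi>) \<in> \<C>.
                 openin (prod_topology (discrete_topology (lcosets\<^bsub>G\<^esub> H)) (closed_disc n))
                   {p \<in> (lcosets\<^bsub>G\<^esub> H) \<times> topspace (closed_disc n). \<Phi> p \<in> U}))))"

text \<open>
  \<open>G\<close>-CW-complexes in the sense of tom Dieck for a discrete group \<open>G\<close>; \<open>S n\<close> is the \<open>n\<close>-skeleton.
  Invariance of the skeleta under \<open>G\<close> follows from equivariance of the characteristic maps.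
\<close>

definition G_CW_complex ::
  "('g, 'r) monoid_scheme \<Rightarrow> 'x topology \<Rightarrow> ('g \<Rightarrow> 'x \<Rightarrow> 'x) \<Rightarrow> (nat \<Rightarrow> 'x set) \<Rightarrow> bool" where
  "G_CW_complex G Y \<phi> S \<longleftrightarrow>
     group G \<and> group_action G (topspace Y) \<phi> \<and>
     (\<forall>g \<in> carrier G. continuous_map Y Y (\<phi> g)) \<and>
     (\<forall>n. attach_equivariant_cells G Y \<phi> n (if n = 0 then {} else S (n - 1)) (S n)) \<and>
     topspace Y = (\<Union>n. S n) \<and>
     (\<forall>U. U \<subseteq> topspace Y \<longrightarrow>
        (openin Y U \<longleftrightarrow> (\<forall>n. openin (subtopology Y (S n)) (U \<inter> S n))))"

text \<open>
  The library's \<open>contractible_space\<close> holds of the empty space, which is therefore excluded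
  explicitly.
\<close>

definition findim_contractible_G_complex ::
  "('g, 'r) monoid_scheme \<Rightarrow> 'x topology \<Rightarrow> ('g \<Rightarrow> 'x \<Rightarrow> 'x) \<Rightarrow> bool" where
  "findim_contractible_G_complex G Y \<phi> \<longleftrightarrow>
     (\<exists>S. G_CW_complex G Y \<phi> S \<and> (\<exists>d. topspace Y = S d)) \<and>
     topspace Y \<noteq> {} \<and> contractible_space Y"

text \<open>
  HOL cannot quantify over types inside a definition, so the points of the complexes are drawn from
  one type, in which a point can be recorded as a coset and a number labelling its open cell together
  with its coordinates in the disc. This is no restriction. A finite dimensional contractible
  \<open>G\<close>-complex contains a contractible \<open>G\<close>-subcomplex with at most \<open>max |G| \<aleph>\<^sub>0\<close> cells: start with the
  orbit of a vertex and repeatedly adjoin \<open>G\<close>-orbits of finite subcomplexes in which the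
  (at most \<open>max |G| \<aleph>\<^sub>0\<close> many) homotopy classes of maps from spheres become trivial. The point
  stabilizers of the subcomplex are among those of the complex, and its points inject into this type.
\<close>

type_synonym 'g complex_point = "'g set \<times> nat \<times> (nat \<Rightarrow> real)"

primrec HF :: "nat \<Rightarrow> 'g monoid \<Rightarrow> bool" where
  "HF 0 G \<longleftrightarrow> group G \<and> finite (carrier G)"
| "HF (Suc n) G \<longleftrightarrow>
     group G \<and>
     (\<exists>(Y :: 'g complex_point topology) \<phi>.
        findim_contractible_G_complex G Y \<phi> \<and>
        (\<forall>x \<in> topspace Y. HF n (G\<lparr>carrier := stabilizer G \<phi> x\<rparr>)))"

text \<open>The subfield \<open>\<rat>(t)\<close> of \<open>\<real>\<close>; its order is that of \<open>\<real>\<close>.\<close>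

definition rational_functions_at :: "real \<Rightarrow> real set" where
  "rational_functions_at t = generate_field (ring_of_type_algebra :: real ring) {t}"

definition mat2_monoid :: "real set \<Rightarrow> (real^2^2) monoid" where
  "mat2_monoid K = \<lparr>carrier = {A. \<forall>i j. A $ i $ j \<in> K}, mult = (**), one = mat 1\<rparr>"

definition GL2 :: "real set \<Rightarrow> (real^2^2) monoid" where
  "GL2 K = units_of (mat2_monoid K)"

definition affine_matrix :: "real \<Rightarrow> real \<Rightarrow> real^2^2" where
  "affine_matrix a b = vector [vector [a, b], vector [0, 1]]"

definition affine_matrices :: "real \<Rightarrow> (real^2^2) set" where
  "affine_matrices t =
     {affine_matrix a b | a b. a \<in> rational_functions_at t \<and> b \<in> rational_functions_at t \<and> a > 0}"

definition affine_group :: "real \<Rightarrow> (real^2^2) monoid" where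
  "affine_group t = (GL2 (rational_functions_at t))\<lparr>carrier := affine_matrices t\<rparr>"

end

(*
  A directed tree in which every vertex has a parent and any two vertices have a common ancestor is
  contractible, and so is the product of n such trees, a complex of cubes of dimension at most n: flow
  all coordinates towards the ends until each lies on a fixed ray, then contract the product of the
  rays. The stabilizer of a point is an intersection of vertex stabilizers. All complexes that are
  needed are such products.

  Let the prime elements q of Z[t] be enumerated. The group G_t is the ascending union of the
  subgroups Gamma_n of those (a, b) for which v_q(a) = 0 and v_q(b) >= 0 for all but the first n of
  the q; hence it acts on a tree, with stabilizers conjugate to the Gamma_n. A conjugate of Gamma_n
  acts on the product of the n + 1 trees of balls in Q(t) for the first n valuations v_q and for minus
  the degree. If (a, b) fixes a vertex, then v_q(a) = 0 for all q, so a = 1, and b lies in a fractional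
  multiple of the polynomials of bounded degree in Z[t]. So the stabilizers embed into some Z^N, which
  acts freely by translations on the product of N lines.
*)
theory Submission
  imports Defs
begin

section \<open>Discs and cubes\<close>

text \<open>The trees of all primes at once would give an infinite dimensional complex. The coset
  tree of the ascending union leaves finitely many primes to deal with, at the cost of one level of
  the hierarchy. Conditions at primes alone would leave stabilizers of infinite rank; minus the
  degree is the valuation that bounds the rank. The primes of Z[t] include the prime numbers, which
  keep the coefficients in Z instead of Q. Positivity of \<open>a\<close> excludes the unit -1.

  Every edge of a tree runs from a vertex to its parent, so a point of the product is determined by
  a starting vertex and coordinates in [0, 1), and the paths towards the ends attach an orthant to
  each vertex. The topology is the quotient of the disjoint union of these orthants. Continuity of
  the contraction can then be read off from one formula per orthant; the price is a proof that the
  cells glue to the same topology. The group commutes with \<open>par\<close> and moves starting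
  vertices only, so an element that preserves a cell fixes it pointwise.\<close>

primrec max_norm :: "nat \<Rightarrow> (nat \<Rightarrow> real) \<Rightarrow> real" where
  "max_norm 0 x = 0"
| "max_norm (Suc n) x = max (max_norm n x) \<bar>x n\<bar>"

lemma max_norm_nonneg: "0 \<le> max_norm n x"
  by (induction n) auto

lemma abs_le_max_norm: "i < n \<Longrightarrow> \<bar>x i\<bar> \<le> max_norm n x"
  by (induction n) (auto simp: less_Suc_eq)

lemma max_norm_scale: "max_norm n (\<lambda>i. c * x i) = \<bar>c\<bar> * max_norm n x"
  by (induction n) (auto simp: abs_mult max_mult_distrib_left)

lemma max_norm_attained: "0 < max_norm n x \<Longrightarrow> \<exists>i<n. \<bar>x i\<bar> = max_norm n x"
  by (induction n) (auto simp: max_def less_Suc_eq split: if_splits)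

lemma max_norm_cong: "(\<And>i. i < n \<Longrightarrow> x i = y i) \<Longrightarrow> max_norm n x = max_norm n y"
  by (induction n) auto

lemma continuous_on_max_norm [continuous_intros]: "continuous_on S (max_norm n)"
proof (induction n)
  case (Suc n)
  have "continuous_on S (\<lambda>x. x n)"
    by (rule continuous_on_subset[OF continuous_on_product_coordinates]) simp
  then show ?case using Suc by (auto intro!: continuous_intros)
qed simp

lemma L2_set_scale: "L2_set (\<lambda>i. c * x i) A = \<bar>c\<bar> * L2_set x A"
  by (simp add: L2_set_def power_mult_distrib real_sqrt_mult flip: sum_distrib_left)

lemma continuous_on_L2_set [continuous_intros]:
  "continuous_on S (\<lambda>x :: nat \<Rightarrow> real. L2_set x {..<n})"
proof -
  have "continuous_on S (\<lambda>x :: nat \<Rightarrow> real. x i)" for i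
    by (rule continuous_on_subset[OF continuous_on_product_coordinates]) simp
  then show ?thesis unfolding L2_set_def by (intro continuous_intros)
qed

definition disc_points :: "nat \<Rightarrow> (nat \<Rightarrow> real) set" where
  "disc_points n = {x. (\<forall>i\<ge>n. x i = 0) \<and> L2_set x {..<n} \<le> 1}"

lemma closed_disc_eq: "closed_disc n = top_of_set (disc_points n)"
proof -
  have "{x. \<forall>i\<ge>n. x i = 0} \<inter> {x. (\<Sum>i<n. (x i)\<^sup>2) \<le> 1} = disc_points n"
    by (auto simp: disc_points_def L2_set_def)
  then show ?thesis
    by (simp add: closed_disc_def Euclidean_space_def euclidean_product_topology
        subtopology_subtopology)
qed

lemma topspace_closed_disc [simp]: "topspace (closed_disc n) = disc_points n"
  by (simp add: closed_disc_eq)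

lemma disc_boundary_eq: "disc_boundary n = {x \<in> disc_points n. L2_set x {..<n} = 1}"
  by (auto simp: disc_boundary_def L2_set_def)

text \<open>A closed subset of a Tychonoff cube. Compactness makes the images of closed subsets of
  discs closed later, when closed sets are glued from faces.\<close>

lemma compact_disc_points: "compact (disc_points n)"
proof -
  have coord: "continuous_on UNIV (\<lambda>x :: nat \<Rightarrow> real. x i)" for i
    by simp
  have "closed {x :: nat \<Rightarrow> real. L2_set x {..<n} \<le> 1}"
    by (intro closed_Collect_le continuous_intros)
  moreover have "closed {x :: nat \<Rightarrow> real. \<forall>i. i \<ge> n \<longrightarrow> x i = 0}"
    by (intro closed_Collect_all closed_Collect_imp open_Collect_const closed_Collect_eq
        continuous_intros) simp
  ultimately have "closed (disc_points n)"
    unfolding disc_points_def using closed_Collect_conj by fastforce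
  moreover have "disc_points n \<subseteq> Pi\<^sub>E UNIV (\<lambda>i. {-1..1})"
  proof
    fix x assume x: "x \<in> disc_points n"
    have "\<bar>x i\<bar> \<le> 1" for i
    proof (cases "i < n")
      case True
      then have "\<bar>x i\<bar> \<le> L2_set x {..<n}"
        using member_le_L2_set[of "{..<n}" i "\<lambda>i. \<bar>x i\<bar>"] by (simp add: L2_set_def)
      then show ?thesis using x by (simp add: disc_points_def)
    qed (use x in \<open>simp add: disc_points_def\<close>)
    then show "x \<in> Pi\<^sub>E UNIV (\<lambda>i. {-1..1})"
      by (auto simp: abs_le_iff minus_le_iff)
  qed
  moreover have "compact (Pi\<^sub>E UNIV (\<lambda>i :: nat. {-1..1 :: real}))"
    using compactin_PiE[of "\<lambda>_. euclideanreal" UNIV "\<lambda>_. {-1..1}"]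
    by (simp add: euclidean_product_topology)
  ultimately show ?thesis
    using closed_Int_compact inf.absorb1 by metis
qed

text \<open>At the origin both radial maps have the value \<open>0\<close> because \<open>0 / 0 = 0\<close>.\<close>

definition disc_to_ball :: "nat \<Rightarrow> (nat \<Rightarrow> real) \<Rightarrow> nat \<Rightarrow> real" where
  "disc_to_ball n x = (\<lambda>i. L2_set x {..<n} / max_norm n x * x i)"

definition ball_to_disc :: "nat \<Rightarrow> (nat \<Rightarrow> real) \<Rightarrow> nat \<Rightarrow> real" where
  "ball_to_disc n x = (\<lambda>i. max_norm n x / L2_set x {..<n} * x i)"

lemma norms_eq_0_iff:
  "max_norm n x = 0 \<longleftrightarrow> (\<forall>i<n. x i = 0)" "L2_set x {..<n} = 0 \<longleftrightarrow> (\<forall>i<n. x i = 0)"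
proof -
  show "max_norm n x = 0 \<longleftrightarrow> (\<forall>i<n. x i = 0)"
    using abs_le_max_norm[of _ n x] max_norm_cong[of n x "\<lambda>_. 0"] max_norm_scale[of n 0 x]
    by fastforce
  show "L2_set x {..<n} = 0 \<longleftrightarrow> (\<forall>i<n. x i = 0)"
    by (auto simp: L2_set_eq_0_iff)
qed

lemma max_norm_disc_to_ball: "max_norm n (disc_to_ball n x) = L2_set x {..<n}"
  unfolding disc_to_ball_def max_norm_scale
  using norms_eq_0_iff[where n = n and x = x] max_norm_nonneg[of n x] by (auto simp: abs_mult)

lemma L2_set_ball_to_disc: "L2_set (ball_to_disc n x) {..<n} = max_norm n x"
  unfolding ball_to_disc_def L2_set_scale
  using norms_eq_0_iff[where n = n and x = x] max_norm_nonneg[of n x] by (auto simp: abs_mult)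

lemma ball_to_disc_to_ball:
  assumes "\<forall>i\<ge>n. x i = 0" shows "ball_to_disc n (disc_to_ball n x) = x"
proof
  fix i
  have "L2_set (disc_to_ball n x) {..<n} = \<bar>L2_set x {..<n} / max_norm n x\<bar> * L2_set x {..<n}"
    by (simp only: disc_to_ball_def L2_set_scale)
  then have "ball_to_disc n (disc_to_ball n x) i =
      L2_set x {..<n} / (\<bar>L2_set x {..<n} / max_norm n x\<bar> * L2_set x {..<n}) *
      (L2_set x {..<n} / max_norm n x * x i)"
    by (simp add: ball_to_disc_def max_norm_disc_to_ball) (simp add: disc_to_ball_def)
  also have "\<dots> = x i"
    using norms_eq_0_iff[where n = n and x = x] max_norm_nonneg[of n x] L2_set_nonneg[of x "{..<n}"] assms
    by (cases "i < n") (auto simp: field_simps)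
  finally show "ball_to_disc n (disc_to_ball n x) i = x i" .
qed

lemma disc_to_ball_to_disc:
  assumes "\<forall>i\<ge>n. x i = 0" shows "disc_to_ball n (ball_to_disc n x) = x"
proof
  fix i
  have "max_norm n (ball_to_disc n x) = \<bar>max_norm n x / L2_set x {..<n}\<bar> * max_norm n x"
    by (simp only: ball_to_disc_def max_norm_scale)
  then have "disc_to_ball n (ball_to_disc n x) i =
      max_norm n x / (\<bar>max_norm n x / L2_set x {..<n}\<bar> * max_norm n x) *
      (max_norm n x / L2_set x {..<n} * x i)"
    by (simp add: disc_to_ball_def L2_set_ball_to_disc) (simp add: ball_to_disc_def)
  also have "\<dots> = x i"
    using norms_eq_0_iff[where n = n and x = x] max_norm_nonneg[of n x] L2_set_nonneg[of x "{..<n}"] assms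
    by (cases "i < n") (auto simp: field_simps)
  finally show "disc_to_ball n (ball_to_disc n x) i = x i" .
qed

text \<open>Away from the origin this is a quotient of continuous functions. Where the first
  \<open>n\<close> coordinates vanish the map takes the value 0, and a further nonzero coordinate
  would make it jump there; hence the restriction of the domain.\<close>

lemma continuous_on_disc_to_ball: "continuous_on {x. \<forall>i\<ge>n. x i = 0} (disc_to_ball n)"
proof (intro continuous_on_coordinatewise_then_product)
  fix i
  let ?S = "{x. \<forall>i\<ge>n. x i = 0} :: (nat \<Rightarrow> real) set" and ?f = "\<lambda>x. disc_to_ball n x i"
  have coord: "continuous_on T (\<lambda>x :: nat \<Rightarrow> real. x i)" for T
    by (rule continuous_on_subset[OF continuous_on_product_coordinates]) simp
  show "continuous_on ?S ?f"
    unfolding continuous_on_eq_continuous_within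
  proof
    fix x assume x: "x \<in> ?S"
    show "continuous (at x within ?S) ?f"
    proof (cases "max_norm n x = 0")
      case False
      have "open {x. max_norm n x \<noteq> 0}"
        by (intro open_Collect_neq continuous_intros)
      moreover have "continuous_on {x. max_norm n x \<noteq> 0} ?f"
        unfolding disc_to_ball_def by (intro continuous_intros coord) auto
      ultimately have "isCont ?f x"
        using False continuous_on_eq_continuous_at by blast
      then show ?thesis using continuous_at_imp_continuous_at_within by blast
    next
      case True
      \<comment> \<open>The radial map turns the Euclidean norm into the max norm, so each
        coordinate is squeezed to 0 at the one singular point.\<close>
      have bound: "norm (?f y) \<le> L2_set y {..<n}" if "y \<in> ?S" for y
      proof (cases "i < n")
        case True
        then show ?thesis
          using abs_le_max_norm[of i n "disc_to_ball n y"] by (simp add: max_norm_disc_to_ball)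
      next
        case False
        then show ?thesis using that by (simp add: disc_to_ball_def)
      qed
      have "((\<lambda>y. L2_set y {..<n}) \<longlongrightarrow> L2_set x {..<n}) (at x within ?S)"
        using continuous_on_L2_set[of UNIV n]
        by (meson continuous_on_def UNIV_I tendsto_within_subset subset_UNIV)
      then have "((\<lambda>y. L2_set y {..<n}) \<longlongrightarrow> 0) (at x within ?S)"
        using True norms_eq_0_iff[where n = n and x = x] by simp
      then have "(?f \<longlongrightarrow> 0) (at x within ?S)"
        by (rule Lim_null_comparison[rotated]) (use bound in \<open>simp add: eventually_at_filter\<close>)
      moreover have "?f x = 0" using bound[OF x] True norms_eq_0_iff[where n = n and x = x] by simp
      ultimately show ?thesis by (simp add: continuous_within)
    qed
  qed
qed

text \<open>\<open>attach_equivariant_cells\<close> asks for round discs, whereas the cells of a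
  product of trees are cubes. The radial map onto [-1, 1]^n is followed by the affine map onto
  [0, 1]^n.\<close>

definition disc_to_cube :: "nat \<Rightarrow> (nat \<Rightarrow> real) \<Rightarrow> nat \<Rightarrow> real" where
  "disc_to_cube n x = (\<lambda>i. if i < n then (1 + disc_to_ball n x i) / 2 else 0)"

lemma continuous_on_disc_to_cube: "continuous_on (disc_points n) (disc_to_cube n)"
proof (intro continuous_on_coordinatewise_then_product)
  fix i
  have "continuous_on (disc_points n) (disc_to_ball n)"
    by (rule continuous_on_subset[OF continuous_on_disc_to_ball]) (auto simp: disc_points_def)
  then have "continuous_on (disc_points n) (\<lambda>x. disc_to_ball n x i)"
    by (rule continuous_on_product_then_coordinatewise)
  then show "continuous_on (disc_points n) (\<lambda>x. disc_to_cube n x i)"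
    by (cases "i < n") (auto simp: disc_to_cube_def intro!: continuous_intros)
qed

lemma disc_to_cube_bounds:
  assumes "x \<in> disc_points n" shows "0 \<le> disc_to_cube n x i" "disc_to_cube n x i \<le> 1"
proof -
  have "\<bar>disc_to_ball n x i\<bar> \<le> 1" if "i < n"
    using abs_le_max_norm[OF that, of "disc_to_ball n x"] assms
    by (simp add: max_norm_disc_to_ball disc_points_def)
  then show "0 \<le> disc_to_cube n x i" "disc_to_cube n x i \<le> 1"
    by (auto simp: disc_to_cube_def abs_le_iff)
qed

lemma disc_to_cube_interior:
  assumes "x \<in> disc_points n - disc_boundary n" "i < n"
  shows "0 < disc_to_cube n x i" "disc_to_cube n x i < 1"
proof -
  have "L2_set x {..<n} < 1"
    using assms(1) by (auto simp: disc_boundary_eq disc_points_def)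
  then have "\<bar>disc_to_ball n x i\<bar> < 1"
    using abs_le_max_norm[OF assms(2), of "disc_to_ball n x"] by (simp add: max_norm_disc_to_ball)
  then show "0 < disc_to_cube n x i" "disc_to_cube n x i < 1"
    using assms(2) by (auto simp: disc_to_cube_def abs_less_iff)
qed

lemma disc_to_cube_boundary:
  assumes "x \<in> disc_boundary n"
  shows "\<exists>i<n. disc_to_cube n x i = 0 \<or> disc_to_cube n x i = 1"
proof -
  have "max_norm n (disc_to_ball n x) = 1"
    using assms by (simp add: max_norm_disc_to_ball disc_boundary_eq)
  then obtain i where i: "i < n" "\<bar>disc_to_ball n x i\<bar> = 1"
    using max_norm_attained[of n "disc_to_ball n x"] by auto
  then have "disc_to_ball n x i = 1 \<or> disc_to_ball n x i = -1" by linarith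
  then have "disc_to_cube n x i = 0 \<or> disc_to_cube n x i = 1"
    using i(1) by (auto simp: disc_to_cube_def)
  then show ?thesis using i(1) by blast
qed

lemma inj_on_disc_to_cube: "inj_on (disc_to_cube n) (disc_points n)"
proof (rule inj_onI)
  fix x y assume xy: "x \<in> disc_points n" "y \<in> disc_points n" "disc_to_cube n x = disc_to_cube n y"
  have "disc_to_ball n x i = disc_to_ball n y i" for i
  proof (cases "i < n")
    case True
    then show ?thesis using fun_cong[OF xy(3), of i] by (simp add: disc_to_cube_def)
  next
    case False
    then show ?thesis using xy(1,2) by (simp add: disc_to_ball_def disc_points_def)
  qed
  then have eq: "disc_to_ball n x = disc_to_ball n y" by (rule ext)
  have "x = ball_to_disc n (disc_to_ball n x)" "ball_to_disc n (disc_to_ball n y) = y"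
    using xy(1,2) by (auto simp: disc_points_def ball_to_disc_to_ball)
  then show "x = y" by (simp only: eq)
qed

lemma disc_to_cube_surj:
  assumes "\<And>i. i < n \<Longrightarrow> 0 \<le> y i \<and> y i \<le> 1" "\<And>i. i \<ge> n \<Longrightarrow> y i = 0"
  obtains x where "x \<in> disc_points n" "disc_to_cube n x = y"
proof
  let ?z = "\<lambda>i. if i < n then 2 * y i - 1 else 0"
  let ?x = "ball_to_disc n ?z"
  have "max_norm n ?z \<le> 1"
  proof (rule ccontr)
    assume "\<not> max_norm n ?z \<le> 1"
    then obtain i where "i < n" "\<bar>?z i\<bar> > 1"
      using max_norm_attained[of n ?z] by force
    then show False using assms(1)[of i] by (auto simp: abs_if split: if_splits)
  qed
  then show "?x \<in> disc_points n"
    by (simp add: disc_points_def L2_set_ball_to_disc) (simp add: ball_to_disc_def)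
  have "disc_to_ball n ?x = ?z"
    by (rule disc_to_ball_to_disc) simp
  then show "disc_to_cube n ?x = y"
    using assms(2) unfolding disc_to_cube_def by (intro ext) simp
qed

section \<open>Products of trees\<close>

lemma continuous_on_coordinate: "continuous_on S (\<lambda>x :: nat \<Rightarrow> real. x i)"
  by (rule continuous_on_subset[OF continuous_on_product_coordinates]) simp

lemma openin_prod_discrete:
  "openin (prod_topology (discrete_topology W) T) S \<longleftrightarrow>
     S \<subseteq> W \<times> topspace T \<and> (\<forall>v\<in>W. openin T {z. (v, z) \<in> S})" (is "?L \<longleftrightarrow> ?R")
proof
  assume L: ?L
  have "openin T {z. (v, z) \<in> S}" if v: "v \<in> W" for v
  proof (subst openin_subopen, safe)
    fix z assume "(v, z) \<in> S"
    then obtain A B where "openin T B" "v \<in> A" "z \<in> B" "A \<times> B \<subseteq> S"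
      using L unfolding openin_prod_topology_alt by meson
    then show "\<exists>B. openin T B \<and> z \<in> B \<and> B \<subseteq> {z. (v, z) \<in> S}"
      by (intro exI[of _ B]) auto
  qed
  then show ?R using openin_subset[OF L] by auto
next
  assume R: ?R
  show ?L unfolding openin_prod_topology_alt
  proof (intro allI impI)
    fix v z assume "(v, z) \<in> S"
    then show "\<exists>A B. openin (discrete_topology W) A \<and> openin T B \<and> v \<in> A \<and> z \<in> B \<and> A \<times> B \<subseteq> S"
      using R by (intro exI[of _ "{v}"] exI[of _ "{z. (v, z) \<in> S}"]) auto
  qed
qed

text \<open>Bookkeeping for a change of starting vertex: \<open>k\<close> steps towards the end
  lower a meeting time \<open>m\<close> to \<open>m - k\<close> and move the meeting position
  \<open>l\<close> to \<open>l + (k - m)\<close>, where truncation accounts for starts that already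
  lie on the ray.\<close>

lemma max_diff_shift:
  assumes "0 \<le> (f :: real)"
  shows "max 0 (real (m - k) - f) = max 0 (real m - (f + real k))"
    and "real (l + (k - m)) + max 0 (f - real (m - k)) = real l + max 0 (f + real k - real m)"
  using assms by (cases "k \<le> m"; simp add: of_nat_diff max_def)+

text \<open>Each tree has an edge from every vertex to its parent. \<open>acyclic\<close> rules out
  circuits and \<open>merge\<close> gives connectedness; the sequences of ancestors all run into one
  end, which \<open>act_par\<close> makes the action preserve, so that no edge is inverted.
  Countability lets vertices be coded by numbers.\<close>

locale tree_product =
  fixes G :: "'g monoid" and n :: nat and V :: "nat \<Rightarrow> 'v set"
    and par :: "nat \<Rightarrow> 'v \<Rightarrow> 'v" and act :: "nat \<Rightarrow> 'g \<Rightarrow> 'v \<Rightarrow> 'v"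
  assumes group: "group G"
    and countable_V: "i < n \<Longrightarrow> countable (V i)"
    and nonempty_V: "i < n \<Longrightarrow> V i \<noteq> {}"
    and par_closed: "i < n \<Longrightarrow> v \<in> V i \<Longrightarrow> par i v \<in> V i"
    and acyclic: "i < n \<Longrightarrow> v \<in> V i \<Longrightarrow> (par i ^^ k) v = v \<Longrightarrow> k = 0"
    and merge: "i < n \<Longrightarrow> u \<in> V i \<Longrightarrow> v \<in> V i \<Longrightarrow> \<exists>k l. (par i ^^ k) u = (par i ^^ l) v"
    and act_closed: "i < n \<Longrightarrow> g \<in> carrier G \<Longrightarrow> v \<in> V i \<Longrightarrow> act i g v \<in> V i"
    and act_one: "i < n \<Longrightarrow> v \<in> V i \<Longrightarrow> act i \<one>\<^bsub>G\<^esub> v = v"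
    and act_mult: "i < n \<Longrightarrow> g \<in> carrier G \<Longrightarrow> h \<in> carrier G \<Longrightarrow> v \<in> V i \<Longrightarrow>
           act i (g \<otimes>\<^bsub>G\<^esub> h) v = act i g (act i h v)"
    and act_par: "i < n \<Longrightarrow> g \<in> carrier G \<Longrightarrow> v \<in> V i \<Longrightarrow> act i g (par i v) = par i (act i g v)"
begin

definition vertices :: "(nat \<Rightarrow> 'v) set" where
  "vertices = Pi\<^sub>E {..<n} V"

text \<open>The vertices of a product of \<open>n\<close> trees are countable, so a number encodes the vertex at which the
  half-open cube of a point starts, and the first component of \<open>complex_point\<close> stays unused.\<close>

definition pt :: "(nat \<Rightarrow> 'v) \<Rightarrow> (nat \<Rightarrow> real) \<Rightarrow> 'g complex_point" where
  "pt v s = ({}, to_nat_on vertices v, s)"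

text \<open>An edge owns its child vertex but not the parent, so that the half-open cubes partition
  the product of the trees.\<close>

definition half_open_cube :: "(nat \<Rightarrow> real) set" where
  "half_open_cube = {s. (\<forall>i<n. 0 \<le> s i \<and> s i < 1) \<and> (\<forall>i\<ge>n. s i = 0)}"

definition orthant :: "(nat \<Rightarrow> real) set" where
  "orthant = {z. (\<forall>i<n. 0 \<le> z i) \<and> (\<forall>i\<ge>n. z i = 0)}"

definition up :: "(nat \<Rightarrow> nat) \<Rightarrow> (nat \<Rightarrow> 'v) \<Rightarrow> nat \<Rightarrow> 'v" where
  "up k v = (\<lambda>i\<in>{..<n}. (par i ^^ k i) (v i))"

text \<open>Coordinate \<open>z i\<close> is the distance travelled from \<open>v i\<close> along
  the path of its ancestors: the integer part counts whole edges, the fractional part is the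
  position on the edge reached.\<close>

definition flow :: "(nat \<Rightarrow> 'v) \<Rightarrow> (nat \<Rightarrow> real) \<Rightarrow> 'g complex_point" where
  "flow v z = pt (up (\<lambda>i. nat \<lfloor>z i\<rfloor>) v) (\<lambda>i. frac (z i))"

definition points :: "'g complex_point set" where
  "points = {pt v s | v s. v \<in> vertices \<and> s \<in> half_open_cube}"

text \<open>The final topology for the maps \<open>flow v\<close> on whole orthants rather than on
  single cubes, so that homotopies can be tested orthant by orthant. Its compatibility with the
  cells is \<open>openin_skeleton_iff\<close>.\<close>

definition space :: "'g complex_point topology" where
  "space = topology (\<lambda>U. U \<subseteq> points \<and>
     (\<forall>v\<in>vertices. openin (top_of_set orthant) (orthant \<inter> flow v -` U)))"

lemma countable_vertices: "countable vertices"
  unfolding vertices_def by (intro countable_PiE) (auto intro: countable_V)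

lemma pt_eq_iff:
  "v \<in> vertices \<Longrightarrow> v' \<in> vertices \<Longrightarrow> pt v s = pt v' s' \<longleftrightarrow> v = v' \<and> s = s'"
  using inj_on_to_nat_on[OF countable_vertices] by (auto simp: pt_def inj_on_def)

lemma vertices_nonempty: "vertices \<noteq> {}"
  using nonempty_V by (auto simp: vertices_def PiE_eq_empty_iff)

lemma funpow_par_closed: "i < n \<Longrightarrow> v \<in> V i \<Longrightarrow> (par i ^^ k) v \<in> V i"
  by (induction k) (auto intro: par_closed)

lemma verticesD: "v \<in> vertices \<Longrightarrow> i < n \<Longrightarrow> v i \<in> V i"
  by (auto simp: vertices_def)

lemma up_closed: "v \<in> vertices \<Longrightarrow> up k v \<in> vertices"
  by (auto simp: vertices_def up_def intro: funpow_par_closed)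

lemma up_zero: "v \<in> vertices \<Longrightarrow> up (\<lambda>_. 0) v = v"
  by (auto simp: vertices_def up_def fun_eq_iff PiE_iff extensional_def)

lemma up_cong: "(\<And>i. i < n \<Longrightarrow> (par i ^^ k i) (v i) = (par i ^^ l i) (w i)) \<Longrightarrow> up k v = up l w"
  by (auto simp: up_def)

text \<open>The orthant of an ancestor sits in the orthant of \<open>v\<close> as a translate:
  adding \<open>k i\<close> to a coordinate adds whole edges and leaves the fractional part
  alone.\<close>

lemma flow_shift:
  assumes "\<And>i. i < n \<Longrightarrow> 0 \<le> z i"
  shows "flow v (\<lambda>i. z i + real (k i)) = flow (up k v) z"
proof -
  have "nat \<lfloor>z i + real (k i)\<rfloor> = nat \<lfloor>z i\<rfloor> + k i" if "i < n" for i
    using assms[OF that] by (simp add: nat_add_distrib)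
  then have "up (\<lambda>i. nat \<lfloor>z i + real (k i)\<rfloor>) v = up (\<lambda>i. nat \<lfloor>z i\<rfloor>) (up k v)"
    by (auto simp: up_def funpow_add)
  moreover have "frac (z i + real (k i)) = frac (z i)" for i
    by (simp add: frac_def)
  ultimately show ?thesis by (simp add: flow_def)
qed

lemma flow_half_open_cube: "v \<in> vertices \<Longrightarrow> s \<in> half_open_cube \<Longrightarrow> flow v s = pt v s"
proof -
  assume v: "v \<in> vertices" and s: "s \<in> half_open_cube"
  have fl: "\<lfloor>s i\<rfloor> = 0" for i
    using s by (cases "i < n") (auto simp: half_open_cube_def floor_eq_iff)
  have "frac (s i) = s i" for i
    by (simp add: frac_def fl)
  then show ?thesis using up_zero[OF v] by (simp add: flow_def fl)
qed

lemma half_open_cube_subset: "half_open_cube \<subseteq> orthant"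
  by (auto simp: half_open_cube_def orthant_def)

lemma frac_half_open_cube: "z \<in> orthant \<Longrightarrow> (\<lambda>i. frac (z i)) \<in> half_open_cube"
  by (auto simp: half_open_cube_def orthant_def frac_lt_1)

lemma flow_closed: "v \<in> vertices \<Longrightarrow> z \<in> orthant \<Longrightarrow> flow v z \<in> points"
  unfolding points_def flow_def using up_closed frac_half_open_cube by blast

lemma points_cases:
  assumes "p \<in> points"
  obtains v s where "v \<in> vertices" "s \<in> half_open_cube" "p = flow v s"
  using assms flow_half_open_cube unfolding points_def by force

lemma closed_orthant: "closed orthant"
proof -
  have eq: "orthant = (\<Inter>i. {z. (if i < n then 0 \<le> z i else z i = 0)})"
    by (auto simp: orthant_def not_less split: if_splits)
  have "closed {z :: nat \<Rightarrow> real. (if i < n then 0 \<le> z i else z i = 0)}" for i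
    by (cases "i < n") (auto intro!: closed_Collect_le closed_Collect_eq continuous_on_coordinate)
  then show ?thesis unfolding eq by (rule closed_INT[rule_format])
qed

section \<open>The quotient topology from the orthants\<close>

lemma openin_space:
  "openin space U \<longleftrightarrow> U \<subseteq> points \<and>
     (\<forall>v\<in>vertices. openin (top_of_set orthant) (orthant \<inter> flow v -` U))"
proof -
  have "istopology (\<lambda>U. U \<subseteq> points \<and>
     (\<forall>v\<in>vertices. openin (top_of_set orthant) (orthant \<inter> flow v -` U)))"
    unfolding istopology_def
  proof (intro conjI allI impI)
    fix S T assume *: "S \<subseteq> points \<and> (\<forall>v\<in>vertices. openin (top_of_set orthant) (orthant \<inter> flow v -` S))"
      "T \<subseteq> points \<and> (\<forall>v\<in>vertices. openin (top_of_set orthant) (orthant \<inter> flow v -` T))"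
    show "S \<inter> T \<subseteq> points" using * by auto
    have "orthant \<inter> flow v -` (S \<inter> T) = (orthant \<inter> flow v -` S) \<inter> (orthant \<inter> flow v -` T)" for v
      by auto
    then show "\<forall>v\<in>vertices. openin (top_of_set orthant) (orthant \<inter> flow v -` (S \<inter> T))"
      using * by (simp only:) (blast intro: openin_Int)
  next
    fix K assume *: "\<forall>S\<in>K. S \<subseteq> points \<and> (\<forall>v\<in>vertices. openin (top_of_set orthant) (orthant \<inter> flow v -` S))"
    show "\<Union>K \<subseteq> points" using * by auto
    show "\<forall>v\<in>vertices. openin (top_of_set orthant) (orthant \<inter> flow v -` (\<Union>K))"
    proof
      fix v assume "v \<in> vertices"
      then have "openin (top_of_set orthant) (\<Union>((\<lambda>S. orthant \<inter> flow v -` S) ` K))"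
        using * by (intro openin_Union) auto
      also have "\<Union>((\<lambda>S. orthant \<inter> flow v -` S) ` K) = orthant \<inter> flow v -` (\<Union>K)"
        by auto
      finally show "openin (top_of_set orthant) (orthant \<inter> flow v -` (\<Union>K))" .
    qed
  qed
  then show ?thesis unfolding space_def by (simp add: topology_inverse')
qed

lemma topspace_space [simp]: "topspace space = points"
proof -
  have "openin space points"
    unfolding openin_space
  proof (intro conjI ballI)
    fix v assume "v \<in> vertices"
    then have "orthant \<inter> flow v -` points = orthant" using flow_closed by auto
    then show "openin (top_of_set orthant) (orthant \<inter> flow v -` points)" by simp
  qed simp
  moreover have "topspace space \<subseteq> points"
    using openin_topspace[of space] by (simp only: openin_space)
  ultimately show ?thesis by (simp add: openin_subset subset_antisym)
qed

lemma closedin_space: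
  "closedin space C \<longleftrightarrow> C \<subseteq> points \<and> (\<forall>v\<in>vertices. closed (orthant \<inter> flow v -` C))"
proof -
  have "openin (top_of_set orthant) (orthant \<inter> flow v -` (points - C)) \<longleftrightarrow>
        closed (orthant \<inter> flow v -` C)" if "v \<in> vertices" for v
  proof -
    have "orthant \<inter> flow v -` (points - C) = orthant - (orthant \<inter> flow v -` C)"
      using that flow_closed by auto
    moreover have "openin (top_of_set orthant) (orthant - (orthant \<inter> flow v -` C)) \<longleftrightarrow>
        closedin (top_of_set orthant) (orthant \<inter> flow v -` C)"
      by (simp add: closedin_def)
    ultimately show ?thesis
      using closedin_closed_eq[OF closed_orthant] by simp
  qed
  then show ?thesis
    unfolding closedin_def openin_space by auto
qed

lemma quotient_map_flow:
  "quotient_map (prod_topology (discrete_topology vertices) (top_of_set orthant)) space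
     (\<lambda>(v, z). flow v z)"
  unfolding quotient_map_def
proof (intro conjI allI impI)
  show "(\<lambda>(v, z). flow v z) ` topspace (prod_topology (discrete_topology vertices) (top_of_set orthant))
      = topspace space"
    using flow_closed half_open_cube_subset by (fastforce elim!: points_cases)
next
  fix U assume U: "U \<subseteq> topspace space"
  have "{z. (v, z) \<in> {x \<in> vertices \<times> orthant. (case x of (v, z) \<Rightarrow> flow v z) \<in> U}} =
      orthant \<inter> flow v -` U" if "v \<in> vertices" for v
    using that by auto
  then show "openin (prod_topology (discrete_topology vertices) (top_of_set orthant))
      {x \<in> topspace (prod_topology (discrete_topology vertices) (top_of_set orthant)).
       (case x of (v, z) \<Rightarrow> flow v z) \<in> U} = openin space U"
    using U by (auto simp: openin_prod_discrete openin_space)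
qed

lemma continuous_map_flow:
  assumes "v \<in> vertices" "continuous_on T f" "f ` T \<subseteq> orthant"
  shows "continuous_map (top_of_set T) space (\<lambda>x. flow v (f x))"
proof -
  have "continuous_map (top_of_set T) (top_of_set orthant) f"
    using assms by auto
  then have "continuous_map (top_of_set T)
      (prod_topology (discrete_topology vertices) (top_of_set orthant)) (\<lambda>x. (v, f x))"
    using assms(1) by (simp add: continuous_map_paired)
  from continuous_map_compose[OF this quotient_imp_continuous_map[OF quotient_map_flow]]
  show ?thesis by (simp add: comp_def)
qed

text \<open>The product of a quotient map with the identity of [0, 1] is again a quotient map,
  [0, 1] being locally compact and Hausdorff. So \<open>H\<close> need only be checked on the
  product of [0, 1] with each orthant, where a continuous \<open>F\<close> into a single orthant
  describes it.\<close>

lemma continuous_map_homotopy: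
  assumes "\<And>v. v \<in> vertices \<Longrightarrow> \<exists>w\<in>vertices. \<exists>F. continuous_on ({0..1} \<times> orthant) F \<and>
      F ` ({0..1} \<times> orthant) \<subseteq> orthant \<and>
      (\<forall>t\<in>{0..1}. \<forall>z\<in>orthant. H (t, flow v z) = flow w (F (t, z)))"
  shows "continuous_map (prod_topology (top_of_set {0..1 :: real}) space) space H"
proof -
  let ?I = "top_of_set {0..1 :: real}"
  let ?P = "prod_topology (discrete_topology vertices) (top_of_set orthant)"
  let ?q = "\<lambda>(t :: real, y). (t, (\<lambda>(v, z). flow v z) y)"
  have q: "quotient_map (prod_topology ?I ?P) (prod_topology ?I space) ?q"
  proof (rule quotient_map_prod_right)
    show "locally_compact_space ?I"
      by (intro compact_imp_locally_compact_space) (simp add: compact_space_subtopology)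
    show "Hausdorff_space ?I \<or> regular_space ?I"
      by (simp add: Hausdorff_space_subtopology)
  qed (rule quotient_map_flow)
  have "continuous_map (prod_topology ?I ?P) space (H \<circ> ?q)"
    unfolding continuous_map_def
  proof (intro conjI allI impI)
    show "H \<circ> ?q \<in> topspace (prod_topology ?I ?P) \<rightarrow> topspace space"
    proof (clarsimp simp del: atLeastAtMost_iff)
      fix t :: real and v z assume *: "t \<in> {0..1}" "v \<in> vertices" "z \<in> orthant"
      then obtain w F where "w \<in> vertices" "F ` ({0..1} \<times> orthant) \<subseteq> orthant"
        "H (t, flow v z) = flow w (F (t, z))" using assms[OF *(2)] by metis
      moreover from this * have "F (t, z) \<in> orthant" by blast
      ultimately show "H (t, flow v z) \<in> points" using flow_closed by simp
    qed
  next
    fix U assume U: "openin space U"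
    show "openin (prod_topology ?I ?P) {x \<in> topspace (prod_topology ?I ?P). (H \<circ> ?q) x \<in> U}"
      unfolding openin_prod_topology_alt[of ?I]
    proof (intro allI impI)
      fix t vz assume "(t, vz) \<in> {x \<in> topspace (prod_topology ?I ?P). (H \<circ> ?q) x \<in> U}"
      then obtain v z where vz: "vz = (v, z)" "t \<in> {0..1}" "v \<in> vertices" "z \<in> orthant"
        "H (t, flow v z) \<in> U" by (cases vz) auto
      obtain w F where wF: "w \<in> vertices" "continuous_on ({0..1} \<times> orthant) F"
        "F ` ({0..1} \<times> orthant) \<subseteq> orthant"
        "\<And>t z. t \<in> {0..1} \<Longrightarrow> z \<in> orthant \<Longrightarrow> H (t, flow v z) = flow w (F (t, z))"
        using assms[OF vz(3)] by metis
      have "continuous_map (prod_topology ?I (top_of_set orthant)) space (\<lambda>x. flow w (F x))"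
        using continuous_map_flow[OF wF(1-3)] by simp
      then have "openin (prod_topology ?I (top_of_set orthant))
          {x \<in> {0..1} \<times> orthant. flow w (F x) \<in> U}"
        using openin_continuous_map_preimage[OF _ U] by fastforce
      moreover have "(t, z) \<in> {x \<in> {0..1} \<times> orthant. flow w (F x) \<in> U}"
        using vz wF(4) by auto
      ultimately obtain A B where AB: "openin ?I A" "openin (top_of_set orthant) B" "t \<in> A" "z \<in> B"
        "A \<times> B \<subseteq> {x \<in> {0..1} \<times> orthant. flow w (F x) \<in> U}"
        unfolding openin_prod_topology_alt by meson
      have "openin ?P ({v} \<times> B)"
        using AB(2) vz(3) by (simp add: openin_prod_Times_iff)
      moreover have "A \<times> ({v} \<times> B) \<subseteq> {x \<in> topspace (prod_topology ?I ?P). (H \<circ> ?q) x \<in> U}"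
        using AB(5) vz(3) wF(4) by (auto simp del: atLeastAtMost_iff)
      ultimately show "\<exists>A C. openin ?I A \<and> openin ?P C \<and> t \<in> A \<and> vz \<in> C \<and>
          A \<times> C \<subseteq> {x \<in> topspace (prod_topology ?I ?P). (H \<circ> ?q) x \<in> U}"
        using AB vz(1) by (intro exI[of _ A] exI[of _ "{v} \<times> B"]) simp
    qed
  qed
  then show ?thesis
    using q by (meson continuous_compose_quotient_map)
qed

section \<open>Meetings of ancestor paths and contractibility\<close>

lemma funpow_par_inj:
  assumes "i < n" "u \<in> V i" "(par i ^^ k) u = (par i ^^ l) u" shows "k = l"
proof -
  have *: "k = l" if "k \<le> l" "(par i ^^ k) u = (par i ^^ l) u" for k l
  proof -
    have "(par i ^^ (l - k)) ((par i ^^ k) u) = (par i ^^ (l - k + k)) u"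
      by (simp only: funpow_add comp_apply)
    also have "\<dots> = (par i ^^ k) u" using that by simp
    finally show ?thesis
      using acyclic[OF assms(1) funpow_par_closed[OF assms(1,2)]] that(1) by fastforce
  qed
  show ?thesis using *[of k l] *[of l k] assms(3) nat_le_linear[of k l] by fastforce
qed

definition base :: "nat \<Rightarrow> 'v" where
  "base = (SOME w. w \<in> vertices)"

text \<open>The path from \<open>u\<close> to the end of the tree meets the one from \<open>base i\<close> after \<open>meet_time i u\<close>
  steps, in the ancestor of \<open>base i\<close> of degree \<open>meet_pos i u\<close>.\<close>

definition meet_time :: "nat \<Rightarrow> 'v \<Rightarrow> nat" where
  "meet_time i u = (LEAST k. \<exists>l. (par i ^^ k) u = (par i ^^ l) (base i))"

definition meet_pos :: "nat \<Rightarrow> 'v \<Rightarrow> nat" where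
  "meet_pos i u = (SOME l. (par i ^^ meet_time i u) u = (par i ^^ l) (base i))"

lemma base_in: "base \<in> vertices"
  using vertices_nonempty unfolding base_def by (simp add: some_in_eq)

text \<open>Once two ancestor paths have met they coincide for ever, and distinct powers of
  \<open>par i\<close> take \<open>base i\<close> to distinct vertices. So the first meeting
  determines all others, and \<open>k\<close> determines \<open>l\<close>.\<close>

lemma meet_iff:
  assumes i: "i < n" and u: "u \<in> V i"
  shows "(par i ^^ k) u = (par i ^^ l) (base i) \<longleftrightarrow>
    meet_time i u \<le> k \<and> l = meet_pos i u + (k - meet_time i u)"
proof -
  have "\<exists>k l. (par i ^^ k) u = (par i ^^ l) (base i)"
    using merge[OF i u verticesD[OF base_in i]] .
  then have "\<exists>l. (par i ^^ meet_time i u) u = (par i ^^ l) (base i)"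
    unfolding meet_time_def by (rule LeastI_ex)
  then have eq: "(par i ^^ meet_time i u) u = (par i ^^ meet_pos i u) (base i)"
    unfolding meet_pos_def by (rule someI_ex)
  have add: "(par i ^^ (meet_time i u + j)) u = (par i ^^ (meet_pos i u + j)) (base i)" for j
    using eq by (metis add.commute comp_apply funpow_add)
  show ?thesis
  proof
    assume k: "(par i ^^ k) u = (par i ^^ l) (base i)"
    then have le: "meet_time i u \<le> k"
      unfolding meet_time_def by (intro Least_le) blast
    then have "(par i ^^ k) u = (par i ^^ (meet_pos i u + (k - meet_time i u))) (base i)"
      using add[of "k - meet_time i u"] by simp
    then show "meet_time i u \<le> k \<and> l = meet_pos i u + (k - meet_time i u)"
      using le k funpow_par_inj[OF i verticesD[OF base_in i]] by metis
  next
    assume "meet_time i u \<le> k \<and> l = meet_pos i u + (k - meet_time i u)"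
    then show "(par i ^^ k) u = (par i ^^ l) (base i)"
      using add[of "k - meet_time i u"] by simp
  qed
qed

text \<open>The path from the \<open>j\<close>-th ancestor is the path from \<open>u\<close> without
  its first \<open>j\<close> steps. If this ancestor already lies on the base ray, truncation makes
  its time 0 and its position advances by the excess.\<close>

lemma meet_funpow:
  assumes i: "i < n" and u: "u \<in> V i"
  shows "meet_time i ((par i ^^ j) u) = meet_time i u - j"
    and "meet_pos i ((par i ^^ j) u) = meet_pos i u + (j - meet_time i u)"
proof -
  let ?u = "(par i ^^ j) u"
  have u': "?u \<in> V i" using funpow_par_closed[OF i u] .
  have iff: "meet_time i ?u \<le> k \<and> l = meet_pos i ?u + (k - meet_time i ?u) \<longleftrightarrow>
      meet_time i u \<le> k + j \<and> l = meet_pos i u + (k + j - meet_time i u)" for k l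
    using meet_iff[OF i u', of k l] meet_iff[OF i u, of "k + j" l] by (simp add: funpow_add)
  have time: "meet_time i ?u \<le> k \<longleftrightarrow> meet_time i u \<le> k + j" for k
    using iff[of k] by blast
  show *: "meet_time i ?u = meet_time i u - j"
    using time[of "meet_time i ?u"] time[of "meet_time i u - j"] by linarith
  show "meet_pos i ?u = meet_pos i u + (j - meet_time i u)"
    using iff[of "meet_time i ?u" "meet_pos i ?u"] by (simp add: *)
qed

definition vert :: "'g complex_point \<Rightarrow> nat \<Rightarrow> 'v" where
  "vert p = from_nat_into vertices (fst (snd p))"

definition coord :: "'g complex_point \<Rightarrow> nat \<Rightarrow> real" where
  "coord p = snd (snd p)"

lemma vert_pt [simp]: "v \<in> vertices \<Longrightarrow> vert (pt v s) = v"
  by (simp add: vert_def pt_def countable_vertices)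

lemma coord_pt [simp]: "coord (pt v s) = s"
  by (simp add: coord_def pt_def)

text \<open>Every point flows towards the ends of the trees until each of its coordinates has reached the
  ray from \<open>base\<close>; the product of these rays is an orthant, which is then contracted linearly.\<close>

definition to_rays :: "real \<times> 'g complex_point \<Rightarrow> 'g complex_point" where
  "to_rays = (\<lambda>(t, p). flow (vert p)
     (\<lambda>i. if i < n then coord p i + t * max 0 (real (meet_time i (vert p i)) - coord p i) else 0))"

definition along_rays :: "real \<times> 'g complex_point \<Rightarrow> 'g complex_point" where
  "along_rays = (\<lambda>(t, p). flow base
     (\<lambda>i. if i < n then (1 - t) * (real (meet_pos i (vert p i)) +
        max 0 (coord p i - real (meet_time i (vert p i)))) else 0))"

text \<open>\<open>to_rays\<close> is defined through the starting vertex of the half-open cube of a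
  point, which jumps from cube to cube. The same formula is valid from every vertex whose orthant
  contains the point, because passing to an ancestor lowers coordinate and meeting time together;
  this gives continuity across cubes.\<close>

lemma to_rays_flow:
  assumes v: "v \<in> vertices" and z: "z \<in> orthant" and t: "0 \<le> t"
  shows "to_rays (t, flow v z) =
    flow v (\<lambda>i. if i < n then z i + t * max 0 (real (meet_time i (v i)) - z i) else 0)"
proof -
  let ?k = "\<lambda>i. nat \<lfloor>z i\<rfloor>" and ?s = "\<lambda>i. frac (z i)"
  have zi: "z i = ?s i + real (?k i)" if "i < n" for i
    using z that by (simp add: orthant_def frac_def)
  have "to_rays (t, flow v z) = flow (up ?k v)
      (\<lambda>i. if i < n then ?s i + t * max 0 (real (meet_time i (up ?k v i)) - ?s i) else 0)"
    unfolding to_rays_def flow_def[of v z] by (simp add: up_closed[OF v] cong: if_cong)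
  also have "\<dots> = flow v (\<lambda>i.
      (if i < n then ?s i + t * max 0 (real (meet_time i (up ?k v i)) - ?s i) else 0) + real (?k i))"
    using t by (subst flow_shift) auto
  also have "(\<lambda>i. (if i < n then ?s i + t * max 0 (real (meet_time i (up ?k v i)) - ?s i) else 0) +
      real (?k i)) = (\<lambda>i. if i < n then z i + t * max 0 (real (meet_time i (v i)) - z i) else 0)"
  proof
    fix i
    show "(if i < n then ?s i + t * max 0 (real (meet_time i (up ?k v i)) - ?s i) else 0) + real (?k i) =
      (if i < n then z i + t * max 0 (real (meet_time i (v i)) - z i) else 0)"
    proof (cases "i < n")
      case True
      have "meet_time i (up ?k v i) = meet_time i (v i) - ?k i"
        using True meet_funpow(1)[OF True verticesD[OF v True]] by (simp add: up_def)
      moreover have "0 \<le> ?s i" by simp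
      ultimately have "max 0 (real (meet_time i (up ?k v i)) - ?s i) =
          max 0 (real (meet_time i (v i)) - (?s i + real (?k i)))"
        by (simp only: max_diff_shift(1))
      then show ?thesis using True zi[OF True] by simp
    next
      case False
      then show ?thesis using z by (simp add: orthant_def)
    qed
  qed
  finally show ?thesis .
qed

text \<open>The factor after \<open>1 - t\<close> is the distance from \<open>base i\<close> at
  which the flow arrives on the base ray, so it does not depend on the vertex from which the point
  is described.\<close>

lemma along_rays_flow:
  assumes v: "v \<in> vertices" and z: "z \<in> orthant"
  shows "along_rays (t, flow v z) = flow base (\<lambda>i. if i < n then
    (1 - t) * (real (meet_pos i (v i)) + max 0 (z i - real (meet_time i (v i)))) else 0)"
proof -
  let ?k = "\<lambda>i. nat \<lfloor>z i\<rfloor>" and ?s = "\<lambda>i. frac (z i)"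
  have "real (meet_pos i (up ?k v i)) + max 0 (?s i - real (meet_time i (up ?k v i))) =
      real (meet_pos i (v i)) + max 0 (z i - real (meet_time i (v i)))" if i: "i < n" for i
  proof -
    have "meet_time i (up ?k v i) = meet_time i (v i) - ?k i"
      "meet_pos i (up ?k v i) = meet_pos i (v i) + (?k i - meet_time i (v i))"
      using i meet_funpow[OF i verticesD[OF v i]] by (simp_all add: up_def)
    moreover have "z i = ?s i + real (?k i)"
      using z i by (simp add: orthant_def frac_def)
    ultimately show ?thesis
      using max_diff_shift(2)[of "?s i" "meet_pos i (v i)" "?k i" "meet_time i (v i)"] by simp
  qed
  then show ?thesis
    unfolding along_rays_def flow_def[of v z]
    by (simp add: up_closed[OF v] cong: if_cong)
qed

lemma contractible_space_space: "contractible_space space"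
proof -
  let ?c = "flow base (\<lambda>_. 0)"
  have cont_coord: "continuous_on S (\<lambda>x :: real \<times> (nat \<Rightarrow> real). snd x i)" for S i
    by (rule continuous_on_product_then_coordinatewise[OF continuous_on_snd[OF continuous_on_id]])
  have "continuous_map (prod_topology (top_of_set {0..1 :: real}) space) space to_rays"
  proof (rule continuous_map_homotopy)
    fix v assume v: "v \<in> vertices"
    let ?F = "\<lambda>(t, z) i. if i < n then z i + t * max 0 (real (meet_time i (v i)) - z i) else 0"
    have "continuous_on ({0..1} \<times> orthant) ?F"
      unfolding case_prod_unfold
    proof (rule continuous_on_coordinatewise_then_product)
      show "continuous_on ({0..1} \<times> orthant) (\<lambda>p. if i < n then snd p i +
          fst p * max 0 (real (meet_time i (v i)) - snd p i) else 0)" for i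
        by (cases "i < n") (auto intro!: continuous_intros cont_coord)
    qed
    moreover have "?F ` ({0..1} \<times> orthant) \<subseteq> orthant"
      by (auto simp: orthant_def)
    moreover have "\<forall>t\<in>{0..1}. \<forall>z\<in>orthant. to_rays (t, flow v z) = flow v (?F (t, z))"
      using to_rays_flow[OF v] by simp
    ultimately show "\<exists>w\<in>vertices. \<exists>F. continuous_on ({0..1} \<times> orthant) F \<and>
      F ` ({0..1} \<times> orthant) \<subseteq> orthant \<and>
      (\<forall>t\<in>{0..1}. \<forall>z\<in>orthant. to_rays (t, flow v z) = flow w (F (t, z)))"
      using v by blast
  qed
  moreover have "to_rays (0, p) = p" if "p \<in> points" for p
    using that
  proof (cases rule: points_cases)
    case (1 v s)
    then have "(\<lambda>i. if i < n then s i else 0) = s" by (auto simp: half_open_cube_def)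
    then show ?thesis
      using 1 to_rays_flow[of v s 0] half_open_cube_subset by (auto cong: if_cong)
  qed
  ultimately have "homotopic_with (\<lambda>_. True) space space id (\<lambda>p. to_rays (1, p))"
    by (subst homotopic_with) (auto intro!: exI[of _ to_rays])
  moreover have "homotopic_with (\<lambda>_. True) space space (\<lambda>p. to_rays (1, p)) (\<lambda>_. ?c)"
  proof -
    have "continuous_map (prod_topology (top_of_set {0..1 :: real}) space) space along_rays"
    proof (rule continuous_map_homotopy)
      fix v assume v: "v \<in> vertices"
      let ?F = "\<lambda>(t, z) i. if i < n then
        (1 - t) * (real (meet_pos i (v i)) + max 0 (z i - real (meet_time i (v i)))) else 0"
      have "continuous_on ({0..1} \<times> orthant) ?F"
        unfolding case_prod_unfold
      proof (rule continuous_on_coordinatewise_then_product)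
        show "continuous_on ({0..1} \<times> orthant) (\<lambda>p. if i < n then (1 - fst p) *
          (real (meet_pos i (v i)) + max 0 (snd p i - real (meet_time i (v i)))) else 0)" for i
          by (cases "i < n") (auto intro!: continuous_intros cont_coord)
      qed
      moreover have "?F ` ({0..1} \<times> orthant) \<subseteq> orthant"
        by (auto simp: orthant_def)
      moreover have "\<forall>t\<in>{0..1}. \<forall>z\<in>orthant. along_rays (t, flow v z) = flow base (?F (t, z))"
        using along_rays_flow[OF v] by simp
      ultimately show "\<exists>w\<in>vertices. \<exists>F. continuous_on ({0..1} \<times> orthant) F \<and>
        F ` ({0..1} \<times> orthant) \<subseteq> orthant \<and>
        (\<forall>t\<in>{0..1}. \<forall>z\<in>orthant. along_rays (t, flow v z) = flow w (F (t, z)))"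
        using base_in by blast
    qed
    moreover have "along_rays (0, p) = to_rays (1, p)" if "p \<in> points" for p
      using that
    proof (cases rule: points_cases)
      case (1 v s)
      let ?m = "\<lambda>i. meet_time i (v i)" and ?l = "\<lambda>i. meet_pos i (v i)"
      let ?y = "\<lambda>i. if i < n then max 0 (s i - real (?m i)) else 0"
      have s: "s \<in> orthant" using 1(2) half_open_cube_subset by blast
      \<comment> \<open>At time 1 coordinate \<open>i\<close> is on the base ray,
        \<open>?y i\<close> beyond the meeting vertex. That vertex is an ancestor of both
        \<open>v i\<close> and \<open>base i\<close>, so two uses of \<open>flow_shift\<close> lead
        from one orthant to the other.\<close>
      have "to_rays (1, p) = flow v (\<lambda>i. ?y i + real (if i < n then ?m i else 0))"
        unfolding 1(3) by (subst to_rays_flow[OF 1(1) s]) (auto intro!: arg_cong[of _ _ "flow v"] simp: fun_eq_iff max_def)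
      also have "\<dots> = flow (up (\<lambda>i. if i < n then ?m i else 0) v) ?y"
        by (rule flow_shift) auto
      also have "up (\<lambda>i. if i < n then ?m i else 0) v = up (\<lambda>i. if i < n then ?l i else 0) base"
      proof (rule up_cong)
        fix i assume i: "i < n"
        show "(par i ^^ (if i < n then ?m i else 0)) (v i) =
            (par i ^^ (if i < n then ?l i else 0)) (base i)"
          using meet_iff[OF i verticesD[OF 1(1) i], of "?m i" "?l i"] i by simp
      qed
      also have "flow \<dots> ?y = flow base (\<lambda>i. ?y i + real (if i < n then ?l i else 0))"
        by (rule flow_shift[symmetric]) auto
      also have "\<dots> = along_rays (0, p)"
        unfolding 1(3) by (subst along_rays_flow[OF 1(1) s]) (auto intro!: arg_cong[of _ _ "flow base"] simp: fun_eq_iff max_def)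
      finally show ?thesis ..
    qed
    moreover have "along_rays (1, p) = ?c" for p
      by (simp add: along_rays_def split_def cong: if_cong)
    ultimately show ?thesis
      by (subst homotopic_with) (auto intro!: exI[of _ along_rays])
  qed
  ultimately show ?thesis
    unfolding contractible_space_def using homotopic_with_trans by blast
qed

end

section \<open>The group action and the charts of the cells\<close>

lemma continuous_map_prod_discrete:
  "continuous_map (prod_topology (discrete_topology W) T) Y f \<longleftrightarrow>
     (\<forall>v\<in>W. continuous_map T Y (\<lambda>z. f (v, z)))" (is "?L \<longleftrightarrow> ?R")
proof
  assume L: ?L
  show ?R
  proof
    fix v assume "v \<in> W"
    then have "continuous_map T (prod_topology (discrete_topology W) T) (\<lambda>z. (v, z))"
      by (simp add: continuous_map_paired)
    from continuous_map_compose[OF this L] show "continuous_map T Y (\<lambda>z. f (v, z))"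
      by (simp add: comp_def)
  qed
next
  assume R: ?R
  show ?L unfolding continuous_map_def
  proof (intro conjI allI impI)
    show "f \<in> topspace (prod_topology (discrete_topology W) T) \<rightarrow> topspace Y"
      using R by (auto simp: continuous_map_def)
  next
    fix U assume U: "openin Y U"
    have "openin T {z. (v, z) \<in> {x \<in> W \<times> topspace T. f x \<in> U}}" if "v \<in> W" for v
      using openin_continuous_map_preimage[OF _ U] R that by fastforce
    then show "openin (prod_topology (discrete_topology W) T)
        {x \<in> topspace (prod_topology (discrete_topology W) T). f x \<in> U}"
      by (auto simp: openin_prod_discrete)
  qed
qed

text \<open>Numbers the directions of a face in increasing order, to match them with the coordinates
  of a disc of dimension \<open>card E\<close>.\<close>

definition position :: "nat set \<Rightarrow> nat \<Rightarrow> nat" where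
  "position E i = card {j \<in> E. j < i}"

lemma bij_betw_position:
  assumes "finite E" shows "bij_betw (position E) E {..<card E}"
proof -
  have less: "position E i < position E j" if "i \<in> E" "i < j" for i j
    unfolding position_def using that assms by (intro psubset_card_mono) auto
  then have inj: "inj_on (position E) E"
    by (metis inj_onI less_irrefl linorder_less_linear)
  moreover have "position E ` E \<subseteq> {..<card E}"
    unfolding position_def using assms by (auto intro!: psubset_card_mono)
  ultimately show ?thesis
    using card_image[OF inj] by (simp add: bij_betw_def card_subset_eq)
qed

lemma position_surj: "finite E \<Longrightarrow> k < card E \<Longrightarrow> \<exists>i\<in>E. position E i = k"
  using bij_betw_imp_surj_on[OF bij_betw_position, of E] by (metis imageE lessThan_iff)

text \<open>Parametrizes the face of the unit cube through the origin with directions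
  \<open>E\<close>. A face at another corner becomes one of these when the corner is absorbed into
  the starting vertex.\<close>

definition chart :: "nat set \<Rightarrow> (nat \<Rightarrow> real) \<Rightarrow> nat \<Rightarrow> real" where
  "chart E x = (\<lambda>i. if i \<in> E then disc_to_cube (card E) x (position E i) else 0)"

lemma continuous_on_chart: "continuous_on (disc_points (card E)) (chart E)"
proof (intro continuous_on_coordinatewise_then_product)
  show "continuous_on (disc_points (card E)) (\<lambda>x. chart E x i)" for i
    using continuous_on_product_then_coordinatewise[OF continuous_on_disc_to_cube]
    by (cases "i \<in> E") (auto simp: chart_def)
qed

lemma chart_bounds:
  "x \<in> disc_points (card E) \<Longrightarrow> 0 \<le> chart E x i" "x \<in> disc_points (card E) \<Longrightarrow> chart E x i \<le> 1"
  by (auto simp: chart_def disc_to_cube_bounds)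

lemma chart_interior:
  assumes "finite E" "x \<in> disc_points (card E) - disc_boundary (card E)" "i \<in> E"
  shows "0 < chart E x i" "chart E x i < 1"
proof -
  have "position E i < card E"
    using bij_betw_position[OF assms(1)] assms(3) by (auto simp: bij_betw_def)
  then show "0 < chart E x i" "chart E x i < 1"
    using disc_to_cube_interior[OF assms(2)] assms(3) by (auto simp: chart_def)
qed

lemma chart_boundary:
  assumes "finite E" "x \<in> disc_boundary (card E)"
  shows "\<exists>i\<in>E. chart E x i = 0 \<or> chart E x i = 1"
proof -
  obtain k where k: "k < card E" "disc_to_cube (card E) x k = 0 \<or> disc_to_cube (card E) x k = 1"
    using disc_to_cube_boundary[OF assms(2)] by blast
  then obtain i where "i \<in> E" "position E i = k"
    using position_surj[OF assms(1)] by blast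
  then show ?thesis using k by (auto simp: chart_def)
qed

lemma inj_on_chart: "finite E \<Longrightarrow> inj_on (chart E) (disc_points (card E))"
proof (rule inj_onI)
  fix x y assume E: "finite E" and xy: "x \<in> disc_points (card E)" "y \<in> disc_points (card E)"
    "chart E x = chart E y"
  have "disc_to_cube (card E) x k = disc_to_cube (card E) y k" for k
  proof (cases "k < card E")
    case True
    then obtain i where "i \<in> E" "position E i = k"
      using position_surj[OF E] by blast
    then show ?thesis using fun_cong[OF xy(3), of i] by (simp add: chart_def)
  qed (simp add: disc_to_cube_def)
  then have "disc_to_cube (card E) x = disc_to_cube (card E) y" by (rule ext)
  then show "x = y" using inj_on_disc_to_cube xy(1,2) by (auto dest: inj_onD)
qed

lemma chart_surj:
  assumes E: "finite E" and y: "\<And>i. i \<in> E \<Longrightarrow> 0 \<le> y i \<and> y i \<le> 1" "\<And>i. i \<notin> E \<Longrightarrow> y i = 0"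
  obtains x where "x \<in> disc_points (card E)" "chart E x = y"
proof -
  let ?inv = "inv_into E (position E)"
  let ?z = "\<lambda>k. if k < card E then y (?inv k) else 0"
  have inv: "?inv k \<in> E" if "k < card E" for k
    using bij_betw_position[OF E] that by (metis bij_betw_def inv_into_into lessThan_iff)
  obtain x where x: "x \<in> disc_points (card E)" "disc_to_cube (card E) x = ?z"
    by (rule disc_to_cube_surj[of "card E" ?z]) (use inv y in auto)
  have "chart E x i = y i" for i
  proof (cases "i \<in> E")
    case True
    then have "position E i < card E" "?inv (position E i) = i"
      using bij_betw_position[OF E] by (auto simp: bij_betw_def inv_into_f_f)
    then show ?thesis using True by (simp add: chart_def x(2))
  qed (simp add: chart_def y)
  then have "chart E x = y" by (rule ext)
  then show ?thesis using that x(1) by blast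
qed

context tree_product
begin

section \<open>The action on points\<close>

lemma carrier_closed [simp]:
  "\<one>\<^bsub>G\<^esub> \<in> carrier G"
  "g \<in> carrier G \<Longrightarrow> inv\<^bsub>G\<^esub> g \<in> carrier G"
  "g \<in> carrier G \<Longrightarrow> h \<in> carrier G \<Longrightarrow> g \<otimes>\<^bsub>G\<^esub> h \<in> carrier G"
  using group by (simp_all add: group.is_monoid monoid.m_closed)

definition act_vertex :: "'g \<Rightarrow> (nat \<Rightarrow> 'v) \<Rightarrow> nat \<Rightarrow> 'v" where
  "act_vertex g v = (\<lambda>i\<in>{..<n}. act i g (v i))"

text \<open>Only the starting vertex moves, so stabilizers of points are stabilizers of vertices of
  the product. The function is extensional because \<open>BijGroup\<close> consists of extensional
  bijections.\<close>

definition move :: "'g \<Rightarrow> 'g complex_point \<Rightarrow> 'g complex_point" where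
  "move g = (\<lambda>p\<in>points. pt (act_vertex g (vert p)) (coord p))"

definition stab :: "(nat \<Rightarrow> 'v) \<Rightarrow> 'g set" where
  "stab v = {g \<in> carrier G. act_vertex g v = v}"

lemma act_vertex_closed: "g \<in> carrier G \<Longrightarrow> v \<in> vertices \<Longrightarrow> act_vertex g v \<in> vertices"
  by (auto simp: vertices_def act_vertex_def intro!: act_closed)

lemma act_vertex_one: "v \<in> vertices \<Longrightarrow> act_vertex \<one>\<^bsub>G\<^esub> v = v"
  using act_one by (auto simp: vertices_def act_vertex_def fun_eq_iff PiE_iff extensional_def)

lemma act_vertex_mult:
  "g \<in> carrier G \<Longrightarrow> h \<in> carrier G \<Longrightarrow> v \<in> vertices \<Longrightarrow>
    act_vertex (g \<otimes>\<^bsub>G\<^esub> h) v = act_vertex g (act_vertex h v)"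
  using act_mult by (auto simp: act_vertex_def fun_eq_iff dest: verticesD)

lemma act_vertex_inv:
  assumes "g \<in> carrier G" "v \<in> vertices"
  shows "act_vertex (inv\<^bsub>G\<^esub> g) (act_vertex g v) = v" "act_vertex g (act_vertex (inv\<^bsub>G\<^esub> g) v) = v"
  using act_vertex_mult[of "inv\<^bsub>G\<^esub> g" g v] act_vertex_mult[of g "inv\<^bsub>G\<^esub> g" v] assms
  by (simp_all add: group.l_inv[OF group] group.r_inv[OF group] act_vertex_one)

lemma act_vertex_up:
  assumes g: "g \<in> carrier G" and v: "v \<in> vertices"
  shows "act_vertex g (up k v) = up k (act_vertex g v)"
proof -
  have "act i g ((par i ^^ j) u) = (par i ^^ j) (act i g u)" if "i < n" "u \<in> V i" for i j u
    using that by (induction j) (auto simp: act_par g funpow_par_closed)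
  then show ?thesis using verticesD[OF v] by (auto simp: act_vertex_def up_def)
qed

lemma move_pt:
  "v \<in> vertices \<Longrightarrow> s \<in> half_open_cube \<Longrightarrow> move g (pt v s) = pt (act_vertex g v) s"
  by (auto simp: move_def points_def)

lemma move_flow:
  assumes "g \<in> carrier G" "v \<in> vertices" "z \<in> orthant"
  shows "move g (flow v z) = flow (act_vertex g v) z"
  unfolding flow_def using assms
  by (simp add: move_pt up_closed frac_half_open_cube act_vertex_up)

lemma pt_in_points: "v \<in> vertices \<Longrightarrow> s \<in> half_open_cube \<Longrightarrow> pt v s \<in> points"
  by (auto simp: points_def)

lemma move_closed: "g \<in> carrier G \<Longrightarrow> p \<in> points \<Longrightarrow> move g p \<in> points"
proof -
  assume "g \<in> carrier G" "p \<in> points"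
  moreover from this obtain v s where "v \<in> vertices" "s \<in> half_open_cube" "p = pt v s"
    by (auto simp: points_def)
  ultimately show ?thesis by (simp add: move_pt pt_in_points act_vertex_closed)
qed

lemma move_inv:
  "g \<in> carrier G \<Longrightarrow> p \<in> points \<Longrightarrow> move (inv\<^bsub>G\<^esub> g) (move g p) = p"
  "g \<in> carrier G \<Longrightarrow> p \<in> points \<Longrightarrow> move g (move (inv\<^bsub>G\<^esub> g) p) = p"
  by (auto simp: points_def move_pt act_vertex_closed act_vertex_inv)

lemma move_Bij: "g \<in> carrier G \<Longrightarrow> move g \<in> Bij points"
proof -
  assume g: "g \<in> carrier G"
  have "bij_betw (move g) points points"
    by (rule bij_betw_byWitness[where f' = "move (inv\<^bsub>G\<^esub> g)"])
      (use g in \<open>auto simp: move_inv move_closed\<close>)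
  then show ?thesis by (simp add: Bij_def) (simp add: move_def)
qed

lemma group_action_move: "group_action G points move"
  unfolding group_action_def group_hom_def group_hom_axioms_def
proof (intro conjI)
  show "move \<in> hom G (BijGroup points)"
  proof (rule homI)
    fix g assume "g \<in> carrier G"
    then show "move g \<in> carrier (BijGroup points)" by (simp add: BijGroup_def move_Bij)
  next
    fix g h assume gh: "g \<in> carrier G" "h \<in> carrier G"
    have "move (g \<otimes>\<^bsub>G\<^esub> h) p = compose points (move g) (move h) p" for p
    proof (cases "p \<in> points")
      case True
      then show ?thesis using gh
        by (auto simp: points_def compose_def move_pt act_vertex_closed act_vertex_mult)
    qed (simp add: compose_def move_def)
    then show "move (g \<otimes>\<^bsub>G\<^esub> h) = move g \<otimes>\<^bsub>BijGroup points\<^esub> move h"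
      using gh by (simp add: BijGroup_def move_Bij fun_eq_iff)
  qed
qed (simp_all add: group group_BijGroup)

lemma continuous_map_move:
  assumes g: "g \<in> carrier G" shows "continuous_map space space (move g)"
proof (rule continuous_compose_quotient_map[OF quotient_map_flow])
  have "continuous_map (top_of_set orthant) space (\<lambda>z. move g (flow v z))" if "v \<in> vertices" for v
    using continuous_map_flow[OF act_vertex_closed[OF g that] continuous_on_id, of orthant]
    by (rule continuous_map_eq) (auto simp: move_flow g that)
  then show "continuous_map (prod_topology (discrete_topology vertices) (top_of_set orthant)) space
      (move g \<circ> (\<lambda>(v, z). flow v z))"
    by (simp add: continuous_map_prod_discrete)
qed

lemma subgroup_stab:
  assumes v: "v \<in> vertices" shows "subgroup (stab v) G"
proof (rule group.subgroupI[OF group])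
  show "stab v \<subseteq> carrier G" by (auto simp: stab_def)
  have "\<one>\<^bsub>G\<^esub> \<in> stab v" using v by (simp add: stab_def act_vertex_one)
  then show "stab v \<noteq> {}" by blast
next
  fix g assume "g \<in> stab v"
  then show "inv\<^bsub>G\<^esub> g \<in> stab v"
    using act_vertex_inv(1)[of g v] v by (simp add: stab_def)
next
  fix g h assume "g \<in> stab v" "h \<in> stab v"
  then show "g \<otimes>\<^bsub>G\<^esub> h \<in> stab v"
    using v by (simp add: stab_def act_vertex_mult)
qed

lemma stabilizer_move:
  "v \<in> vertices \<Longrightarrow> s \<in> half_open_cube \<Longrightarrow> stabilizer G move (pt v s) = stab v"
  by (auto simp: stabilizer_def stab_def move_pt pt_eq_iff act_vertex_closed)

text \<open>A zero coordinate places the point at a vertex of the corresponding tree, so the number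
  of nonzero coordinates is the dimension of the open cube that contains it.\<close>

definition skeleton :: "nat \<Rightarrow> 'g complex_point set" where
  "skeleton m = {p \<in> points. card {i. coord p i \<noteq> 0} \<le> m}"

text \<open>The skeleton of one dimension less; the strict inequality makes it empty for
  \<open>m = 0\<close>.\<close>

definition below :: "nat \<Rightarrow> 'g complex_point set" where
  "below m = {p \<in> points. card {i. coord p i \<noteq> 0} < m}"

lemma below_eq: "below m = (if m = 0 then {} else skeleton (m - 1))"
  by (auto simp: below_def skeleton_def)

lemma below_subset: "below m \<subseteq> skeleton m"
  by (auto simp: below_def skeleton_def)

lemma skeleton_subset: "skeleton m \<subseteq> points"
  by (auto simp: skeleton_def)

lemma coord_flow: "coord (flow v z) = (\<lambda>i. frac (z i))"
  by (simp add: flow_def)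

lemma support_subset: "z \<in> orthant \<Longrightarrow> {i. frac (z i) \<noteq> 0} \<subseteq> {..<n}"
proof (rule subsetI, rule ccontr)
  fix i assume z: "z \<in> orthant" and i: "i \<in> {i. frac (z i) \<noteq> 0}" "i \<notin> {..<n}"
  then have "z i = 0" by (simp add: orthant_def)
  then show False using i(1) by simp
qed

lemma skeleton_n: "skeleton n = points"
proof -
  have "card {i. coord p i \<noteq> 0} \<le> n" if "p \<in> points" for p
    using that
  proof (cases rule: points_cases)
    case (1 v s)
    then have "{i. coord p i \<noteq> 0} \<subseteq> {..<n}"
      using support_subset half_open_cube_subset by (auto simp: coord_flow)
    then show ?thesis using card_mono[of "{..<n}"] by fastforce
  qed
  then show ?thesis by (auto simp: skeleton_def)
qed

text \<open>In an orthant, fewer than \<open>m\<close> coordinates are nonintegral exactly if every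
  set of \<open>m\<close> coordinates contains an integral one. This is a finite combination of the
  closed conditions \<open>z i \<in> \<int>\<close>.\<close>

lemma closedin_below: "closedin space (below m)"
  unfolding closedin_space
proof (intro conjI ballI)
  fix v assume v: "v \<in> vertices"
  let ?\<F> = "{F. F \<subseteq> {..<n} \<and> card F = m}"
  have *: "card {i. frac (z i) \<noteq> 0} < m \<longleftrightarrow> (\<forall>F\<in>?\<F>. \<exists>i\<in>F. z i \<in> \<int>)" if "z \<in> orthant" for z
  proof
    assume less: "card {i. frac (z i) \<noteq> 0} < m"
    show "\<forall>F\<in>?\<F>. \<exists>i\<in>F. z i \<in> \<int>"
    proof (intro ballI, rule ccontr)
      fix F assume F: "F \<in> ?\<F>" "\<not> (\<exists>i\<in>F. z i \<in> \<int>)"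
      then have "F \<subseteq> {i. frac (z i) \<noteq> 0}" by (auto simp: frac_eq_0_iff)
      then show False
        using F less card_mono[of "{i. frac (z i) \<noteq> 0}" F] finite_subset[OF support_subset[OF that]]
        by auto
    qed
  next
    assume all: "\<forall>F\<in>?\<F>. \<exists>i\<in>F. z i \<in> \<int>"
    show "card {i. frac (z i) \<noteq> 0} < m"
    proof (rule ccontr)
      assume "\<not> card {i. frac (z i) \<noteq> 0} < m"
      then obtain F where F: "F \<subseteq> {i. frac (z i) \<noteq> 0}" "card F = m"
        using obtain_subset_with_card_n[of m "{i. frac (z i) \<noteq> 0}"] by auto
      then have "F \<in> ?\<F>" using support_subset[OF that] by blast
      then obtain i where "i \<in> F" "z i \<in> \<int>" using all by blast
      then show False using F by auto
    qed
  qed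
  have "orthant \<inter> flow v -` below m = orthant \<inter> (\<Inter>F\<in>?\<F>. \<Union>i\<in>F. {z. z i \<in> \<int>})"
    using * v by (auto simp: below_def coord_flow flow_closed)
  moreover have Ints: "closed {z :: nat \<Rightarrow> real. z i \<in> \<int>}" for i
    using closed_vimage[OF closed_Ints continuous_on_coordinate, of i] by (simp add: vimage_def)
  have "closed (\<Inter>F\<in>?\<F>. \<Union>i\<in>F. {z :: nat \<Rightarrow> real. z i \<in> \<int>})"
    by (intro closed_INT ballI closed_UN Ints) (auto intro: finite_subset)
  ultimately show "closed (orthant \<inter> flow v -` below m)"
    using closed_Int[OF closed_orthant] by simp
qed (auto simp: below_def)

lemma chart_in_orthant: "E \<subseteq> {..<n} \<Longrightarrow> x \<in> disc_points (card E) \<Longrightarrow> chart E x \<in> orthant"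
proof -
  assume E: "E \<subseteq> {..<n}" and x: "x \<in> disc_points (card E)"
  have "chart E x i = 0" if "n \<le> i" for i
    using E that by (auto simp: chart_def)
  then show ?thesis using chart_bounds(1)[OF x] by (simp add: orthant_def)
qed

lemma chart_in_half_open_cube:
  assumes "E \<subseteq> {..<n}" "x \<in> disc_points (card E) - disc_boundary (card E)"
  shows "chart E x \<in> half_open_cube" "{i. chart E x i \<noteq> 0} = E"
proof -
  have "finite E" using assms(1) finite_subset by blast
  then have pos: "0 < chart E x i" "chart E x i < 1" if "i \<in> E" for i
    using chart_interior assms(2) that by auto
  have zero: "chart E x i = 0" if "i \<notin> E" for i using that by (simp add: chart_def)
  show "chart E x \<in> half_open_cube"
    unfolding half_open_cube_def
  proof (intro CollectI conjI allI impI)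
    show "0 \<le> chart E x i" "chart E x i < 1" for i
      using pos[of i] zero[of i] by (cases "i \<in> E"; simp)+
    show "chart E x i = 0" if "n \<le> i" for i using assms(1) that by (intro zero) auto
  qed
  show "{i. chart E x i \<noteq> 0} = E" using pos(1) zero by force
qed

lemma flow_chart_in_skeleton:
  assumes "v \<in> vertices" "E \<subseteq> {..<n}" "x \<in> disc_points (card E)"
  shows "flow v (chart E x) \<in> skeleton (card E)"
    and "x \<in> disc_boundary (card E) \<Longrightarrow> flow v (chart E x) \<in> below (card E)"
proof -
  have fin: "finite E" using assms(2) finite_subset by blast
  have sub: "{i. frac (chart E x i) \<noteq> 0} \<subseteq> E"
    by (auto simp: chart_def)
  have pts: "flow v (chart E x) \<in> points"
    using flow_closed[OF assms(1) chart_in_orthant[OF assms(2,3)]] .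
  then show "flow v (chart E x) \<in> skeleton (card E)"
    using card_mono[OF fin sub] by (simp add: skeleton_def coord_flow)
  assume "x \<in> disc_boundary (card E)"
  then obtain i where i: "i \<in> E" "chart E x i = 0 \<or> chart E x i = 1"
    using chart_boundary[OF fin] by blast
  \<comment> \<open>A coordinate 1 is carried over into the starting vertex as one step to the
    parent, so both kinds of boundary points lose the direction \<open>i\<close>.\<close>
  then have "frac (chart E x i) = 0" by (elim disjE) simp_all
  then have "{i. frac (chart E x i) \<noteq> 0} \<subset> E" using sub i(1) by blast
  from psubset_card_mono[OF fin this] pts show "flow v (chart E x) \<in> below (card E)"
    by (simp add: below_def coord_flow)
qed

text \<open>The choice is made from the orbit as a set and so depends on the orbit alone. This
  yields one equivariant cell for each orbit of cubes.\<close>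

definition orbit_rep :: "(nat \<Rightarrow> 'v) \<Rightarrow> nat \<Rightarrow> 'v" where
  "orbit_rep v = (SOME u. u \<in> (\<lambda>g. act_vertex g v) ` carrier G)"

lemma orbit_rep_in: "v \<in> vertices \<Longrightarrow> \<exists>g\<in>carrier G. orbit_rep v = act_vertex g v"
proof -
  have "\<exists>u. u \<in> (\<lambda>g. act_vertex g v) ` carrier G"
    using carrier_closed(1) by blast
  then have "orbit_rep v \<in> (\<lambda>g. act_vertex g v) ` carrier G"
    unfolding orbit_rep_def by (rule someI_ex)
  then show ?thesis by blast
qed

lemma orbit_rep_act: "v \<in> vertices \<Longrightarrow> g \<in> carrier G \<Longrightarrow> orbit_rep (act_vertex g v) = orbit_rep v"
proof -
  assume v: "v \<in> vertices" and g: "g \<in> carrier G"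
  have "(\<lambda>h. act_vertex h (act_vertex g v)) ` carrier G = (\<lambda>h. act_vertex h v) ` carrier G"
  proof (intro equalityI subsetI)
    fix u assume "u \<in> (\<lambda>h. act_vertex h (act_vertex g v)) ` carrier G"
    then obtain h where "h \<in> carrier G" "u = act_vertex (h \<otimes>\<^bsub>G\<^esub> g) v"
      using v g act_vertex_mult by auto
    then show "u \<in> (\<lambda>h. act_vertex h v) ` carrier G"
      using g by (intro rev_image_eqI) auto
  next
    fix u assume "u \<in> (\<lambda>h. act_vertex h v) ` carrier G"
    then obtain h where h: "h \<in> carrier G" "u = act_vertex h v" by blast
    then have "u = act_vertex (h \<otimes>\<^bsub>G\<^esub> inv\<^bsub>G\<^esub> g) (act_vertex g v)"
      using v g by (simp add: act_vertex_mult act_vertex_closed act_vertex_inv)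
    then show "u \<in> (\<lambda>h. act_vertex h (act_vertex g v)) ` carrier G"
      using h g by (intro rev_image_eqI) auto
  qed
  then show ?thesis by (simp add: orbit_rep_def)
qed

text \<open>The coset of \<open>g\<close> names the cube with directions \<open>E\<close> that
  starts at \<open>act_vertex g v\<close>. The choice from the coset is harmless since all its
  elements send \<open>v\<close> to the same vertex.\<close>

definition cell :: "nat set \<Rightarrow> (nat \<Rightarrow> 'v) \<Rightarrow> 'g set \<times> ('g set \<times> (nat \<Rightarrow> real) \<Rightarrow> 'g complex_point)" where
  "cell E v = (stab v, \<lambda>(C, x). flow (act_vertex (SOME g. g \<in> C) v) (chart E x))"

definition cells :: "nat \<Rightarrow> ('g set \<times> ('g set \<times> (nat \<Rightarrow> real) \<Rightarrow> 'g complex_point)) set" where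
  "cells m = {cell E v | E v. E \<subseteq> {..<n} \<and> card E = m \<and> v \<in> orbit_rep ` vertices}"

lemma cell_coset:
  assumes v: "v \<in> vertices" and g: "g \<in> carrier G"
  shows "snd (cell E v) (g <#\<^bsub>G\<^esub> stab v, x) = flow (act_vertex g v) (chart E x)"
proof -
  have "g \<otimes>\<^bsub>G\<^esub> \<one>\<^bsub>G\<^esub> \<in> g <#\<^bsub>G\<^esub> stab v"
    using subgroup.one_closed[OF subgroup_stab[OF v]] by (auto simp: l_coset_def)
  then have "(SOME h. h \<in> g <#\<^bsub>G\<^esub> stab v) \<in> g <#\<^bsub>G\<^esub> stab v"
    by (rule someI)
  then obtain h where "h \<in> stab v" "(SOME h. h \<in> g <#\<^bsub>G\<^esub> stab v) = g \<otimes>\<^bsub>G\<^esub> h"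
    by (auto simp: l_coset_def)
  then show ?thesis
    using v g by (simp add: cell_def act_vertex_mult) (simp add: stab_def act_vertex_mult)
qed

end

section \<open>The cell structure\<close>

context tree_product
begin

lemma lcosetsE:
  assumes "C \<in> lcosets\<^bsub>G\<^esub> H"
  obtains g where "g \<in> carrier G" "C = g <#\<^bsub>G\<^esub> H"
  using assms by (auto simp: LCOSETS_def)

lemma lcosetsI: "g \<in> carrier G \<Longrightarrow> g <#\<^bsub>G\<^esub> H \<in> lcosets\<^bsub>G\<^esub> H"
  by (auto simp: LCOSETS_def)

lemma orbit_rep_closed: "v \<in> vertices \<Longrightarrow> orbit_rep v \<in> vertices"
  using orbit_rep_in act_vertex_closed by metis

lemma in_orbit_of_rep:
  assumes "v \<in> vertices" obtains g where "g \<in> carrier G" "v = act_vertex g (orbit_rep v)"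
proof -
  obtain g where "g \<in> carrier G" "orbit_rep v = act_vertex g v"
    using orbit_rep_in[OF assms] by blast
  then show ?thesis
    using that[of "inv\<^bsub>G\<^esub> g"] act_vertex_inv(1)[of g v] assms by simp
qed

lemma cellsE:
  assumes "(H, \<Phi>) \<in> cells m"
  obtains E v where "E \<subseteq> {..<n}" "card E = m" "v \<in> vertices" "orbit_rep v = v" "H = stab v"
    "(H, \<Phi>) = cell E v"
    "\<forall>g\<in>carrier G. \<forall>x. \<Phi> (g <#\<^bsub>G\<^esub> H, x) = flow (act_vertex g v) (chart E x)"
proof -
  obtain E u where *: "(H, \<Phi>) = cell E (orbit_rep u)" "E \<subseteq> {..<n}" "card E = m" "u \<in> vertices"
    using assms by (auto simp: cells_def)
  have u: "orbit_rep u \<in> vertices" "orbit_rep (orbit_rep u) = orbit_rep u"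
    using *(4) orbit_rep_closed orbit_rep_in[OF *(4)] by (auto simp: orbit_rep_act)
  have "H = stab (orbit_rep u)" using *(1) by (simp add: cell_def)
  moreover have "\<Phi> = snd (cell E (orbit_rep u))" using *(1) by (metis snd_conv)
  ultimately show ?thesis
    using that[of E "orbit_rep u"] * u cell_coset[OF u(1)] by simp
qed

lemma continuous_map_cell:
  assumes "(H, \<Phi>) \<in> cells m"
  shows "continuous_map (prod_topology (discrete_topology (lcosets\<^bsub>G\<^esub> H)) (closed_disc m))
           (subtopology space (skeleton m)) \<Phi>"
  unfolding continuous_map_prod_discrete
proof
  obtain E v where E: "E \<subseteq> {..<n}" "card E = m"
    and v: "v \<in> vertices" "orbit_rep v = v" "H = stab v" and cell: "(H, \<Phi>) = cell E v"
    and \<Phi>_all: "\<forall>g\<in>carrier G. \<forall>x. \<Phi> (g <#\<^bsub>G\<^esub> H, x) = flow (act_vertex g v) (chart E x)"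
    using assms by (rule cellsE)
    note \<Phi> = \<Phi>_all[rule_format]
  fix C assume "C \<in> lcosets\<^bsub>G\<^esub> H"
  then obtain g where g: "g \<in> carrier G" "C = g <#\<^bsub>G\<^esub> H" by (rule lcosetsE)
  have gv: "act_vertex g v \<in> vertices" using act_vertex_closed[OF g(1) v(1)] .
  have "continuous_map (closed_disc m) space (\<lambda>x. flow (act_vertex g v) (chart E x))"
    unfolding closed_disc_eq
    using continuous_on_chart[of E] chart_in_orthant[OF E(1)] E(2)
    by (intro continuous_map_flow[OF gv]) auto
  then show "continuous_map (closed_disc m) (subtopology space (skeleton m)) (\<lambda>x. \<Phi> (C, x))"
    using flow_chart_in_skeleton(1)[OF gv E(1)] E(2)
    by (auto simp: continuous_map_in_subtopology g(2) \<Phi>[OF g(1)])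
qed

lemma cell_equivariant:
  assumes "(H, \<Phi>) \<in> cells m" "g \<in> carrier G" "C \<in> lcosets\<^bsub>G\<^esub> H" "x \<in> disc_points m"
  shows "\<Phi> (g <#\<^bsub>G\<^esub> C, x) = move g (\<Phi> (C, x))"
proof -
  obtain E v where E: "E \<subseteq> {..<n}" "card E = m"
    and v: "v \<in> vertices" "orbit_rep v = v" "H = stab v" and cell: "(H, \<Phi>) = cell E v"
    and \<Phi>_all: "\<forall>g\<in>carrier G. \<forall>x. \<Phi> (g <#\<^bsub>G\<^esub> H, x) = flow (act_vertex g v) (chart E x)"
    using assms(1) by (rule cellsE)
    note \<Phi> = \<Phi>_all[rule_format]
  obtain h where h: "h \<in> carrier G" "C = h <#\<^bsub>G\<^esub> H" using assms(3) by (rule lcosetsE)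
  have "g <#\<^bsub>G\<^esub> C = (g \<otimes>\<^bsub>G\<^esub> h) <#\<^bsub>G\<^esub> H"
    using group.lcos_m_assoc[OF group _ assms(2) h(1)] subgroup.subset[OF subgroup_stab[OF v(1)]]
    by (simp add: h(2) v(3))
  then have "\<Phi> (g <#\<^bsub>G\<^esub> C, x) = flow (act_vertex (g \<otimes>\<^bsub>G\<^esub> h) v) (chart E x)"
    using \<Phi>[of "g \<otimes>\<^bsub>G\<^esub> h"] assms(2) h(1) by simp
  moreover have "\<Phi> (C, x) = flow (act_vertex h v) (chart E x)"
    using \<Phi>[OF h(1)] h(2) by simp
  ultimately show ?thesis
    using assms(2,4) E h(1) v(1)
    by (simp add: move_flow act_vertex_closed chart_in_orthant act_vertex_mult)
qed

lemma cell_boundary: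
  assumes "(H, \<Phi>) \<in> cells m"
  shows "\<Phi> ` ((lcosets\<^bsub>G\<^esub> H) \<times> disc_boundary m) \<subseteq> below m"
proof -
  obtain E v where E: "E \<subseteq> {..<n}" "card E = m"
    and v: "v \<in> vertices" "orbit_rep v = v" "H = stab v" and cell: "(H, \<Phi>) = cell E v"
    and \<Phi>_all: "\<forall>g\<in>carrier G. \<forall>x. \<Phi> (g <#\<^bsub>G\<^esub> H, x) = flow (act_vertex g v) (chart E x)"
    using assms by (rule cellsE)
    note \<Phi> = \<Phi>_all[rule_format]
  show ?thesis
  proof (rule image_subsetI)
    fix p assume "p \<in> (lcosets\<^bsub>G\<^esub> H) \<times> disc_boundary m"
    then obtain C x where p: "p = (C, x)" "C \<in> lcosets\<^bsub>G\<^esub> H" and x: "x \<in> disc_boundary m"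
      by blast
    obtain g where g: "g \<in> carrier G" "C = g <#\<^bsub>G\<^esub> H" using p(2) by (rule lcosetsE)
    show "\<Phi> p \<in> below m"
      using flow_chart_in_skeleton(2)[OF act_vertex_closed[OF g(1) v(1)] E(1), of x] x E(2)
      by (simp add: p(1) g(2) \<Phi>[OF g(1)] disc_boundary_eq)
  qed
qed

text \<open>A point outside the lower skeleton has a unique form \<open>pt u s\<close> with
  \<open>m\<close> nonzero coordinates. The support of \<open>s\<close> is \<open>E\<close>, the
  values of \<open>s\<close> give the point of the open disc, and \<open>u\<close> determines its
  orbit representative and a coset of the stabilizer.\<close>

lemma bij_betw_cells:
  "bij_betw (\<lambda>((H, \<Phi>), p). \<Phi> p)
     (SIGMA (H, \<Phi>) : cells m. (lcosets\<^bsub>G\<^esub> H) \<times> (disc_points m - disc_boundary m))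
     (skeleton m - below m)"
  unfolding bij_betw_def
proof
  let ?S = "SIGMA (H, \<Phi>) : cells m. (lcosets\<^bsub>G\<^esub> H) \<times> (disc_points m - disc_boundary m)"
  \<comment> \<open>On an open cell no coordinate reaches 1, hence \<open>flow\<close> reduces to
    \<open>pt\<close>, whose injectivity recovers the data.\<close>
  have descr: "\<exists>E v g. E \<subseteq> {..<n} \<and> card E = m \<and> v \<in> vertices \<and> orbit_rep v = v \<and> g \<in> carrier G \<and>
      (H, \<Phi>) = cell E v \<and> H = stab v \<and> C = g <#\<^bsub>G\<^esub> stab v \<and>
      x \<in> disc_points m - disc_boundary m \<and> \<Phi> (C, x) = pt (act_vertex g v) (chart E x) \<and>
      chart E x \<in> half_open_cube \<and> {i. chart E x i \<noteq> 0} = E"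
    if "((H, \<Phi>), (C, x)) \<in> ?S" for H \<Phi> C x
  proof -
    have 1: "(H, \<Phi>) \<in> cells m" "C \<in> lcosets\<^bsub>G\<^esub> H" "x \<in> disc_points m - disc_boundary m"
      using that by auto
    obtain E v where E: "E \<subseteq> {..<n}" "card E = m"
      and v: "v \<in> vertices" "orbit_rep v = v" "H = stab v" and cell: "(H, \<Phi>) = cell E v"
      and \<Phi>_all: "\<forall>g\<in>carrier G. \<forall>x. \<Phi> (g <#\<^bsub>G\<^esub> H, x) = flow (act_vertex g v) (chart E x)"
      using 1(1) by (rule cellsE)
      note \<Phi> = \<Phi>_all[rule_format]
    obtain g where g: "g \<in> carrier G" "C = g <#\<^bsub>G\<^esub> H" using 1(2) by (rule lcosetsE)
    have ch: "chart E x \<in> half_open_cube" "{i. chart E x i \<noteq> 0} = E"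
      using chart_in_half_open_cube[OF E(1)] 1(3) E(2) by auto
    have "\<Phi> (C, x) = pt (act_vertex g v) (chart E x)"
      using \<Phi>[OF g(1)] flow_half_open_cube[OF act_vertex_closed[OF g(1) v(1)] ch(1)] g(2) by simp
    then show ?thesis using E v cell g ch 1(3) by blast
  qed
  show "inj_on (\<lambda>((H, \<Phi>), p). \<Phi> p) ?S"
  proof (rule inj_onI)
    fix a a' assume a: "a \<in> ?S" and a': "a' \<in> ?S"
      and eq: "(\<lambda>((H, \<Phi>), p). \<Phi> p) a = (\<lambda>((H, \<Phi>), p). \<Phi> p) a'"
    obtain H \<Phi> C x H' \<Phi>' C' x' where [simp]: "a = ((H, \<Phi>), (C, x))" "a' = ((H', \<Phi>'), (C', x'))"
      by (metis surj_pair)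
    obtain E v g where 1: "E \<subseteq> {..<n}" "card E = m" "v \<in> vertices" "orbit_rep v = v"
      "g \<in> carrier G" "(H, \<Phi>) = cell E v" "C = g <#\<^bsub>G\<^esub> stab v"
      "x \<in> disc_points m - disc_boundary m" "\<Phi> (C, x) = pt (act_vertex g v) (chart E x)"
      "{i. chart E x i \<noteq> 0} = E"
      using descr[of H \<Phi> C x] a by auto
    obtain E' v' g' where 2: "E' \<subseteq> {..<n}" "card E' = m" "v' \<in> vertices" "orbit_rep v' = v'"
      "g' \<in> carrier G" "(H', \<Phi>') = cell E' v'" "C' = g' <#\<^bsub>G\<^esub> stab v'"
      "x' \<in> disc_points m - disc_boundary m" "\<Phi>' (C', x') = pt (act_vertex g' v') (chart E' x')"
      "{i. chart E' x' i \<noteq> 0} = E'"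
      using descr[of H' \<Phi>' C' x'] a' by auto
    have "pt (act_vertex g v) (chart E x) = pt (act_vertex g' v') (chart E' x')"
      using eq 1(9) 2(9) by simp
    then have vv: "act_vertex g v = act_vertex g' v'" and cc: "chart E x = chart E' x'"
      using pt_eq_iff act_vertex_closed 1(3,5) 2(3,5) by blast+
    have EE: "E = E'" using 1(10) 2(10) cc by simp
    have "finite E" using 1(1) finite_subset by blast
    then have xx: "x = x'"
      using inj_on_chart[of E] cc 1(2,8) 2(8) EE by (auto dest: inj_onD)
    have v: "v = v'"
      using orbit_rep_act[OF 1(3,5)] orbit_rep_act[OF 2(3,5)] vv 1(4) 2(4) by simp
    \<comment> \<open>Both elements carry \<open>v\<close> to the same vertex, so they differ by an
      element of its stabilizer and lie in the same coset.\<close>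
    have "act_vertex (inv\<^bsub>G\<^esub> g \<otimes>\<^bsub>G\<^esub> g') v = v"
      using vv v 1(3,5) 2(5) act_vertex_inv(1)[of g v] by (simp add: act_vertex_mult)
    then have "inv\<^bsub>G\<^esub> g \<otimes>\<^bsub>G\<^esub> g' \<in> stab v"
      using 1(5) 2(5) by (simp add: stab_def)
    moreover have "g' = g \<otimes>\<^bsub>G\<^esub> (inv\<^bsub>G\<^esub> g \<otimes>\<^bsub>G\<^esub> g')"
      using 1(5) 2(5) monoid.m_assoc[OF group.is_monoid[OF group], of g "inv\<^bsub>G\<^esub> g" g']
      by (simp add: group.r_inv[OF group] monoid.l_one[OF group.is_monoid[OF group]])
    ultimately have "g' \<in> g <#\<^bsub>G\<^esub> stab v"
      by (auto simp: l_coset_def)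
    then have "C = C'"
      using group.l_repr_independence[OF group _ 1(5) subgroup_stab[OF 1(3)]] 1(7) 2(7) v by simp
    then show "a = a'" using 1(6) 2(6) v EE xx by simp
  qed
  show "(\<lambda>((H, \<Phi>), p). \<Phi> p) ` ?S = skeleton m - below m"
  proof (intro equalityI subsetI)
    fix p assume "p \<in> (\<lambda>((H, \<Phi>), p). \<Phi> p) ` ?S"
    then obtain H \<Phi> C x where *: "((H, \<Phi>), (C, x)) \<in> ?S" "p = \<Phi> (C, x)" by auto
    obtain E v g where "card E = m" "v \<in> vertices" "g \<in> carrier G"
      "p = pt (act_vertex g v) (chart E x)" "chart E x \<in> half_open_cube" "{i. chart E x i \<noteq> 0} = E"
      using descr[OF *(1)] *(2) by auto
    then show "p \<in> skeleton m - below m"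
      using pt_in_points[OF act_vertex_closed] by (simp add: skeleton_def below_def)
  next
    fix p assume p: "p \<in> skeleton m - below m"
    then obtain v s where v: "v \<in> vertices" and s: "s \<in> half_open_cube" "p = pt v s"
      by (auto simp: skeleton_def points_def)
    let ?E = "{i. s i \<noteq> 0}"
    have card: "card ?E = m"
      using p s(2) by (auto simp: skeleton_def below_def)
    have E: "?E \<subseteq> {..<n}" using s(1) by (auto simp: half_open_cube_def not_less[symmetric])
    then have fin: "finite ?E" using finite_subset by blast
    obtain x where x: "x \<in> disc_points (card ?E)" "chart ?E x = s"
    proof (rule chart_surj[OF fin])
      show "0 \<le> s i \<and> s i \<le> 1" if "i \<in> ?E" for i
        using s(1) E that by (auto simp: half_open_cube_def intro: less_imp_le)
    qed auto
    have int: "x \<in> disc_points m - disc_boundary m"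
    proof -
      have "x \<notin> disc_boundary (card ?E)"
      proof
        assume "x \<in> disc_boundary (card ?E)"
        then obtain i where i: "i \<in> ?E" "chart ?E x i = 0 \<or> chart ?E x i = 1"
          using chart_boundary[OF fin] by blast
        then have "s i = 1" using x(2) by auto
        moreover have "i < n" using E i(1) by blast
        ultimately show False using s(1) by (auto simp: half_open_cube_def)
      qed
      then show ?thesis using x(1) card by simp
    qed
    obtain g where g: "g \<in> carrier G" "v = act_vertex g (orbit_rep v)"
      using in_orbit_of_rep[OF v] .
    let ?u = "orbit_rep v" and ?C = "g <#\<^bsub>G\<^esub> stab (orbit_rep v)"
    have "cell ?E ?u \<in> cells m" using E card v by (auto simp: cells_def)
    moreover have "?C \<in> lcosets\<^bsub>G\<^esub> (fst (cell ?E ?u))"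
      using lcosetsI[OF g(1)] by (simp add: cell_def)
    moreover have "snd (cell ?E ?u) (?C, x) = p"
      using cell_coset[OF orbit_rep_closed[OF v] g(1), of ?E x] flow_half_open_cube[OF v s(1)]
      by (simp add: x(2) s(2) flip: g(2))
    ultimately have "(cell ?E ?u, (?C, x)) \<in> ?S" and
      "p = (\<lambda>((H, \<Phi>), p). \<Phi> p) (cell ?E ?u, (?C, x))"
      using int by (auto simp: split_def)
    then show "p \<in> (\<lambda>((H, \<Phi>), p). \<Phi> p) ` ?S" by (rule rev_image_eqI)
  qed
qed

text \<open>The preimage of a subset of the \<open>m\<close>-skeleton under \<open>flow v\<close> is a locally finite union of
  pieces of \<open>m\<close>-dimensional faces of the unit cubes of the orthant.\<close>

lemma closedin_from_cells:
  assumes C: "C \<subseteq> skeleton m" and below: "closedin space (C \<inter> below m)"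
    and faces: "\<And>E v. E \<subseteq> {..<n} \<Longrightarrow> card E = m \<Longrightarrow> v \<in> vertices \<Longrightarrow>
      closed {x \<in> disc_points m. flow v (chart E x) \<in> C}"
  shows "closedin space C"
  unfolding closedin_space
proof (intro conjI ballI)
  show "C \<subseteq> points" using C skeleton_subset by blast
  fix v assume v: "v \<in> vertices"
  \<comment> \<open>\<open>K\<close> consists of the corners of the unit cubes of the orthant, and
    \<open>piece (k, E)\<close> is the part of the preimage in the face at \<open>k\<close> with
    directions \<open>E\<close>. \<open>Q0\<close> collects what is sent to the lower
    skeleton.\<close>
  define K where "K = {k :: nat \<Rightarrow> nat. \<forall>i\<ge>n. k i = 0}"
  define J where "J = K \<times> {E. E \<subseteq> {..<n} \<and> card E = m}"
  define piece where "piece = (\<lambda>(k, E). (\<lambda>x i. real (k i) + chart E x i) `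
    {x \<in> disc_points m. flow (up k v) (chart E x) \<in> C})"
  define Q0 where "Q0 = orthant \<inter> flow v -` (C \<inter> below m)"
  have flow_piece: "flow v (\<lambda>i. real (k i) + chart E x i) = flow (up k v) (chart E x)"
    if "E \<subseteq> {..<n}" "x \<in> disc_points (card E)" for k E x
    using flow_shift[of "chart E x" v k] chart_bounds(1)[OF that(2)] by (simp add: add.commute)
  have "orthant \<inter> flow v -` C = \<Union>(insert Q0 (piece ` J))"
  proof (intro equalityI subsetI)
    fix z assume z: "z \<in> orthant \<inter> flow v -` C"
    show "z \<in> \<Union>(insert Q0 (piece ` J))"
    proof (cases "flow v z \<in> below m")
      case False
      \<comment> \<open>The integer parts give the corner, and the nonintegral coordinates the
        directions, of the face that contains \<open>z\<close> in its interior.\<close>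
      let ?E = "{i. frac (z i) \<noteq> 0}" and ?k = "\<lambda>i. nat \<lfloor>z i\<rfloor>"
      have zi: "z i = real (?k i) + frac (z i)" for i
        using z by (cases "i < n") (auto simp: orthant_def frac_def)
      have E: "?E \<subseteq> {..<n}" using support_subset z by blast
      have card: "card ?E = m"
        using False z C by (auto simp: skeleton_def below_def coord_flow)
      obtain x where x: "x \<in> disc_points (card ?E)" "chart ?E x = (\<lambda>i. frac (z i))"
        by (rule chart_surj[of ?E "\<lambda>i. frac (z i)"])
          (use E finite_subset in \<open>auto simp: less_imp_le[OF frac_lt_1]\<close>)
      have z_eq: "z = (\<lambda>i. real (?k i) + chart ?E x i)"
        unfolding x(2) using zi by (rule ext)
      then have "flow (up ?k v) (chart ?E x) \<in> C"
        using flow_piece[OF E x(1), of ?k] z by simp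
      then have "z \<in> piece (?k, ?E)"
        using x(1) card z_eq by (auto simp: piece_def simp del: frac_eq_0_iff)
      moreover have "(?k, ?E) \<in> J"
        using E card z by (auto simp: J_def K_def orthant_def simp del: frac_eq_0_iff)
      ultimately show ?thesis by blast
    qed (use z in \<open>simp add: Q0_def\<close>)
  next
    fix z assume "z \<in> \<Union>(insert Q0 (piece ` J))"
    then consider "z \<in> Q0" | k E where "(k, E) \<in> J" "z \<in> piece (k, E)" by auto
    then show "z \<in> orthant \<inter> flow v -` C"
    proof cases
      case 2
      then obtain x where x: "x \<in> disc_points m" "flow (up k v) (chart E x) \<in> C"
        "z = (\<lambda>i. real (k i) + chart E x i)" by (auto simp: piece_def)
      have E: "E \<subseteq> {..<n}" "card E = m" and k: "k \<in> K" using 2(1) by (auto simp: J_def)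
      have "flow v z \<in> C" using flow_piece[OF E(1), of x k] x E(2) by simp
      moreover have "z \<in> orthant"
        using chart_in_orthant[OF E(1), of x] x E(2) k by (simp add: orthant_def K_def)
      ultimately show ?thesis by simp
    qed (simp add: Q0_def)
  qed
  moreover have "closedin euclidean (\<Union>(insert Q0 (piece ` J)))"
  proof (rule closedin_locally_finite_Union)
    fix S assume "S \<in> insert Q0 (piece ` J)"
    then consider "S = Q0" | k E where "(k, E) \<in> J" "S = piece (k, E)" by auto
    then have "closed S"
    proof cases
      case 1
      then show ?thesis using below v by (simp add: closedin_space Q0_def)
    next
      case 2
      then have E: "E \<subseteq> {..<n}" "card E = m" by (auto simp: J_def)
      let ?D = "{x \<in> disc_points m. flow (up k v) (chart E x) \<in> C}"
      have "compact (?D \<inter> disc_points m)"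
        using closed_Int_compact[OF faces[OF E up_closed[OF v]] compact_disc_points] .
      then have "compact ?D" by (simp add: Int_def conj_ac)
      moreover have "continuous_on ?D (\<lambda>x i. real (k i) + chart E x i)"
      proof (rule continuous_on_coordinatewise_then_product)
        fix i
        have "continuous_on ?D (chart E)"
          by (rule continuous_on_subset[OF continuous_on_chart]) (use E in auto)
        from continuous_on_product_then_coordinatewise[OF this, of i]
        show "continuous_on ?D (\<lambda>x. real (k i) + chart E x i)"
          by (rule continuous_on_add[OF continuous_on_const])
      qed
      ultimately have "compact S"
        unfolding 2 piece_def by (simp add: compact_continuous_image)
      then show ?thesis by (rule compact_imp_closed)
    qed
    then show "closedin euclidean S" by simp
  next
    show "locally_finite_in euclidean (insert Q0 (piece ` J))"
      unfolding locally_finite_in_def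
    proof (intro conjI ballI)
      fix y :: "nat \<Rightarrow> real"
      \<comment> \<open>Bounds from above suffice: a face lies above its corner, and only finitely
        many corners with natural coordinates respect the bounds.\<close>
      let ?V = "{z. \<forall>i\<in>{..<n}. z i \<in> {..<y i + 1}}"
      define N where "N = Max (insert 0 ((\<lambda>i. nat \<lceil>y i + 1\<rceil>) ` {..<n}))"
      let ?K = "{k :: nat \<Rightarrow> nat. \<forall>i. (i \<in> {..<n} \<longrightarrow> k i \<in> {..N}) \<and> (i \<notin> {..<n} \<longrightarrow> k i = 0)}"
      have "{S \<in> insert Q0 (piece ` J). S \<inter> ?V \<noteq> {}} \<subseteq>
          insert Q0 (piece ` (?K \<times> Pow {..<n}))"
      proof (rule subsetI, rule ccontr)
        fix S assume S: "S \<in> {S \<in> insert Q0 (piece ` J). S \<inter> ?V \<noteq> {}}"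
          and notin: "S \<notin> insert Q0 (piece ` (?K \<times> Pow {..<n}))"
        then obtain k E where kE: "(k, E) \<in> J" "S = piece (k, E)" by auto
        obtain z where z: "z \<in> piece (k, E)" "\<forall>i\<in>{..<n}. z i \<in> {..<y i + 1}"
          using S kE(2) by blast
        have "k i \<le> N" if i: "i < n" for i
        proof -
          have "card E = m" using kE(1) by (simp add: J_def)
          then have "real (k i) \<le> z i" using z(1) chart_bounds(1)[of _ E i] by (auto simp: piece_def)
          then have "real (k i) \<le> y i + 1" using z(2) i by force
          then have "k i \<le> nat \<lceil>y i + 1\<rceil>" by linarith
          also have "\<dots> \<le> N" unfolding N_def using i by (intro Max_ge) auto
          finally show ?thesis .
        qed
        then have "(k, E) \<in> ?K \<times> Pow {..<n}"
          using kE by (auto simp: J_def K_def)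
        then show False using notin kE(2) by blast
      qed
      moreover have "finite ?K" by (rule finite_set_of_finite_funs) auto
      ultimately have fin: "finite {S \<in> insert Q0 (piece ` J). S \<inter> ?V \<noteq> {}}"
        by (rule finite_subset[OF _ finite.insertI[OF finite_imageI[OF finite_cartesian_product]]])
          simp_all
      have "open ?V"
        by (rule product_topology_basis') auto
      then have "openin euclidean ?V" by (simp only: open_openin)
      moreover have "y \<in> ?V" by simp
      ultimately show "\<exists>V. openin euclidean V \<and> y \<in> V \<and>
          finite {S \<in> insert Q0 (piece ` J). S \<inter> V \<noteq> {}}"
        using fin by (intro exI[of _ ?V] conjI)
    qed simp
  qed
  ultimately show "closed (orthant \<inter> flow v -` C)" by simp
qed

text \<open>Openness is deduced from the cells by applying \<open>closedin_from_cells\<close> to the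
  complement: the lower skeleton is closed, and the condition on the equivariant cells covers all
  cubes because every vertex is a translate of its orbit representative.\<close>

lemma openin_skeleton_iff:
  assumes U: "U \<subseteq> skeleton m"
  shows "openin (subtopology space (skeleton m)) U \<longleftrightarrow>
     openin (subtopology space (below m)) (U \<inter> below m) \<and>
     (\<forall>(H, \<Phi>) \<in> cells m.
        openin (prod_topology (discrete_topology (lcosets\<^bsub>G\<^esub> H)) (closed_disc m))
          {p \<in> (lcosets\<^bsub>G\<^esub> H) \<times> topspace (closed_disc m). \<Phi> p \<in> U})" (is "?L \<longleftrightarrow> ?R1 \<and> ?R2")
proof
  assume L: ?L
  have "?R1"
    using L below_subset[of m] unfolding openin_subtopology by blast
  moreover have ?R2
    using openin_continuous_map_preimage[OF continuous_map_cell L] by fastforce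
  ultimately show "?R1 \<and> ?R2" ..
next
  assume R: "?R1 \<and> ?R2"
  let ?C = "skeleton m - U"
  have "closedin space ?C"
  proof (rule closedin_from_cells)
    have "closedin (subtopology space (below m)) (below m - U \<inter> below m)"
      using R closedin_diff[OF closedin_topspace] by (fastforce simp: below_def Int_absorb1)
    then have "closedin space (below m - U \<inter> below m)"
      using closedin_trans_full closedin_below by blast
    moreover have "below m - U \<inter> below m = ?C \<inter> below m" using below_subset by blast
    ultimately show "closedin space (?C \<inter> below m)" by simp
  next
    fix E v assume E: "E \<subseteq> {..<n}" "card E = m" and v: "v \<in> vertices"
    obtain g where g: "g \<in> carrier G" "v = act_vertex g (orbit_rep v)"
      using in_orbit_of_rep[OF v] .
    let ?H = "stab (orbit_rep v)" and ?\<Phi> = "snd (cell E (orbit_rep v))"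
    have "cell E (orbit_rep v) \<in> cells m" using E v by (auto simp: cells_def)
    moreover have "cell E (orbit_rep v) = (?H, ?\<Phi>)" by (simp add: cell_def)
    ultimately have "(?H, ?\<Phi>) \<in> cells m" by metis
    then have "openin (prod_topology (discrete_topology (lcosets\<^bsub>G\<^esub> ?H)) (closed_disc m))
        {p \<in> (lcosets\<^bsub>G\<^esub> ?H) \<times> disc_points m. ?\<Phi> p \<in> U}" using R by fastforce
    then have "openin (closed_disc m)
        {x. (g <#\<^bsub>G\<^esub> ?H, x) \<in> {p \<in> (lcosets\<^bsub>G\<^esub> ?H) \<times> disc_points m. ?\<Phi> p \<in> U}}"
      using lcosetsI[OF g(1)] unfolding openin_prod_discrete by blast
    also have "{x. (g <#\<^bsub>G\<^esub> ?H, x) \<in> {p \<in> (lcosets\<^bsub>G\<^esub> ?H) \<times> disc_points m. ?\<Phi> p \<in> U}} =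
        {x \<in> disc_points m. flow v (chart E x) \<in> U}"
      using lcosetsI[OF g(1)] cell_coset[OF orbit_rep_closed[OF v] g(1), of E] g(2) by auto
    finally have "closedin (closed_disc m)
        (disc_points m - {x \<in> disc_points m. flow v (chart E x) \<in> U})"
      using closedin_diff[OF closedin_topspace, of "closed_disc m"] by simp
    also have "disc_points m - {x \<in> disc_points m. flow v (chart E x) \<in> U} =
        {x \<in> disc_points m. flow v (chart E x) \<in> ?C}"
      using flow_chart_in_skeleton(1)[OF v E(1)] E(2) by auto
    finally show "closed {x \<in> disc_points m. flow v (chart E x) \<in> ?C}"
      unfolding closed_disc_eq
      using closedin_closed_eq[OF compact_imp_closed[OF compact_disc_points]] by blast
  qed simp
  then have "closedin (subtopology space (skeleton m)) ?C"
    by (rule closedin_subset_topspace) simp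
  then have "openin (subtopology space (skeleton m)) (skeleton m - ?C)"
    using openin_diff[OF openin_topspace, of "subtopology space (skeleton m)"] skeleton_subset
    by (simp add: Int_absorb1)
  then show ?L using U by (simp add: double_diff)
qed

lemma attach_cells: "attach_equivariant_cells G space move m (below m) (skeleton m)"
  unfolding attach_equivariant_cells_def
proof (intro conjI exI[of _ "cells m"])
  show "\<forall>(H, \<Phi>)\<in>cells m. subgroup H G \<and>
      continuous_map (prod_topology (discrete_topology (lcosets\<^bsub>G\<^esub> H)) (closed_disc m))
        (subtopology space (skeleton m)) \<Phi> \<and>
      (\<forall>g\<in>carrier G. \<forall>C\<in>lcosets\<^bsub>G\<^esub> H. \<forall>x\<in>topspace (closed_disc m).
        \<Phi> (g <#\<^bsub>G\<^esub> C, x) = move g (\<Phi> (C, x))) \<and>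
      \<Phi> ` ((lcosets\<^bsub>G\<^esub> H) \<times> disc_boundary m) \<subseteq> below m"
  proof clarify
    fix H \<Phi> assume cell: "(H, \<Phi>) \<in> cells m"
    then have "subgroup H G" using subgroup_stab by (auto elim: cellsE)
    then show "subgroup H G \<and>
      continuous_map (prod_topology (discrete_topology (lcosets\<^bsub>G\<^esub> H)) (closed_disc m))
        (subtopology space (skeleton m)) \<Phi> \<and>
      (\<forall>g\<in>carrier G. \<forall>C\<in>lcosets\<^bsub>G\<^esub> H. \<forall>x\<in>topspace (closed_disc m).
        \<Phi> (g <#\<^bsub>G\<^esub> C, x) = move g (\<Phi> (C, x))) \<and>
      \<Phi> ` ((lcosets\<^bsub>G\<^esub> H) \<times> disc_boundary m) \<subseteq> below m"
      using continuous_map_cell[OF cell] cell_equivariant[OF cell] cell_boundary[OF cell] by simp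
  qed
  show "bij_betw (\<lambda>((H, \<Phi>), p). \<Phi> p)
      (SIGMA (H, \<Phi>) : cells m. (lcosets\<^bsub>G\<^esub> H) \<times> (topspace (closed_disc m) - disc_boundary m))
      (skeleton m - below m)"
    using bij_betw_cells by simp
qed (use below_subset openin_skeleton_iff in auto)

lemma findim_contractible: "findim_contractible_G_complex G space move"
  unfolding findim_contractible_G_complex_def G_CW_complex_def
proof (intro conjI exI[of _ skeleton] exI[of _ n] allI ballI impI)
  show "attach_equivariant_cells G space move m (if m = 0 then {} else skeleton (m - 1)) (skeleton m)"
    for m using attach_cells[of m] by (simp add: below_eq)
  show "topspace space = (\<Union>m. skeleton m)"
    using skeleton_n skeleton_subset by auto
  fix U assume "U \<subseteq> topspace space"
  \<comment> \<open>The \<open>n\<close>-skeleton is everything, so the coherence condition at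
    \<open>n\<close> already is openness.\<close>
  then have "subtopology space (skeleton n) = space" "U \<inter> skeleton n = U"
    by (auto simp: skeleton_n subtopology_superset)
  then show "openin space U = (\<forall>m. openin (subtopology space (skeleton m)) (U \<inter> skeleton m))"
    using openin_subtopology_Int by metis
next
  show "topspace space \<noteq> {}"
    using pt_in_points[OF base_in, of "\<lambda>_. 0"] by (auto simp: half_open_cube_def)
qed (use group group_action_move continuous_map_move contractible_space_space in
    \<open>auto simp: skeleton_n\<close>)

theorem HF_Suc_tree_product:
  assumes "\<And>v. v \<in> vertices \<Longrightarrow> HF m (G\<lparr>carrier := stab v\<rparr>)"
  shows "HF (Suc m) G"
proof -
  have "HF m (G\<lparr>carrier := stabilizer G move p\<rparr>)" if "p \<in> points" for p
    using that assms by (auto simp: points_def stabilizer_move)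
  then show ?thesis
    using group findim_contractible unfolding HF.simps
    by (intro conjI exI[of _ space] exI[of _ move]) simp_all
qed

end

section \<open>Three actions on products of trees\<close>

text \<open>Additive functions with trivial common kernel embed the group in Z^n. A line becomes a
  directed tree by letting \<open>k + 1\<close> be the parent of \<open>k\<close>; translations
  commute with this, and one that fixes a vertex is 0.\<close>

lemma HF_1_lattice:
  fixes G :: "'g monoid" and f :: "nat \<Rightarrow> 'g \<Rightarrow> int"
  assumes group: "group G"
    and add: "\<And>i g h. i < n \<Longrightarrow> g \<in> carrier G \<Longrightarrow> h \<in> carrier G \<Longrightarrow> f i (g \<otimes>\<^bsub>G\<^esub> h) = f i g + f i h"
    and triv: "\<And>g. g \<in> carrier G \<Longrightarrow> (\<And>i. i < n \<Longrightarrow> f i g = 0) \<Longrightarrow> g = \<one>\<^bsub>G\<^esub>"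
  shows "HF 1 G"
proof -
  have par: "((\<lambda>k. k + 1) ^^ j) v = v + int j" for j and v :: int
    by (induction j) auto
  have one: "f i \<one>\<^bsub>G\<^esub> = 0" if "i < n" for i
    using add[OF that, of "\<one>\<^bsub>G\<^esub>" "\<one>\<^bsub>G\<^esub>"] group
    by (simp add: group.is_monoid monoid.one_closed monoid.l_one)
  interpret tree_product G n "\<lambda>_. UNIV :: int set" "\<lambda>_ k. k + 1" "\<lambda>i g k. f i g + k"
  proof (rule tree_product.intro)
    \<comment> \<open>\<open>nat\<close> turns a negative difference into 0, so only the lower
      vertex climbs.\<close>
    show "\<exists>k l. ((\<lambda>k. k + 1) ^^ k) u = ((\<lambda>k. k + 1) ^^ l) v" for u v :: int
      by (intro exI[of _ "nat (v - u)"] exI[of _ "nat (u - v)"]) (simp add: par)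
  qed (auto simp: group add one par)
  have "HF 0 (G\<lparr>carrier := stab v\<rparr>)" if v: "v \<in> vertices" for v
  proof -
    have "g = \<one>\<^bsub>G\<^esub>" if "g \<in> stab v" for g
    proof (rule triv)
      show "g \<in> carrier G" using that by (simp add: stab_def)
      have fixed: "act_vertex g v = v" using that by (simp add: stab_def)
      show "f i g = 0" if "i < n" for i
        using fun_cong[OF fixed, of i] that by (simp add: act_vertex_def)
    qed
    then have "stab v \<subseteq> {\<one>\<^bsub>G\<^esub>}" by blast
    then have "finite (stab v)" by (rule finite_subset) simp
    then show ?thesis
      using subgroup.subgroup_is_group[OF subgroup_stab[OF v] group] by simp
  qed
  then show ?thesis using HF_Suc_tree_product[of 0] by simp
qed

text \<open>The vertices are the left cosets of the \<open>\<Gamma> n\<close>; the parent of a coset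
  of \<open>\<Gamma> n\<close> is the coset of \<open>\<Gamma> (Suc n)\<close> around it. The set in
  the last assumption is the conjugate of \<open>\<Gamma> n\<close> by \<open>g\<close>, that is,
  the stabilizer of the coset of \<open>g\<close>.\<close>

lemma HF_Suc_directed_union:
  fixes G :: "'g monoid" and \<Gamma> :: "nat \<Rightarrow> 'g set"
  assumes group: "group G" and countable: "countable (carrier G)"
    and sub: "\<And>n. subgroup (\<Gamma> n) G" and mono: "\<And>n. \<Gamma> n \<subseteq> \<Gamma> (Suc n)"
    and union: "carrier G = (\<Union>n. \<Gamma> n)"
    and HF: "\<And>n g. g \<in> carrier G \<Longrightarrow>
      subgroup {x \<in> carrier G. inv\<^bsub>G\<^esub> g \<otimes>\<^bsub>G\<^esub> x \<otimes>\<^bsub>G\<^esub> g \<in> \<Gamma> n} G \<Longrightarrow>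
      HF m (G\<lparr>carrier := {x \<in> carrier G. inv\<^bsub>G\<^esub> g \<otimes>\<^bsub>G\<^esub> x \<otimes>\<^bsub>G\<^esub> g \<in> \<Gamma> n}\<rparr>)"
  shows "HF (Suc m) G"
proof -
  interpret G: group G by (rule group)
  \<comment> \<open>Recording the level makes \<open>acyclic\<close> immediate and separates levels
    at which the subgroups coincide.\<close>
  define V where "V = {(g <#\<^bsub>G\<^esub> \<Gamma> n, n) | g n. g \<in> carrier G}"
  \<comment> \<open>The union over all representatives avoids a choice; its members are all
    equal.\<close>
  define par where "par = (\<lambda>(C, n). (\<Union>x\<in>C. x <#\<^bsub>G\<^esub> \<Gamma> (Suc n), Suc n))"
  define act where "act = (\<lambda>g (C, n :: nat). (g <#\<^bsub>G\<^esub> C, n))"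
  have coset_eq: "g <#\<^bsub>G\<^esub> \<Gamma> n = h <#\<^bsub>G\<^esub> \<Gamma> n \<longleftrightarrow> inv\<^bsub>G\<^esub> g \<otimes>\<^bsub>G\<^esub> h \<in> \<Gamma> n"
    if "g \<in> carrier G" "h \<in> carrier G" for g h n
  proof
    assume "g <#\<^bsub>G\<^esub> \<Gamma> n = h <#\<^bsub>G\<^esub> \<Gamma> n"
    then have "h \<in> g <#\<^bsub>G\<^esub> \<Gamma> n" using G.lcos_self[OF that(2) sub] by simp
    then obtain x where "x \<in> \<Gamma> n" "h = g \<otimes>\<^bsub>G\<^esub> x" by (auto simp: l_coset_def)
    then show "inv\<^bsub>G\<^esub> g \<otimes>\<^bsub>G\<^esub> h \<in> \<Gamma> n"
      using that(1) subgroup.mem_carrier[OF sub, of x n] G.m_assoc[of "inv\<^bsub>G\<^esub> g" g x] by simp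
  next
    assume *: "inv\<^bsub>G\<^esub> g \<otimes>\<^bsub>G\<^esub> h \<in> \<Gamma> n"
    have "h = g \<otimes>\<^bsub>G\<^esub> (inv\<^bsub>G\<^esub> g \<otimes>\<^bsub>G\<^esub> h)"
      using that G.m_assoc[of g "inv\<^bsub>G\<^esub> g" h] by simp
    then have "h \<in> g <#\<^bsub>G\<^esub> \<Gamma> n" using * by (auto simp: l_coset_def)
    then show "g <#\<^bsub>G\<^esub> \<Gamma> n = h <#\<^bsub>G\<^esub> \<Gamma> n"
      by (rule G.l_repr_independence[OF _ that(1) sub])
  qed
  have par_coset: "par (g <#\<^bsub>G\<^esub> \<Gamma> n, n) = (g <#\<^bsub>G\<^esub> \<Gamma> (Suc n), Suc n)" if g: "g \<in> carrier G" for g n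
  proof -
    have "x <#\<^bsub>G\<^esub> \<Gamma> (Suc n) = g <#\<^bsub>G\<^esub> \<Gamma> (Suc n)" if x: "x \<in> g <#\<^bsub>G\<^esub> \<Gamma> n" for x
    proof -
      have "x \<in> g <#\<^bsub>G\<^esub> \<Gamma> (Suc n)" using x mono[of n] by (auto simp: l_coset_def)
      then show ?thesis by (rule G.l_repr_independence[OF _ g sub, symmetric])
    qed
    moreover have "g <#\<^bsub>G\<^esub> \<Gamma> n \<noteq> {}" using G.lcos_self[OF g sub] by blast
    ultimately have "(\<Union>x\<in>g <#\<^bsub>G\<^esub> \<Gamma> n. x <#\<^bsub>G\<^esub> \<Gamma> (Suc n)) = g <#\<^bsub>G\<^esub> \<Gamma> (Suc n)"
      by (intro SUP_eq_const)
    then show ?thesis by (simp only: par_def case_prod_conv)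
  qed
  have par_funpow: "(par ^^ j) (g <#\<^bsub>G\<^esub> \<Gamma> n, n) = (g <#\<^bsub>G\<^esub> \<Gamma> (n + j), n + j)"
    if "g \<in> carrier G" for g n j
    using that by (induction j) (simp_all add: par_coset)
  have act_coset: "act g (h <#\<^bsub>G\<^esub> \<Gamma> n, n) = ((g \<otimes>\<^bsub>G\<^esub> h) <#\<^bsub>G\<^esub> \<Gamma> n, n)"
    if "g \<in> carrier G" "h \<in> carrier G" for g h n
    using G.lcos_m_assoc[OF subgroup.subset[OF sub] that] by (simp add: act_def)
  have mono_le: "\<Gamma> n \<subseteq> \<Gamma> k" if "n \<le> k" for n k
    using that by (rule lift_Suc_mono_le[of \<Gamma>, OF mono])
  interpret tree_product G "Suc 0" "\<lambda>_. V" "\<lambda>_. par" "\<lambda>_. act"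
  proof (rule tree_product.intro)
    have "V = (\<lambda>(g, n). (g <#\<^bsub>G\<^esub> \<Gamma> n, n)) ` (carrier G \<times> UNIV)" by (auto simp: V_def)
    then show "Countable_Set.countable V" using countable by simp
    show "V \<noteq> {}" by (auto simp: V_def)
    show "\<exists>k l. (par ^^ k) u = (par ^^ l) v" if uv: "u \<in> V" "v \<in> V" for u v
    proof -
      obtain g j h k where gh: "g \<in> carrier G" "h \<in> carrier G"
        and [simp]: "u = (g <#\<^bsub>G\<^esub> \<Gamma> j, j)" "v = (h <#\<^bsub>G\<^esub> \<Gamma> k, k)"
        using uv by (auto simp: V_def)
      obtain l where l: "inv\<^bsub>G\<^esub> g \<otimes>\<^bsub>G\<^esub> h \<in> \<Gamma> l"
        using gh union by (metis G.inv_closed G.m_closed UN_E)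
      \<comment> \<open>A level above \<open>j\<close> and \<open>k\<close> at which the subgroup
        contains the quotient of the two representatives; \<open>u\<close> and \<open>v\<close>
        reach it after \<open>k + l\<close> and \<open>j + l\<close> steps.\<close>
      let ?N = "j + k + l"
      have "inv\<^bsub>G\<^esub> g \<otimes>\<^bsub>G\<^esub> h \<in> \<Gamma> ?N" using l mono_le[of l ?N] by auto
      then have "g <#\<^bsub>G\<^esub> \<Gamma> ?N = h <#\<^bsub>G\<^esub> \<Gamma> ?N" using coset_eq gh by blast
      then have "(par ^^ (k + l)) u = (par ^^ (j + l)) v"
        using gh by (simp add: par_funpow ac_simps)
      then show ?thesis by blast
    qed
    show "k = 0" if "v \<in> V" "(par ^^ k) v = v" for v k
      using that by (auto simp: V_def par_funpow)
  qed (auto simp: group V_def par_coset act_coset G.m_assoc)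
  have "HF m (G\<lparr>carrier := stab v\<rparr>)" if v: "v \<in> vertices" for v
  proof -
    obtain g n where g: "g \<in> carrier G" "v 0 = (g <#\<^bsub>G\<^esub> \<Gamma> n, n)"
      using verticesD[OF v, of 0] by (auto simp: V_def)
    have "act_vertex x v = v \<longleftrightarrow> inv\<^bsub>G\<^esub> g \<otimes>\<^bsub>G\<^esub> x \<otimes>\<^bsub>G\<^esub> g \<in> \<Gamma> n" if x: "x \<in> carrier G" for x
    proof -
      have "act_vertex x v = v \<longleftrightarrow> act x (v 0) = v 0"
        using act_vertex_closed[OF x v] v
        by (auto simp: act_vertex_def fun_eq_iff vertices_def PiE_iff extensional_def)
      also have "\<dots> \<longleftrightarrow> g <#\<^bsub>G\<^esub> \<Gamma> n = (x \<otimes>\<^bsub>G\<^esub> g) <#\<^bsub>G\<^esub> \<Gamma> n"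
        using x g by (auto simp: act_coset)
      also have "\<dots> \<longleftrightarrow> inv\<^bsub>G\<^esub> g \<otimes>\<^bsub>G\<^esub> x \<otimes>\<^bsub>G\<^esub> g \<in> \<Gamma> n"
        using coset_eq[OF g(1), of "x \<otimes>\<^bsub>G\<^esub> g"] x g(1) by (simp add: G.m_assoc)
      finally show ?thesis .
    qed
    then have "stab v = {x \<in> carrier G. inv\<^bsub>G\<^esub> g \<otimes>\<^bsub>G\<^esub> x \<otimes>\<^bsub>G\<^esub> g \<in> \<Gamma> n}"
      by (auto simp: stab_def)
    then show ?thesis using HF[OF g(1), of n] subgroup_stab[OF v] by simp
  qed
  then show ?thesis by (rule HF_Suc_tree_product)
qed

text \<open>The entries of an affine matrix as functions on an abstract group, so that the same
  statements apply to the subgroups that occur as stabilizers.\<close>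

locale affine_coordinates =
  fixes G :: "'g monoid" and K :: "real set" and a b :: "'g \<Rightarrow> real"
  assumes group: "group G"
    and a_in: "g \<in> carrier G \<Longrightarrow> a g \<in> K" and b_in: "g \<in> carrier G \<Longrightarrow> b g \<in> K"
    and a_pos: "g \<in> carrier G \<Longrightarrow> 0 < a g"
    and a_mult: "g \<in> carrier G \<Longrightarrow> h \<in> carrier G \<Longrightarrow> a (g \<otimes>\<^bsub>G\<^esub> h) = a g * a h"
    and b_mult: "g \<in> carrier G \<Longrightarrow> h \<in> carrier G \<Longrightarrow> b (g \<otimes>\<^bsub>G\<^esub> h) = a g * b h + b g"
    and coords_eq: "g \<in> carrier G \<Longrightarrow> a g = 1 \<Longrightarrow> b g = 0 \<Longrightarrow> g = \<one>\<^bsub>G\<^esub>"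
begin

lemma coords_one: "a \<one>\<^bsub>G\<^esub> = 1" "b \<one>\<^bsub>G\<^esub> = 0"
proof -
  interpret G: group G by (rule group)
  show *: "a \<one>\<^bsub>G\<^esub> = 1"
    using a_mult[of "\<one>\<^bsub>G\<^esub>" "\<one>\<^bsub>G\<^esub>"] a_pos[of "\<one>\<^bsub>G\<^esub>"] by simp
  show "b \<one>\<^bsub>G\<^esub> = 0"
    using b_mult[of "\<one>\<^bsub>G\<^esub>" "\<one>\<^bsub>G\<^esub>"] * by simp
qed

lemma coords_inv:
  assumes "g \<in> carrier G"
  shows "a (inv\<^bsub>G\<^esub> g) = 1 / a g" "b (inv\<^bsub>G\<^esub> g) = - b g / a g"
proof -
  interpret G: group G by (rule group)
  have inv: "inv\<^bsub>G\<^esub> g \<in> carrier G" "g \<otimes>\<^bsub>G\<^esub> inv\<^bsub>G\<^esub> g = \<one>\<^bsub>G\<^esub>"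
    using assms by auto
  have "a g * a (inv\<^bsub>G\<^esub> g) = 1" "a g * b (inv\<^bsub>G\<^esub> g) + b g = 0"
    using a_mult[OF assms inv(1)] b_mult[OF assms inv(1)] inv(2) coords_one by simp_all
  then show "a (inv\<^bsub>G\<^esub> g) = 1 / a g" "b (inv\<^bsub>G\<^esub> g) = - b g / a g"
    using a_pos[OF assms] by (simp_all add: field_simps add_eq_0_iff)
qed

lemma restrict_subgroup:
  assumes "subgroup H G" shows "affine_coordinates (G\<lparr>carrier := H\<rparr>) K a b"
proof (rule affine_coordinates.intro)
  show "group (G\<lparr>carrier := H\<rparr>)" using subgroup.subgroup_is_group[OF assms group] .
qed (use subgroup.mem_carrier[OF assms] a_in b_in a_pos a_mult b_mult coords_eq in auto)

end

text \<open>The integer \<open>w 0\<close> is arbitrary, so both laws exclude 0;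
  \<open>val_ge\<close> restores the convention that 0 has infinite valuation.\<close>

locale valued_field =
  fixes K :: "real set" and w :: "real \<Rightarrow> int"
  assumes one_in: "1 \<in> K"
    and minus_in: "x \<in> K \<Longrightarrow> - x \<in> K"
    and inverse_in: "x \<in> K \<Longrightarrow> inverse x \<in> K"
    and add_in: "x \<in> K \<Longrightarrow> y \<in> K \<Longrightarrow> x + y \<in> K"
    and mult_in: "x \<in> K \<Longrightarrow> y \<in> K \<Longrightarrow> x * y \<in> K"
    and val_mult: "x \<in> K \<Longrightarrow> y \<in> K \<Longrightarrow> x \<noteq> 0 \<Longrightarrow> y \<noteq> 0 \<Longrightarrow> w (x * y) = w x + w y"
    and val_add: "x \<in> K \<Longrightarrow> y \<in> K \<Longrightarrow> x \<noteq> 0 \<Longrightarrow> y \<noteq> 0 \<Longrightarrow> x + y \<noteq> 0 \<Longrightarrow>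
      min (w x) (w y) \<le> w (x + y)"
begin

definition val_ge :: "int \<Rightarrow> real \<Rightarrow> bool" where
  "val_ge k x \<longleftrightarrow> x = 0 \<or> k \<le> w x"

definition ball :: "real \<Rightarrow> int \<Rightarrow> real set" where
  "ball c k = {x \<in> K. val_ge k (x - c)}"

lemma diff_in: "x \<in> K \<Longrightarrow> y \<in> K \<Longrightarrow> x - y \<in> K"
  using add_in[of x "- y"] minus_in by simp

lemma divide_in: "x \<in> K \<Longrightarrow> y \<in> K \<Longrightarrow> x / y \<in> K"
  using mult_in[of x "inverse y"] inverse_in by (simp add: divide_inverse)

lemma val_one: "w 1 = 0"
  using val_mult[of 1 1] one_in by simp

lemma val_minus: "x \<in> K \<Longrightarrow> w (- x) = w x"
proof -
  assume x: "x \<in> K"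
  have "- 1 \<in> K" using one_in minus_in by blast
  then have "w (- 1) = 0" using val_mult[of "- 1" "- 1"] val_one by simp
  then show ?thesis using val_mult[of "- 1" x] \<open>- 1 \<in> K\<close> x by (cases "x = 0") simp_all
qed

lemma val_ge_mono: "val_ge k x \<Longrightarrow> j \<le> k \<Longrightarrow> val_ge j x"
  by (auto simp: val_ge_def)

lemma val_ge_minus: "x \<in> K \<Longrightarrow> val_ge k x \<Longrightarrow> val_ge k (- x)"
  by (auto simp: val_ge_def val_minus)

lemma val_ge_add: "x \<in> K \<Longrightarrow> y \<in> K \<Longrightarrow> val_ge k x \<Longrightarrow> val_ge k y \<Longrightarrow> val_ge k (x + y)"
  using val_add[of x y] by (fastforce simp: val_ge_def)

lemma val_ge_scale:
  "\<alpha> \<in> K \<Longrightarrow> \<alpha> \<noteq> 0 \<Longrightarrow> x \<in> K \<Longrightarrow> val_ge (k + w \<alpha>) (\<alpha> * x) \<longleftrightarrow> val_ge k x"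
  by (auto simp: val_ge_def val_mult)

lemma center_in_ball: "c \<in> K \<Longrightarrow> c \<in> ball c k"
  by (simp add: ball_def val_ge_def)

text \<open>By the ultrametric inequality every point of a ball is a centre of it.\<close>

lemma ball_eq_iff:
  assumes "c \<in> K" "c' \<in> K"
  shows "ball c k = ball c' k \<longleftrightarrow> val_ge k (c - c')"
proof
  assume "ball c k = ball c' k"
  then have "c \<in> ball c' k" using center_in_ball[OF assms(1)] by blast
  then show "val_ge k (c - c')" by (simp add: ball_def)
next
  have sub: "ball c k \<subseteq> ball c' k" if "val_ge k (c - c')" "c \<in> K" "c' \<in> K" for c c'
  proof
    fix x assume "x \<in> ball c k"
    then have "x \<in> K" "val_ge k (x - c)" by (auto simp: ball_def)
    then show "x \<in> ball c' k"
      using val_ge_add[of "x - c" "c - c'" k] that by (simp add: ball_def diff_in)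
  qed
  assume *: "val_ge k (c - c')"
  then have "val_ge k (c' - c)" using val_ge_minus[of "c - c'"] assms diff_in by fastforce
  then show "ball c k = ball c' k" using sub * assms by blast
qed

lemma affine_image_ball:
  assumes "\<alpha> \<in> K" "\<alpha> \<noteq> 0" "\<beta> \<in> K" "c \<in> K"
  shows "(\<lambda>x. \<alpha> * x + \<beta>) ` ball c k = ball (\<alpha> * c + \<beta>) (k + w \<alpha>)"
proof (intro equalityI subsetI)
  fix y assume "y \<in> (\<lambda>x. \<alpha> * x + \<beta>) ` ball c k"
  then obtain x where x: "x \<in> K" "val_ge k (x - c)" "y = \<alpha> * x + \<beta>" by (auto simp: ball_def)
  have "y - (\<alpha> * c + \<beta>) = \<alpha> * (x - c)" using x(3) by (simp add: algebra_simps)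
  then show "y \<in> ball (\<alpha> * c + \<beta>) (k + w \<alpha>)"
    using x assms by (simp add: ball_def val_ge_scale diff_in add_in mult_in)
next
  fix y assume y: "y \<in> ball (\<alpha> * c + \<beta>) (k + w \<alpha>)"
  let ?x = "(y - \<beta>) / \<alpha>"
  have x: "?x \<in> K" using y assms by (simp add: ball_def divide_in diff_in)
  have "\<alpha> * (?x - c) = y - (\<alpha> * c + \<beta>)" using assms(2) by (simp add: field_simps)
  then have "val_ge k (?x - c)"
    using y val_ge_scale[OF assms(1,2) diff_in[OF x assms(4)], of k] by (simp add: ball_def)
  then show "y \<in> (\<lambda>x. \<alpha> * x + \<beta>) ` ball c k"
    using x assms(2) by (intro image_eqI[of _ _ ?x]) (auto simp: ball_def)
qed

text \<open>For surjective \<open>w\<close> these are the vertices of the Bruhat-Tits tree, with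
  parents in the direction of the end at infinity. Large \<open>k\<close> means a small ball, so a
  parent has \<open>k - 1\<close>. Keeping \<open>k\<close> makes the parent a different vertex even
  if the two sets agree.\<close>

definition balls :: "(real set \<times> int) set" where
  "balls = {(ball c k, k) | c k. c \<in> K}"

definition enlarge :: "real set \<times> int \<Rightarrow> real set \<times> int" where
  "enlarge = (\<lambda>(B, k). (\<Union>c\<in>B. ball c (k - 1), k - 1))"

lemma enlarge_ball: "c \<in> K \<Longrightarrow> enlarge (ball c k, k) = (ball c (k - 1), k - 1)"
proof -
  assume c: "c \<in> K"
  have "ball c' (k - 1) = ball c (k - 1)" if "c' \<in> ball c k" for c'
    using that c val_ge_mono[of k _ "k - 1"] by (subst ball_eq_iff) (auto simp: ball_def)
  moreover have "ball c k \<noteq> {}" using center_in_ball[OF c] by blast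
  ultimately have "(\<Union>c'\<in>ball c k. ball c' (k - 1)) = ball c (k - 1)"
    by (intro SUP_eq_const)
  then show ?thesis by (simp only: enlarge_def case_prod_conv)
qed

lemma enlarge_funpow: "c \<in> K \<Longrightarrow> (enlarge ^^ j) (ball c k, k) = (ball c (k - int j), k - int j)"
  by (induction j) (simp_all add: enlarge_ball algebra_simps)

definition affine_act :: "real \<Rightarrow> real \<Rightarrow> real set \<times> int \<Rightarrow> real set \<times> int" where
  "affine_act \<alpha> \<beta> = (\<lambda>(B, k). ((\<lambda>x. \<alpha> * x + \<beta>) ` B, k + w \<alpha>))"

lemma affine_act_ball:
  "\<alpha> \<in> K \<Longrightarrow> \<alpha> \<noteq> 0 \<Longrightarrow> \<beta> \<in> K \<Longrightarrow> c \<in> K \<Longrightarrow>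
    affine_act \<alpha> \<beta> (ball c k, k) = (ball (\<alpha> * c + \<beta>) (k + w \<alpha>), k + w \<alpha>)"
  by (simp add: affine_act_def affine_image_ball)

lemma countable_balls: "countable K \<Longrightarrow> countable balls"
proof -
  assume "countable K"
  moreover have "balls = (\<lambda>(c, k). (ball c k, k)) ` (K \<times> UNIV)" by (auto simp: balls_def)
  ultimately show ?thesis by simp
qed

lemma balls_merge:
  assumes "u \<in> balls" "v \<in> balls"
  shows "\<exists>j l. (enlarge ^^ j) u = (enlarge ^^ l) v"
proof -
  obtain c k c' k' where c: "c \<in> K" "c' \<in> K" and uv: "u = (ball c k, k)" "v = (ball c' k', k')"
    using assms by (auto simp: balls_def)
  \<comment> \<open>Small enough for one ball of level \<open>m\<close> to contain both centres. For
    \<open>c = c'\<close> the value \<open>w 0\<close> enters, which can only lower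
    \<open>m\<close>.\<close>
  define m where "m = min (min k k') (w (c - c'))"
  have m: "m \<le> k" "m \<le> k'" "m \<le> w (c - c')" by (auto simp: m_def)
  then have "ball c m = ball c' m" using c by (simp add: ball_eq_iff val_ge_def)
  then have "(enlarge ^^ nat (k - m)) u = (enlarge ^^ nat (k' - m)) v"
    using m by (simp add: uv enlarge_funpow c)
  then show ?thesis by blast
qed

end

text \<open>What a vertex stabilizer inherits: preserving the level of a ball forces
  \<open>a\<close> to have valuation 0, and a translation that preserves a ball of level
  \<open>k\<close> has \<open>b\<close> of valuation at least \<open>k\<close>. Only these two facts
  are passed on to the next step.\<close>

lemma HF_Suc_valuations:
  fixes G :: "'g monoid" and w :: "nat \<Rightarrow> real \<Rightarrow> int" and n :: nat
  assumes G: "affine_coordinates G K a b" and K: "countable K"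
    and w: "\<And>i. i < n \<Longrightarrow> valued_field K (w i)"
    and HF: "\<And>H. subgroup H G \<Longrightarrow> (\<And>g i. g \<in> H \<Longrightarrow> i < n \<Longrightarrow> w i (a g) = 0) \<Longrightarrow>
      (\<And>i. i < n \<Longrightarrow> \<exists>k. \<forall>g\<in>H. a g = 1 \<longrightarrow> b g \<noteq> 0 \<longrightarrow> k \<le> w i (b g)) \<Longrightarrow>
      HF m (G\<lparr>carrier := H\<rparr>)"
  shows "HF (Suc m) G"
proof -
  interpret affine_coordinates G K a b by (rule G)
  interpret G: group G by (rule group)
  have nz: "a g \<noteq> 0" if "g \<in> carrier G" for g using a_pos[OF that] by simp
  interpret tree_product G n "\<lambda>i. valued_field.balls K (w i)" "\<lambda>i. valued_field.enlarge K (w i)"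
    "\<lambda>i g. valued_field.affine_act (w i) (a g) (b g)"
  proof (rule tree_product.intro)
    fix i assume i: "i < n"
    interpret valued_field K "w i" by (rule w[OF i])
    show "Countable_Set.countable balls" by (rule countable_balls[OF K])
    show "balls \<noteq> {}" using one_in by (auto simp: balls_def)
    show "enlarge v \<in> balls" if "v \<in> balls" for v
      using that by (auto simp: balls_def enlarge_ball)
    show "k = 0" if "v \<in> balls" "(enlarge ^^ k) v = v" for v k
    proof -
      obtain c j where "c \<in> K" "v = (ball c j, j)" using \<open>v \<in> balls\<close> by (auto simp: balls_def)
      then show ?thesis using enlarge_funpow[of c k j] that(2) by simp
    qed
    show "\<exists>k l. (enlarge ^^ k) u = (enlarge ^^ l) v" if "u \<in> balls" "v \<in> balls" for u v
      using that by (rule balls_merge)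
    show "affine_act (a g) (b g) v \<in> balls" if "g \<in> carrier G" "v \<in> balls" for g v
    proof -
      obtain c j where "c \<in> K" "v = (ball c j, j)" using \<open>v \<in> balls\<close> by (auto simp: balls_def)
      then have "affine_act (a g) (b g) v = (ball (a g * c + b g) (j + w i (a g)), j + w i (a g))"
        and "a g * c + b g \<in> K"
        using that(1) by (simp_all add: affine_act_ball a_in b_in nz add_in mult_in)
      then show ?thesis unfolding balls_def by blast
    qed
    show "affine_act (a \<one>\<^bsub>G\<^esub>) (b \<one>\<^bsub>G\<^esub>) v = v" if "v \<in> balls" for v
      by (auto simp: affine_act_def coords_one val_one split: prod.split)
    show "affine_act (a (g \<otimes>\<^bsub>G\<^esub> h)) (b (g \<otimes>\<^bsub>G\<^esub> h)) v =
        affine_act (a g) (b g) (affine_act (a h) (b h) v)"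
      if "g \<in> carrier G" "h \<in> carrier G" "v \<in> balls" for g h v
      using that by (auto simp: affine_act_def a_mult b_mult val_mult a_in nz image_image
          algebra_simps split: prod.split)
    show "affine_act (a g) (b g) (enlarge v) = enlarge (affine_act (a g) (b g) v)"
      if "g \<in> carrier G" "v \<in> balls" for g v
    proof -
      obtain c j where "c \<in> K" "v = (ball c j, j)" using \<open>v \<in> balls\<close> by (auto simp: balls_def)
      then show ?thesis
        using that(1)
        by (simp add: affine_act_ball enlarge_ball a_in b_in nz add_in mult_in) (simp add: algebra_simps)
    qed
  qed (rule group)
  have "HF m (G\<lparr>carrier := stab v\<rparr>)" if v: "v \<in> vertices" for v
  proof (rule HF[OF subgroup_stab[OF v]])
    fix i assume i: "i < n"
    interpret valued_field K "w i" by (rule w[OF i])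
    obtain c k where c: "c \<in> K" "v i = (ball c k, k)"
      using verticesD[OF v i] by (auto simp: balls_def)
    have fixed: "w i (a g) = 0" "ball (a g * c + b g) k = ball c k" "g \<in> carrier G"
      if "g \<in> stab v" for g
    proof -
      show g: "g \<in> carrier G" using that by (simp add: stab_def)
      have "act_vertex g v i = v i" using that by (simp add: stab_def)
      then have "affine_act (a g) (b g) (ball c k, k) = (ball c k, k)"
        using i c(2) by (simp add: act_vertex_def)
      then show "w i (a g) = 0" "ball (a g * c + b g) k = ball c k"
        using affine_act_ball[OF a_in[OF g] nz[OF g] b_in[OF g] c(1)] by auto
    qed
    show "w i (a g) = 0" if "g \<in> stab v" for g using fixed(1)[OF that] .
    have "k \<le> w i (b g)" if "g \<in> stab v" "a g = 1" "b g \<noteq> 0" for g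
      using fixed(2,3)[OF that(1)] that ball_eq_iff[of "c + b g" c k] c(1)
      by (simp add: add_in b_in val_ge_def)
    then show "\<exists>k. \<forall>g\<in>stab v. a g = 1 \<longrightarrow> b g \<noteq> 0 \<longrightarrow> k \<le> w i (b g)" by blast
  qed
  then show ?thesis by (rule HF_Suc_tree_product)
qed

section \<open>Valuations of the field of rational functions\<close>

lemma countable_int_poly: "countable (UNIV :: int poly set)"
proof -
  have "p \<in> range (Poly :: int list \<Rightarrow> int poly)" for p
    by (rule range_eqI[of _ _ "coeffs p"]) simp
  then show ?thesis
    using countable_image[of "UNIV :: int list set" Poly] by (metis UNIV_eq_I countableI_type)
qed

definition eval_at :: "real \<Rightarrow> int poly \<Rightarrow> real" where
  "eval_at t p = poly (map_poly of_int p) t"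

lemma eval_at_0 [simp]: "eval_at t 0 = 0"
  by (simp add: eval_at_def)

lemma eval_at_pCons [simp]: "eval_at t (pCons c p) = of_int c + t * eval_at t p"
  by (simp add: eval_at_def map_poly_pCons)

lemma eval_at_1 [simp]: "eval_at t 1 = 1"
  by (simp add: one_pCons)

lemma eval_at_add: "eval_at t (p + q) = eval_at t p + eval_at t q"
proof (induction p arbitrary: q)
  case (pCons c p)
  then show ?case by (cases q) (simp add: algebra_simps)
qed simp

lemma eval_at_smult: "eval_at t (Polynomial.smult c p) = of_int c * eval_at t p"
  by (induction p) (simp_all add: algebra_simps)

lemma eval_at_mult: "eval_at t (p * q) = eval_at t p * eval_at t q"
  by (induction p) (simp_all add: eval_at_add eval_at_smult algebra_simps)

lemma eval_at_uminus: "eval_at t (- p) = - eval_at t p"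
  using eval_at_add[of t p "- p"] by simp

text \<open>Covers multiplicities of primes and minus the degree alike; \<open>val\<close> extends
  such a function to fractions.\<close>

definition discrete_valuation :: "(int poly \<Rightarrow> int) \<Rightarrow> bool" where
  "discrete_valuation \<mu> \<longleftrightarrow> (\<forall>p q. p \<noteq> 0 \<longrightarrow> q \<noteq> 0 \<longrightarrow> \<mu> (p * q) = \<mu> p + \<mu> q \<and>
     (p + q \<noteq> 0 \<longrightarrow> min (\<mu> p) (\<mu> q) \<le> \<mu> (p + q)))"

lemma discrete_valuation_multiplicity:
  assumes "Factorial_Ring.prime q" shows "discrete_valuation (\<lambda>p. int (multiplicity q p))"
  unfolding discrete_valuation_def
proof (intro allI impI conjI)
  fix p r :: "int poly" assume pr: "p \<noteq> 0" "r \<noteq> 0"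
  show "int (multiplicity q (p * r)) = int (multiplicity q p) + int (multiplicity q r)"
    using assms pr by (simp add: prime_elem_multiplicity_mult_distrib)
  assume sum: "p + r \<noteq> 0"
  let ?k = "min (multiplicity q p) (multiplicity q r)"
  have "q ^ ?k dvd p + r"
    by (intro dvd_add multiplicity_dvd') simp_all
  then have "?k \<le> multiplicity q (p + r)"
    using assms sum by (intro multiplicity_geI) auto
  then show "min (int (multiplicity q p)) (int (multiplicity q r)) \<le> int (multiplicity q (p + r))"
    by linarith
qed

lemma discrete_valuation_degree: "discrete_valuation (\<lambda>p. - int (Polynomial.degree p))"
  unfolding discrete_valuation_def
proof (intro allI impI conjI)
  fix p q :: "int poly" assume "p \<noteq> 0" "q \<noteq> 0"
  then show "- int (Polynomial.degree (p * q)) = - int (Polynomial.degree p) + - int (Polynomial.degree q)"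
    by (simp add: degree_mult_eq)
  show "min (- int (Polynomial.degree p)) (- int (Polynomial.degree q)) \<le> - int (Polynomial.degree (p + q))"
    using degree_add_le_max[of p q] by linarith
qed

lemma ring_of_type_real:
  "x \<oplus>\<^bsub>ring_of_type_algebra\<^esub> y = x + (y :: real)"
  "x \<otimes>\<^bsub>ring_of_type_algebra\<^esub> y = x * (y :: real)"
  "\<zero>\<^bsub>ring_of_type_algebra\<^esub> = (0 :: real)"
  "\<one>\<^bsub>ring_of_type_algebra\<^esub> = (1 :: real)"
  "\<ominus>\<^bsub>ring_of_type_algebra\<^esub> x = - x"
  "x \<noteq> 0 \<Longrightarrow> inv\<^bsub>ring_of_type_algebra\<^esub> x = inverse x"
proof -
  let ?R = "ring_of_type_algebra :: real ring"
  interpret R: field ?R by (rule field_from_type_algebra)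
  show "\<ominus>\<^bsub>?R\<^esub> x = - x"
    by (rule R.minus_equality) (simp_all add: ring_of_type_algebra_def)
  show "inv\<^bsub>?R\<^esub> x = inverse x" if "x \<noteq> 0"
    by (rule R.comm_inv_char) (use that in \<open>simp_all add: ring_of_type_algebra_def\<close>)
qed (simp_all add: ring_of_type_algebra_def)

locale transcendental_real =
  fixes t :: real
  assumes transcendental: "\<not> algebraic t"
begin

abbreviation ev :: "int poly \<Rightarrow> real" where
  "ev \<equiv> eval_at t"

abbreviation K :: "real set" where
  "K \<equiv> rational_functions_at t"

text \<open>This is where transcendence enters: a nonzero integer polynomial vanishing at
  \<open>t\<close> would make \<open>t\<close> algebraic.\<close>

lemma ev_eq_0_iff [simp]: "ev p = 0 \<longleftrightarrow> p = 0"
proof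
  assume "ev p = 0"
  then have root: "poly (map_poly of_int p :: real poly) t = 0" by (simp add: eval_at_def)
  have coeff: "Polynomial.coeff (map_poly of_int p :: real poly) i = of_int (Polynomial.coeff p i)" for i
    by (simp add: coeff_map_poly)
  show "p = 0"
  proof (rule ccontr)
    assume "p \<noteq> 0"
    then have "(map_poly of_int p :: real poly) \<noteq> 0"
      using coeff by (metis coeff_0 leading_coeff_0_iff of_int_eq_0_iff)
    then show False using algebraicI[of "map_poly of_int p" t] coeff root transcendental by simp
  qed
qed simp

lemma ev_eq_iff [simp]: "ev p = ev q \<longleftrightarrow> p = q"
proof
  assume eq: "ev p = ev q"
  have "ev (p + - q) = 0"
    by (simp only: eval_at_add eval_at_uminus eq add.right_inverse)
  then show "p = q" by simp
qed simp

section \<open>The field as a field of fractions of Z[t]\<close>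

lemma K_simps:
  "1 \<in> K" "t \<in> K" "x \<in> K \<Longrightarrow> - x \<in> K" "x \<in> K \<Longrightarrow> inverse x \<in> K"
  "x \<in> K \<Longrightarrow> y \<in> K \<Longrightarrow> x + y \<in> K" "x \<in> K \<Longrightarrow> y \<in> K \<Longrightarrow> x * y \<in> K"
proof -
  let ?R = "ring_of_type_algebra :: real ring"
  show "1 \<in> K" "t \<in> K"
    using generate_field.one[of ?R "{t}"] generate_field.incl[of t "{t}" ?R]
    by (simp_all add: rational_functions_at_def ring_of_type_algebra_def)
  show "- x \<in> K" if "x \<in> K"
    using generate_field.a_inv[of x ?R "{t}"] that
    by (simp add: rational_functions_at_def ring_of_type_real)
  show "inverse x \<in> K" if "x \<in> K"
    using generate_field.m_inv[of x ?R "{t}"] that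
    by (cases "x = 0") (simp_all add: rational_functions_at_def ring_of_type_real)
  show "x + y \<in> K" if "x \<in> K" "y \<in> K"
    using generate_field.eng_add[of x ?R "{t}" y] that
    by (simp add: rational_functions_at_def ring_of_type_real)
  show "x * y \<in> K" if "x \<in> K" "y \<in> K"
    using generate_field.eng_mult[of x ?R "{t}" y] that
    by (simp add: rational_functions_at_def ring_of_type_real)
qed

lemma K_cases:
  assumes "x \<in> K" obtains p q where "q \<noteq> 0" "x = ev p / ev q"
proof -
  have "\<exists>p q. q \<noteq> 0 \<and> x = ev p / ev q"
    using assms unfolding rational_functions_at_def
  proof (induction rule: generate_field.induct)
    case one
    show ?case by (rule exI[of _ 1], rule exI[of _ 1]) (simp add: ring_of_type_real)
  next
    case (incl h)
    then show ?case by (intro exI[of _ "[:0, 1:]"] exI[of _ 1]) simp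
  next
    case (a_inv h)
    then obtain p q where "q \<noteq> 0" "h = ev p / ev q" by blast
    then show ?case
      by (intro exI[of _ "- p"] exI[of _ q]) (simp add: ring_of_type_real eval_at_uminus)
  next
    case (m_inv h)
    then obtain p q where "q \<noteq> 0" "h = ev p / ev q" by blast
    then show ?case using m_inv(2)
      by (intro exI[of _ q] exI[of _ p]) (auto simp: ring_of_type_real)
  next
    case (eng_add h1 h2)
    then obtain p q p' q' where "q \<noteq> 0" "h1 = ev p / ev q" "q' \<noteq> 0" "h2 = ev p' / ev q'" by blast
    then show ?case
      by (intro exI[of _ "p * q' + p' * q"] exI[of _ "q * q'"])
        (simp add: ring_of_type_real eval_at_add eval_at_mult add_frac_eq)
  next
    case (eng_mult h1 h2)
    then obtain p q p' q' where "q \<noteq> 0" "h1 = ev p / ev q" "q' \<noteq> 0" "h2 = ev p' / ev q'" by blast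
    then show ?case
      by (intro exI[of _ "p * p'"] exI[of _ "q * q'"]) (simp add: ring_of_type_real eval_at_mult)
  qed
  then show ?thesis using that by blast
qed

lemma zero_in_K: "0 \<in> K"
  using K_simps(1,3,5) by (metis add.right_inverse)

lemma diff_in_K: "x \<in> K \<Longrightarrow> y \<in> K \<Longrightarrow> x - y \<in> K"
  using K_simps(5)[of x "- y"] K_simps(3) by simp

lemma divide_in_K: "x \<in> K \<Longrightarrow> y \<in> K \<Longrightarrow> x / y \<in> K"
  using K_simps(6)[of x "inverse y"] K_simps(4) by (simp add: divide_inverse)

lemma of_int_in_K: "real_of_int c \<in> K"
proof (induction c rule: int_induct[where k = 0])
  case (step1 i)
  then show ?case using K_simps(1,5) by simp
next
  case (step2 i)
  then show ?case using K_simps(1) diff_in_K by simp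
qed (simp add: zero_in_K)

lemma ev_in_K: "ev p \<in> K"
  by (induction p) (simp_all add: zero_in_K of_int_in_K K_simps)

lemma countable_K: "countable K"
proof -
  have "K \<subseteq> (\<lambda>(p, q). ev p / ev q) ` (UNIV \<times> UNIV)"
    by (auto elim!: K_cases)
  then show ?thesis
    using countable_subset countable_image countable_SIGMA countable_int_poly by metis
qed

definition val :: "(int poly \<Rightarrow> int) \<Rightarrow> real \<Rightarrow> int" where
  "val \<mu> x = (THE k. \<exists>p q. p \<noteq> 0 \<and> q \<noteq> 0 \<and> x = ev p / ev q \<and> k = \<mu> p - \<mu> q)"

text \<open>Equal fractions give equal products in Z[t] after cross-multiplication,
  \<open>ev\<close> being injective, and additivity of \<open>\<mu>\<close> makes the differences
  agree.\<close>

lemma val_fraction: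
  assumes \<mu>: "discrete_valuation \<mu>" and "p \<noteq> 0" "q \<noteq> 0"
  shows "val \<mu> (ev p / ev q) = \<mu> p - \<mu> q"
  unfolding val_def
proof (rule the_equality)
  fix k assume "\<exists>p' q'. p' \<noteq> 0 \<and> q' \<noteq> 0 \<and> ev p / ev q = ev p' / ev q' \<and> k = \<mu> p' - \<mu> q'"
  then obtain p' q' where *: "p' \<noteq> 0" "q' \<noteq> 0" "ev p / ev q = ev p' / ev q'" "k = \<mu> p' - \<mu> q'"
    by blast
  then have "ev (p * q') = ev (p' * q)"
    using assms by (simp add: eval_at_mult frac_eq_eq)
  then have "\<mu> (p * q') = \<mu> (p' * q)" by simp
  then have "\<mu> p + \<mu> q' = \<mu> p' + \<mu> q"
    using \<mu> assms(2,3) *(1,2) by (simp add: discrete_valuation_def)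
  then show "k = \<mu> p - \<mu> q" using *(4) by simp
qed (use assms in blast)

text \<open>Over a common denominator both laws reduce to those of \<open>\<mu>\<close> on
  Z[t].\<close>

lemma valued_field_val:
  assumes \<mu>: "discrete_valuation \<mu>" shows "valued_field K (val \<mu>)"
proof (rule valued_field.intro)
  fix x y assume xy: "x \<in> K" "y \<in> K" "x \<noteq> 0" "y \<noteq> 0"
  obtain p q where x: "q \<noteq> 0" "x = ev p / ev q" using xy(1) by (rule K_cases)
  obtain r s where y: "s \<noteq> 0" "y = ev r / ev s" using xy(2) by (rule K_cases)
  have nz: "p \<noteq> 0" "r \<noteq> 0" using xy x y by auto
  have mult: "\<mu> (f * g) = \<mu> f + \<mu> g" if "f \<noteq> 0" "g \<noteq> 0" for f g
    using \<mu> that by (simp add: discrete_valuation_def)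
  have "x * y = ev (p * r) / ev (q * s)"
    by (simp add: x y eval_at_mult)
  then have "val \<mu> (x * y) = \<mu> (p * r) - \<mu> (q * s)"
    using val_fraction[OF \<mu>, of "p * r" "q * s"] x y nz by simp
  then show "val \<mu> (x * y) = val \<mu> x + val \<mu> y"
    using val_fraction[OF \<mu>] x y nz mult by simp
  assume "x + y \<noteq> 0"
  moreover have sum: "x + y = ev (p * s + r * q) / ev (q * s)"
    using x y by (simp add: eval_at_add eval_at_mult add_frac_eq)
  ultimately have nz': "p * s + r * q \<noteq> 0" by auto
  have "val \<mu> (x + y) = \<mu> (p * s + r * q) - \<mu> (q * s)"
    unfolding sum using val_fraction[OF \<mu> nz'] x y by simp
  moreover have "min (\<mu> (p * s)) (\<mu> (r * q)) \<le> \<mu> (p * s + r * q)"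
    using \<mu>[unfolded discrete_valuation_def, rule_format, of "p * s" "r * q"] nz nz' x y by simp
  ultimately show "min (val \<mu> x) (val \<mu> y) \<le> val \<mu> (x + y)"
    using val_fraction[OF \<mu>] x y nz mult by simp
qed (use K_simps in auto)

abbreviation prime_val :: "int poly \<Rightarrow> real \<Rightarrow> int" where
  "prime_val q \<equiv> val (\<lambda>p. int (multiplicity q p))"

abbreviation degree_val :: "real \<Rightarrow> int" where
  "degree_val \<equiv> val (\<lambda>p. - int (Polynomial.degree p))"

text \<open>Z[t] is factorial, so divisibility of the numerator by the denominator can be tested at
  primes. The prime numbers are among these, hence the quotient has integer coefficients.\<close>

lemma integral_element:
  assumes x: "x \<in> K" "x \<noteq> 0" and val: "\<And>q. Factorial_Ring.prime q \<Longrightarrow> 0 \<le> prime_val q x"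
  obtains p where "x = ev p"
proof -
  obtain r s where rs: "s \<noteq> 0" "x = ev r / ev s" using x(1) by (rule K_cases)
  have r: "r \<noteq> 0" using x(2) rs by auto
  have "s dvd r"
  proof (rule multiplicity_le_imp_dvd[OF rs(1)])
    show "multiplicity q s \<le> multiplicity q r" if "Factorial_Ring.prime q" for q
      using val[OF that] val_fraction[OF discrete_valuation_multiplicity[OF that] r rs(1)] rs(2)
      by simp
  qed
  then obtain p where "r = s * p" by (rule dvdE)
  then have "x = ev p" using rs by (simp add: eval_at_mult)
  then show ?thesis by (rule that)
qed

text \<open>An element without zeros and poles is a unit of Z[t], that is, 1 or -1; positivity
  leaves 1.\<close>

lemma unit_element:
  assumes x: "x \<in> K" "0 < x" and val: "\<And>q. Factorial_Ring.prime q \<Longrightarrow> prime_val q x = 0"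
  shows "x = 1"
proof -
  obtain p where p: "x = ev p"
    by (rule integral_element[OF x(1)]) (use x(2) val in auto)
  have p0: "p \<noteq> 0" using p x(2) by auto
  have "is_unit p"
  proof (rule ccontr)
    assume "\<not> is_unit p"
    then obtain q where q: "Factorial_Ring.prime q" "q dvd p"
      using prime_divisor_exists[of p] p0 by blast
    then have "0 < multiplicity q p"
      using p0 prime_multiplicity_gt_zero_iff[of q p] by auto
    moreover have "prime_val q (ev p / ev 1) = int (multiplicity q p) - int (multiplicity q 1)"
      by (rule val_fraction[OF discrete_valuation_multiplicity[OF q(1)] p0]) simp
    ultimately show False using val[OF q(1)] p by simp
  qed
  then obtain c where "p = [:c:]" "is_unit c" by (rule is_unit_polyE)
  then have "x = 1 \<or> x = -1" using p by (auto simp: zdvd1_eq)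
  then show ?thesis using x(2) by auto
qed

text \<open>Only prime factors of numerator or denominator can occur. This makes the subgroups
  \<open>\<Gamma> n\<close> exhaust the group.\<close>

lemma finite_support_val:
  assumes x: "x \<in> K" "x \<noteq> 0" shows "finite {q. Factorial_Ring.prime q \<and> prime_val q x \<noteq> 0}"
proof -
  obtain r s where rs: "s \<noteq> 0" "x = ev r / ev s" using x(1) by (rule K_cases)
  have r: "r \<noteq> 0" using x(2) rs by auto
  have "q \<in> prime_factors r \<union> prime_factors s" if q: "Factorial_Ring.prime q" "prime_val q x \<noteq> 0" for q
  proof (rule ccontr)
    assume "q \<notin> prime_factors r \<union> prime_factors s"
    then have "multiplicity q r = 0" "multiplicity q s = 0"
      using q(1) r rs(1) by (auto simp: prime_factors_multiplicity)
    then show False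
      using q(2) val_fraction[OF discrete_valuation_multiplicity[OF q(1)] r rs(1)] rs(2) by simp
  qed
  then have "{q. Factorial_Ring.prime q \<and> prime_val q x \<noteq> 0} \<subseteq> prime_factors r \<union> prime_factors s" by blast
  then show ?thesis by (rule finite_subset) simp
qed

end

section \<open>The affine group\<close>

context transcendental_real
begin

lemma prime_val_ev:
  "Factorial_Ring.prime q \<Longrightarrow> p \<noteq> 0 \<Longrightarrow> prime_val q (ev p) = int (multiplicity q p)"
  using val_fraction[OF discrete_valuation_multiplicity, of q p 1] by simp

lemma degree_val_ev: "p \<noteq> 0 \<Longrightarrow> degree_val (ev p) = - int (Polynomial.degree p)"
  using val_fraction[OF discrete_valuation_degree, of p 1] by simp

text \<open>\<open>D\<close> is a common denominator of the translation parts, which thus become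
  polynomials with \<open>N\<close> integer coefficients. These coefficients are the additive
  functions required by \<open>HF_1_lattice\<close>.\<close>

lemma HF_1_translations:
  fixes H :: "'g monoid"
  assumes H: "affine_coordinates H K a b" and a: "\<And>g. g \<in> carrier H \<Longrightarrow> a g = 1"
    and D: "D \<noteq> 0"
    and bounded: "\<And>g. g \<in> carrier H \<Longrightarrow> \<exists>p. D * b g = ev p \<and> Polynomial.degree p < N"
  shows "HF 1 H"
proof -
  interpret affine_coordinates H K a b by (rule H)
  define P where "P g = (THE p. ev p = D * b g)" for g
  have P: "P g = p" if "ev p = D * b g" for g p
    unfolding P_def using that by (intro the_equality) (simp_all flip: that)
  have ev_P: "ev (P g) = D * b g" "Polynomial.degree (P g) < N" if "g \<in> carrier H" for g
    using bounded[OF that] P by auto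
  show ?thesis
  proof (rule HF_1_lattice[where f = "\<lambda>i g. Polynomial.coeff (P g) i" and n = N])
    fix g h assume gh: "g \<in> carrier H" "h \<in> carrier H"
    have "P (g \<otimes>\<^bsub>H\<^esub> h) = P g + P h"
      using gh by (intro P) (simp add: eval_at_add ev_P b_mult a algebra_simps)
    then show "Polynomial.coeff (P (g \<otimes>\<^bsub>H\<^esub> h)) i = Polynomial.coeff (P g) i + Polynomial.coeff (P h) i"
      for i by simp
  next
    fix g assume g: "g \<in> carrier H" and zero: "\<And>i. i < N \<Longrightarrow> Polynomial.coeff (P g) i = 0"
    have "Polynomial.coeff (P g) i = 0" for i
      using zero[of i] ev_P(2)[OF g] coeff_eq_0[of "P g" i] by (cases "i < N") auto
    then have "P g = 0" by (simp add: poly_eq_iff)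
    then have "b g = 0" using ev_P(1)[OF g] D by simp
    then show "g = \<one>\<^bsub>H\<^esub>" using coords_eq[OF g] a[OF g] by simp
  qed (rule group)
qed

text \<open>Shaped for conjugates of \<open>\<Gamma> n\<close>: \<open>F\<close> will hold the first
  primes of the enumeration, and \<open>c\<close> is the factor by which conjugation rescales
  translations.\<close>

lemma HF_2_finitely_many_primes:
  fixes H :: "'g monoid"
  assumes H: "affine_coordinates H K a b" and F: "finite F" "\<And>q. q \<in> F \<Longrightarrow> Factorial_Ring.prime q"
    and c: "c \<in> K" "c \<noteq> 0"
    and units: "\<And>g q. g \<in> carrier H \<Longrightarrow> Factorial_Ring.prime q \<Longrightarrow> q \<notin> F \<Longrightarrow> prime_val q (a g) = 0"
    and integral: "\<And>g q. g \<in> carrier H \<Longrightarrow> a g = 1 \<Longrightarrow> b g \<noteq> 0 \<Longrightarrow> Factorial_Ring.prime q \<Longrightarrow>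
      q \<notin> F \<Longrightarrow> prime_val q c \<le> prime_val q (b g)"
  shows "HF 2 H"
proof -
  interpret affine_coordinates H K a b by (rule H)
  obtain e where e: "bij_betw e {0..<card F} F"
    using ex_bij_betw_nat_finite[OF F(1)] by blast
  have index: "\<exists>i<card F. e i = q" if "q \<in> F" for q
    using bij_betw_imp_surj_on[OF e] that by force
  have e_in: "e i \<in> F" if "i < card F" for i
    using bij_betw_imp_surj_on[OF e] that by force
  \<comment> \<open>The index \<open>card F\<close> is left for the degree, hence
    \<open>Suc (card F)\<close> trees.\<close>
  define w where "w i = (if i < card F then prime_val (e i) else degree_val)" for i
  have "HF (Suc 1) H"
  proof (rule HF_Suc_valuations[OF H countable_K, where n = "Suc (card F)" and w = w])
    show "valued_field K (w i)" for i
      using e_in F(2) by (auto simp: w_def intro!: valued_field_val discrete_valuation_degree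
          discrete_valuation_multiplicity)
  next
    fix S assume S: "subgroup S H"
      and w_a: "\<And>g i. g \<in> S \<Longrightarrow> i < Suc (card F) \<Longrightarrow> w i (a g) = 0"
      and w_b: "\<And>i. i < Suc (card F) \<Longrightarrow> \<exists>k. \<forall>g\<in>S. a g = 1 \<longrightarrow> b g \<noteq> 0 \<longrightarrow> k \<le> w i (b g)"
    have in_H: "g \<in> carrier H" if "g \<in> S" for g using subgroup.mem_carrier[OF S that] .
    have "prime_val q (a g) = 0" if "g \<in> S" "Factorial_Ring.prime q" for g q
    proof (cases "q \<in> F")
      case True
      then obtain i where "i < card F" "e i = q" using index by blast
      then show ?thesis using w_a[OF that(1), of i] by (simp add: w_def)
    qed (use units in_H that in blast)
    then have a1: "a g = 1" if "g \<in> S" for g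
      using unit_element[OF a_in a_pos] in_H that by blast
    have "\<exists>k. \<forall>g\<in>S. b g \<noteq> 0 \<longrightarrow> k \<le> prime_val q (b g)" if "q \<in> F" for q
    proof -
      obtain i where "i < card F" "e i = q" using index[OF \<open>q \<in> F\<close>] by blast
      then show ?thesis using w_b[of i] a1 by (simp add: w_def)
    qed
    then obtain k where k: "\<And>q g. q \<in> F \<Longrightarrow> g \<in> S \<Longrightarrow> b g \<noteq> 0 \<Longrightarrow> k q \<le> prime_val q (b g)"
      by metis
    obtain l where l: "\<And>g. g \<in> S \<Longrightarrow> b g \<noteq> 0 \<Longrightarrow> l \<le> degree_val (b g)"
      using w_b[of "card F"] a1 by (auto simp: w_def)
    \<comment> \<open>The exponents compensate the bounds \<open>k q\<close> at the primes of
      \<open>F\<close>, negative ones being cut off at 0. Elsewhere \<open>b\<close> is bounded by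
      \<open>c\<close>, so \<open>ev M / c\<close> clears all denominators.\<close>
    define M where "M = (\<Prod>q\<in>F. q ^ nat (prime_val q c - k q))"
    have "q \<noteq> 0" if "q \<in> F" for q using F(2)[OF that] by auto
    then have M0: "M \<noteq> 0" using F(1) by (auto simp: M_def)
    define D where "D = ev M / c"
    have D: "D \<in> K" "D \<noteq> 0" "ev M = D * c"
      using c M0 by (auto simp: D_def divide_in_K ev_in_K)
    \<comment> \<open>A nonzero \<open>D * b g\<close> has degree at most
      \<open>- (degree_val D + l)\<close>. \<open>Suc\<close> makes the bound strict and keeps
      \<open>N\<close> positive for the zero polynomial.\<close>
    define N where "N = Suc (nat (- (degree_val D + l)))"
    have "HF 1 (H\<lparr>carrier := S\<rparr>)"
    proof (rule HF_1_translations[OF restrict_subgroup[OF S] _ D(2), where N = N])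
      show "a g = 1" if "g \<in> carrier (H\<lparr>carrier := S\<rparr>)" for g using a1 that by simp
    next
      fix g assume "g \<in> carrier (H\<lparr>carrier := S\<rparr>)"
      then have g: "g \<in> S" by simp
      show "\<exists>p. D * b g = ev p \<and> Polynomial.degree p < N"
      proof (cases "b g = 0")
        case True
        then show ?thesis by (intro exI[of _ 0]) (simp add: N_def)
      next
        case False
        have bK: "b g \<in> K" using b_in in_H g by blast
        have "0 \<le> prime_val q (D * b g)" if q: "Factorial_Ring.prime q" for q
        proof -
          interpret v: valued_field K "prime_val q"
            by (rule valued_field_val[OF discrete_valuation_multiplicity[OF q]])
          have "int (multiplicity q M) = prime_val q D + prime_val q c"
            using v.val_mult[OF D(1) c(1) D(2) c(2)] prime_val_ev[OF q M0] D(3) by simp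
          moreover have "prime_val q c \<le> int (multiplicity q M) + prime_val q (b g)"
          proof (cases "q \<in> F")
            case True
            then have "q ^ nat (prime_val q c - k q) dvd M"
              unfolding M_def using F(1) by (rule dvd_prodI[rotated])
            then have "nat (prime_val q c - k q) \<le> multiplicity q M"
              using q M0 by (intro multiplicity_geI) auto
            then show ?thesis using k[OF True g False] by linarith
          next
            case False
            then show ?thesis
              using integral[OF in_H[OF g] a1[OF g] \<open>b g \<noteq> 0\<close> q] by simp
          qed
          ultimately show ?thesis
            using v.val_mult[OF D(1) bK D(2) False] by simp
        qed
        then obtain p where p: "D * b g = ev p"
          using integral_element[of "D * b g"] K_simps(6)[OF D(1) bK] D(2) False by auto
        have p0: "p \<noteq> 0" using p D(2) False by auto
        interpret v: valued_field K degree_val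
          by (rule valued_field_val[OF discrete_valuation_degree])
        have "- int (Polynomial.degree p) = degree_val D + degree_val (b g)"
          using v.val_mult[OF D(1) bK D(2) False] degree_val_ev[OF p0] p by simp
        then have "Polynomial.degree p < N" using l[OF g False] by (simp add: N_def)
        then show ?thesis using p by blast
      qed
    qed
    then show "HF 1 (H\<lparr>carrier := S\<rparr>)" .
  qed
  then show ?thesis by (simp only: numeral_2_eq_2 One_nat_def)
qed

lemma HF_3_affine_coordinates:
  fixes G :: "'g monoid"
  assumes G: "affine_coordinates G K a b" and countable: "countable (carrier G)"
  shows "HF 3 G"
proof -
  interpret affine_coordinates G K a b by (rule G)
  interpret G: group G by (rule group)
  let ?primes = "{q :: int poly. Factorial_Ring.prime q}"
  have inj: "inj_on (to_nat_on ?primes) ?primes"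
    by (rule inj_on_to_nat_on) (rule countable_subset[OF subset_UNIV countable_int_poly])
  \<comment> \<open>Conditions are imposed at primes numbered \<open>n\<close> or higher, so they
    weaken as \<open>n\<close> grows and exempt finitely many primes only.\<close>
  define late where "late n q \<longleftrightarrow> Factorial_Ring.prime q \<and> n \<le> to_nat_on ?primes q" for n q
  define \<Gamma> where "\<Gamma> n = {g \<in> carrier G. \<forall>q. late n q \<longrightarrow>
    prime_val q (a g) = 0 \<and> (b g = 0 \<or> 0 \<le> prime_val q (b g))}" for n
  have nz: "a g \<noteq> 0" if "g \<in> carrier G" for g using a_pos[OF that] by simp
  have "HF (Suc 2) G"
  proof (rule HF_Suc_directed_union[OF group countable, where \<Gamma> = \<Gamma>])
    fix n
    show "\<Gamma> n \<subseteq> \<Gamma> (Suc n)" by (auto simp: \<Gamma>_def late_def)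
    show "subgroup (\<Gamma> n) G"
    proof (rule G.subgroupI)
      show "\<Gamma> n \<subseteq> carrier G" by (auto simp: \<Gamma>_def)
      have "prime_val q 1 = 0" if "late n q" for q
        using that prime_val_ev[of q 1] by (simp add: late_def)
      then have "\<one>\<^bsub>G\<^esub> \<in> \<Gamma> n" by (simp add: \<Gamma>_def coords_one)
      then show "\<Gamma> n \<noteq> {}" by blast
    next
      fix g assume g: "g \<in> \<Gamma> n"
      then have gG: "g \<in> carrier G" by (simp add: \<Gamma>_def)
      show "inv\<^bsub>G\<^esub> g \<in> \<Gamma> n"
        unfolding \<Gamma>_def
      proof (intro CollectI conjI allI impI)
        show "inv\<^bsub>G\<^esub> g \<in> carrier G" using gG by simp
        fix q assume q: "late n q"
        interpret v: valued_field K "prime_val q"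
          using q by (intro valued_field_val discrete_valuation_multiplicity) (simp add: late_def)
        have va: "prime_val q (a g) = 0" and vb: "v.val_ge 0 (b g)"
          using g q by (auto simp: \<Gamma>_def v.val_ge_def)
        have inv: "inverse (a g) \<in> K" using v.inverse_in[OF a_in[OF gG]] .
        have vinv: "prime_val q (inverse (a g)) = 0"
          using v.val_mult[OF a_in[OF gG] inv] nz[OF gG] va v.val_one by simp
        then show "prime_val q (a (inv\<^bsub>G\<^esub> g)) = 0"
          by (simp add: coords_inv[OF gG] inverse_eq_divide)
        have "v.val_ge 0 (inverse (a g) * b g)"
          using v.val_ge_scale[OF inv _ b_in[OF gG], of 0] vb vinv nz[OF gG] by simp
        then have "v.val_ge 0 (- (inverse (a g) * b g))"
          using v.val_ge_minus v.mult_in[OF inv b_in[OF gG]] by blast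
        moreover have "b (inv\<^bsub>G\<^esub> g) = - (inverse (a g) * b g)"
          using nz[OF gG] by (simp add: coords_inv[OF gG] field_simps)
        ultimately show "b (inv\<^bsub>G\<^esub> g) = 0 \<or> 0 \<le> prime_val q (b (inv\<^bsub>G\<^esub> g))"
          by (simp only: v.val_ge_def)
      qed
    next
      fix g h assume g: "g \<in> \<Gamma> n" and h: "h \<in> \<Gamma> n"
      then have gh: "g \<in> carrier G" "h \<in> carrier G" by (simp_all add: \<Gamma>_def)
      show "g \<otimes>\<^bsub>G\<^esub> h \<in> \<Gamma> n"
        unfolding \<Gamma>_def
      proof (intro CollectI conjI allI impI)
        show "g \<otimes>\<^bsub>G\<^esub> h \<in> carrier G" using gh by simp
        fix q assume q: "late n q"
        interpret v: valued_field K "prime_val q"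
          using q by (intro valued_field_val discrete_valuation_multiplicity) (simp add: late_def)
        have va: "prime_val q (a g) = 0" "prime_val q (a h) = 0"
          and vb: "v.val_ge 0 (b g)" "v.val_ge 0 (b h)"
          using g h q by (auto simp: \<Gamma>_def v.val_ge_def)
        show "prime_val q (a (g \<otimes>\<^bsub>G\<^esub> h)) = 0"
          using va gh by (simp add: a_mult v.val_mult a_in nz)
        have "v.val_ge 0 (a g * b h)"
          using v.val_ge_scale[OF a_in[OF gh(1)] nz[OF gh(1)] b_in[OF gh(2)], of 0] vb va by simp
        then have "v.val_ge 0 (a g * b h + b g)"
          using vb gh by (intro v.val_ge_add v.mult_in a_in b_in)
        then show "b (g \<otimes>\<^bsub>G\<^esub> h) = 0 \<or> 0 \<le> prime_val q (b (g \<otimes>\<^bsub>G\<^esub> h))"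
          by (simp only: v.val_ge_def b_mult[OF gh])
      qed
    qed
  next
    have "g \<in> (\<Union>n. \<Gamma> n)" if g: "g \<in> carrier G" for g
    proof -
      \<comment> \<open>Only a prime at which a nonzero entry has a zero or a pole can obstruct
        membership; a bound on the numbers of these primes serves as \<open>n\<close>.\<close>
      let ?bad = "\<lambda>x. {q. Factorial_Ring.prime q \<and> prime_val q x \<noteq> 0}"
      let ?S = "?bad (a g) \<union> (if b g = 0 then {} else ?bad (b g))"
      have "finite ?S"
        using finite_support_val[OF a_in[OF g] nz[OF g]] finite_support_val[OF b_in[OF g]] by simp
      then obtain n where n: "\<And>q. q \<in> ?S \<Longrightarrow> to_nat_on ?primes q < n"
        using finite_nat_set_iff_bounded[of "to_nat_on ?primes ` ?S"] by blast
      have "prime_val q (a g) = 0 \<and> (b g = 0 \<or> 0 \<le> prime_val q (b g))" if "late n q" for q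
        using n[of q] that unfolding late_def by (cases "q \<in> ?S") (auto split: if_splits)
      then show ?thesis using g by (auto simp: \<Gamma>_def)
    qed
    then show "carrier G = (\<Union>n. \<Gamma> n)" by (auto simp: \<Gamma>_def)
  next
    fix n g assume g: "g \<in> carrier G"
    let ?H = "{x \<in> carrier G. inv\<^bsub>G\<^esub> g \<otimes>\<^bsub>G\<^esub> x \<otimes>\<^bsub>G\<^esub> g \<in> \<Gamma> n}"
    assume sub: "subgroup ?H G"
    let ?F = "{q \<in> ?primes. to_nat_on ?primes q < n}"
    show "HF 2 (G\<lparr>carrier := ?H\<rparr>)"
    \<comment> \<open>Conjugation by the inverse of \<open>g\<close> leaves \<open>a x\<close>
      unchanged and divides the translation part of a translation by \<open>a g\<close>; this is the
      origin of \<open>c\<close>.\<close>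
    proof (rule HF_2_finitely_many_primes[OF restrict_subgroup[OF sub], where F = ?F and c = "a g"])
      have "to_nat_on ?primes ` ?F \<subseteq> {..<n}" by auto
      then have "finite (to_nat_on ?primes ` ?F)" by (rule finite_subset) simp
      moreover have "inj_on (to_nat_on ?primes) ?F" by (rule inj_on_subset[OF inj]) blast
      ultimately show "finite ?F" by (rule finite_imageD)
      show "a g \<in> K" "a g \<noteq> 0" using a_in nz g by blast+
    next
      fix x q assume x: "x \<in> carrier (G\<lparr>carrier := ?H\<rparr>)"
        and q: "Factorial_Ring.prime q" "q \<notin> ?F"
      have "late n q" using q by (auto simp: late_def)
      moreover have xG: "x \<in> carrier G" and "inv\<^bsub>G\<^esub> g \<otimes>\<^bsub>G\<^esub> x \<otimes>\<^bsub>G\<^esub> g \<in> \<Gamma> n"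
        using x by auto
      ultimately have val: "prime_val q (a (inv\<^bsub>G\<^esub> g \<otimes>\<^bsub>G\<^esub> x \<otimes>\<^bsub>G\<^esub> g)) = 0"
        "b (inv\<^bsub>G\<^esub> g \<otimes>\<^bsub>G\<^esub> x \<otimes>\<^bsub>G\<^esub> g) = 0 \<or> 0 \<le> prime_val q (b (inv\<^bsub>G\<^esub> g \<otimes>\<^bsub>G\<^esub> x \<otimes>\<^bsub>G\<^esub> g))"
        by (auto simp: \<Gamma>_def)
      have "a (inv\<^bsub>G\<^esub> g \<otimes>\<^bsub>G\<^esub> x \<otimes>\<^bsub>G\<^esub> g) = a x"
        using g xG nz[OF g] by (simp add: a_mult coords_inv)
      then show "prime_val q (a x) = 0" using val(1) by simp
      assume a1: "a x = 1" and b0: "b x \<noteq> 0"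
      interpret v: valued_field K "prime_val q"
        by (intro valued_field_val discrete_valuation_multiplicity q)
      have "b (inv\<^bsub>G\<^esub> g \<otimes>\<^bsub>G\<^esub> x \<otimes>\<^bsub>G\<^esub> g) = b x / a g"
        using g xG nz[OF g] a1 by (simp add: a_mult b_mult coords_inv add_divide_distrib)
      then have "0 \<le> prime_val q (b x / a g)" using val(2) b0 nz[OF g] by simp
      moreover have "prime_val q (b x / a g * a g) = prime_val q (b x / a g) + prime_val q (a g)"
        using b0 nz[OF g] by (intro v.val_mult v.divide_in a_in b_in g xG) simp_all
      ultimately show "prime_val q (a g) \<le> prime_val q (b x)" using nz[OF g] by simp
    qed simp
  qed
  then show ?thesis by (simp only: eval_nat_numeral)
qed

end

section \<open>The matrix group in affine coordinates\<close>

lemma affine_matrix_nth [simp]: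
  "affine_matrix a b $ 1 $ 1 = a" "affine_matrix a b $ 1 $ 2 = b"
  "affine_matrix a b $ 2 $ 1 = 0" "affine_matrix a b $ 2 $ 2 = 1"
  by (simp_all add: affine_matrix_def)

lemma affine_matrix_mult:
  "affine_matrix a b ** affine_matrix c d = affine_matrix (a * c) (a * d + b)"
  by (simp add: vec_eq_iff forall_2 matrix_matrix_mult_def sum_2)

lemma affine_matrix_one: "mat 1 = affine_matrix 1 0"
  by (simp add: vec_eq_iff forall_2 mat_def)

lemma affine_group_simps:
  "carrier (affine_group t) = affine_matrices t"
  "x \<otimes>\<^bsub>affine_group t\<^esub> y = x ** y" "\<one>\<^bsub>affine_group t\<^esub> = mat 1"
  by (simp_all add: affine_group_def GL2_def mat2_monoid_def units_of_def)

context transcendental_real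
begin

lemma affine_matricesI: "a \<in> K \<Longrightarrow> b \<in> K \<Longrightarrow> 0 < a \<Longrightarrow> affine_matrix a b \<in> affine_matrices t"
  by (auto simp: affine_matrices_def)

lemma group_affine_group: "group (affine_group t)"
proof (rule groupI, unfold affine_group_simps)
  fix x y assume "x \<in> affine_matrices t" "y \<in> affine_matrices t"
  then show "x ** y \<in> affine_matrices t"
    by (auto simp: affine_matrices_def[of t] affine_matrix_mult)
      (metis K_simps(5,6) mult_pos_pos)
next
  show "mat 1 \<in> affine_matrices t"
    by (simp add: affine_matrix_one affine_matricesI K_simps zero_in_K)
next
  fix x y z :: "real^2^2" show "x ** y ** z = x ** (y ** z)" by (simp add: matrix_mul_assoc)
next
  fix x :: "real^2^2" show "mat 1 ** x = x" by simp
next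
  fix x assume "x \<in> affine_matrices t"
  then obtain a b where x: "x = affine_matrix a b" "a \<in> K" "b \<in> K" "0 < a"
    by (auto simp: affine_matrices_def)
  then have "affine_matrix (1 / a) (- b / a) ** x = mat 1"
    by (simp add: affine_matrix_mult affine_matrix_one)
  moreover have "affine_matrix (1 / a) (- b / a) \<in> affine_matrices t"
    using x by (intro affine_matricesI divide_in_K K_simps) simp_all
  ultimately show "\<exists>y\<in>affine_matrices t. y ** x = mat 1" by blast
qed

lemma affine_coordinates_affine_group:
  "affine_coordinates (affine_group t) K (\<lambda>A. A $ 1 $ 1) (\<lambda>A. A $ 1 $ 2)"
proof (rule affine_coordinates.intro[OF group_affine_group], unfold affine_group_simps)
qed (auto simp: affine_matrices_def affine_matrix_mult affine_matrix_one)

lemma countable_affine_group: "countable (carrier (affine_group t))"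
proof -
  have "affine_matrices t \<subseteq> (\<lambda>(a, b). affine_matrix a b) ` (K \<times> K)"
    by (auto simp: affine_matrices_def)
  then show ?thesis
    unfolding affine_group_simps
    by (rule countable_subset) (intro countable_image countable_SIGMA countable_K)
qed

end

theorem corollary2p8:
  fixes t :: real
  assumes "\<not> algebraic t"
  shows "HF 3 (affine_group t)"
proof -
  interpret transcendental_real t by (rule transcendental_real.intro[OF assms])
  show ?thesis
    by (rule HF_3_affine_coordinates[OF affine_coordinates_affine_group countable_affine_group])
qed

end
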